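(* Let $\alpha\in(\tfrac12,1)$, $s=p^{1-\alpha}$, $A=\sqrt{2r\log p/n}$ with $0<r<\rho^*(\alpha)$, and $\mathbf X\in\mathrm{SubG}(\sigma^2)$. Then $$\lim_{p\to\infty}\frac{\log(1-\mathrm{Risk}(s,A))}{\log p}=\begin{cases} r-\left(\alpha-\tfrac12\right), & \text{if } 4r\le1 \text{ and } n/(p^{13/6}\log p)\to\infty,\\[2pt] 1-\alpha-(1-\sqrt r)^2, & \text{if } 4r>1 \text{ and } n/(p^{2}\log p)\to\infty.\end{cases}$$ The same conclusion holds (in both cases) for $\mathbf X\in\mathcal O_n(p)$ with any $n\ge p$.
   Context: Setting: for each $p$ one observes $(\mathbf y,\mathbf X)$ with $\mathbf y=\mathbf X\boldsymbol\beta+\boldsymbol\varepsilon$, where $\boldsymbol\varepsilon\sim\mathcal N(0,I_n)$, $\mathbf X$ is an $n\times p$ real matrix independent of $\boldsymbol\varepsilon$, $\boldsymbol\beta\in\mathbb R^p$ is unknown, and $n=n(p)\to\infty$ as $p\to\infty$. Design classes: $\mathbf X\in\mathrm{SubG}(\sigma^2)$ means the rows of $\mathbf X$ are i.i.d. centered isotropic ($\mathbb E[xx^T]=I_p$) sub-Gaussian random vectors with sub-Gaussian parameter $\sigma^2$ (for every unit $u$ and $t\in\mathbb R$, $\log\mathbb E e^{t\langle u,x\rangle}\le\sigma^2t^2/2$), and $\mathbf X^T\mathbf X$ is almost surely positive definite; $\mathbf X\in\mathcal O_n(p)$ means $\mathbf X^T\mathbf X=nI_p$. For an integer $s$ and $A>0$,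 $\Xi(s,A)=\{\boldsymbol\beta\in\mathbb R^p:|\mathrm{supp}(\boldsymbol\beta)|=s,\ |\beta_i|\ge A\text{ for }i\in\mathrm{supp}(\boldsymbol\beta)\}$. A test $T$ is a measurable $[0,1]$-valued function of $(\mathbf y,\mathbf X)$; $\mathbb P_{\boldsymbol\beta},\mathbb E_{\boldsymbol\beta}$ denote the law/expectation of $(\mathbf y,\mathbf X)$ (including the randomness of $\mathbf X$) under parameter $\boldsymbol\beta$, and $\mathbb P_0,\mathbb E_0$ those under $\boldsymbol\beta=0$. $\mathrm{Risk}(T,s,A)=\mathbb E_0[T]+\sup_{\boldsymbol\beta\in\Xi(s,A)}\mathbb E_{\boldsymbol\beta}[1-T]$ and $\mathrm{Risk}(s,A)=\inf_T\mathrm{Risk}(T,s,A)$. The sparsity is $s=p^{1-\alpha}$ (rounded to an integer) with $\alpha$ fixed; all limits are as $p\to\infty$. The detection threshold function is $\rho^*(\alpha)=\alpha-\tfrac12$ for $\tfrac12<\alpha<\tfrac34$ and $\rho^*(\alpha)=(1-\sqrt{1-\alpha})^2$ for $\tfrac34\le\alpha<1$. *)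

theory Defs
  imports "HOL-Probability.Probability"
begin

text \<open>Vectors in R^m are functions nat => real (meaningful on indices < m);
  an n x p matrix X is a function nat => nat => real with entry X i j
  (row i < n, column j < p).\<close>

definition Rspace :: "nat \<Rightarrow> (nat \<Rightarrow> real) measure" where
  "Rspace m = PiM {..<m} (\<lambda>_. borel)"

definition Xspace :: "nat \<Rightarrow> nat \<Rightarrow> (nat \<Rightarrow> nat \<Rightarrow> real) measure" where
  "Xspace n p = PiM {..<n} (\<lambda>_. Rspace p)"

definition Dspace :: "nat \<Rightarrow> nat \<Rightarrow> ((nat \<Rightarrow> real) \<times> (nat \<Rightarrow> nat \<Rightarrow> real)) measure" where
  "Dspace n p = Rspace n \<Otimes>\<^sub>M Xspace n p"

definition matvec :: "(nat \<Rightarrow> nat \<Rightarrow> real) \<Rightarrow> nat \<Rightarrow> (nat \<Rightarrow> real) \<Rightarrow> nat \<Rightarrow> real" where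
  "matvec X p \<beta> i = (\<Sum>j<p. X i j * \<beta> j)"

definition std_gauss :: "real measure" where
  "std_gauss = density lborel std_normal_density"

definition data_law :: "nat \<Rightarrow> nat \<Rightarrow> (nat \<Rightarrow> nat \<Rightarrow> real) measure \<Rightarrow> (nat \<Rightarrow> real)
    \<Rightarrow> ((nat \<Rightarrow> real) \<times> (nat \<Rightarrow> nat \<Rightarrow> real)) measure" where
  "data_law n p \<mu> \<beta> =
     distr (\<mu> \<Otimes>\<^sub>M PiM {..<n} (\<lambda>_. std_gauss)) (Dspace n p)
       (\<lambda>(X, e). (\<lambda>i\<in>{..<n}. matvec X p \<beta> i + e i, X))"

definition is_test :: "nat \<Rightarrow> nat \<Rightarrow> ((nat \<Rightarrow> real) \<times> (nat \<Rightarrow> nat \<Rightarrow> real) \<Rightarrow> real) \<Rightarrow> bool" where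
  "is_test n p T \<longleftrightarrow> T \<in> borel_measurable (Dspace n p) \<and>
     (\<forall>z\<in>space (Dspace n p). 0 \<le> T z \<and> T z \<le> 1)"

definition Xi :: "nat \<Rightarrow> nat \<Rightarrow> real \<Rightarrow> (nat \<Rightarrow> real) set" where
  "Xi p s A = {\<beta>. (\<forall>j\<ge>p. \<beta> j = 0) \<and> card {j\<in>{..<p}. \<beta> j \<noteq> 0} = s \<and>
                  (\<forall>j<p. \<beta> j \<noteq> 0 \<longrightarrow> A \<le> \<bar>\<beta> j\<bar>)}"

definition risk_test :: "nat \<Rightarrow> nat \<Rightarrow> (nat \<Rightarrow> nat \<Rightarrow> real) measure
    \<Rightarrow> ((nat \<Rightarrow> real) \<times> (nat \<Rightarrow> nat \<Rightarrow> real) \<Rightarrow> real) \<Rightarrow> nat \<Rightarrow> real \<Rightarrow> real" where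
  "risk_test n p \<mu> T s A =
     (\<integral>z. T z \<partial>data_law n p \<mu> (\<lambda>_. 0)) +
     (SUP \<beta>\<in>Xi p s A. \<integral>z. 1 - T z \<partial>data_law n p \<mu> \<beta>)"

definition minimax_risk :: "nat \<Rightarrow> nat \<Rightarrow> (nat \<Rightarrow> nat \<Rightarrow> real) measure \<Rightarrow> nat \<Rightarrow> real \<Rightarrow> real" where
  "minimax_risk n p \<mu> s A = (INF T\<in>{T. is_test n p T}. risk_test n p \<mu> T s A)"

definition subG_row :: "real \<Rightarrow> nat \<Rightarrow> (nat \<Rightarrow> real) measure \<Rightarrow> bool" where
  "subG_row \<sigma>2 p \<nu> \<longleftrightarrow> prob_space \<nu> \<and> sets \<nu> = sets (Rspace p) \<and>
     (\<forall>j<p. integrable \<nu> (\<lambda>x. x j) \<and> (\<integral>x. x j \<partial>\<nu>) = 0) \<and>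
     (\<forall>j<p. \<forall>k<p. integrable \<nu> (\<lambda>x. x j * x k) \<and>
        (\<integral>x. x j * x k \<partial>\<nu>) = (if j = k then 1 else 0)) \<and>
     (\<forall>u t. (\<Sum>j<p. (u j)\<^sup>2) = 1 \<longrightarrow>
        integrable \<nu> (\<lambda>x. exp (t * (\<Sum>j<p. u j * x j))) \<and>
        ln (\<integral>x. exp (t * (\<Sum>j<p. u j * x j)) \<partial>\<nu>) \<le> \<sigma>2 * t\<^sup>2 / 2)"

definition gram_pd :: "nat \<Rightarrow> nat \<Rightarrow> (nat \<Rightarrow> nat \<Rightarrow> real) \<Rightarrow> bool" where
  "gram_pd n p X \<longleftrightarrow> (\<forall>v. (\<exists>j<p. v j \<noteq> 0) \<longrightarrow>
      0 < (\<Sum>j<p. \<Sum>k<p. v j * (\<Sum>i<n. X i j * X i k) * v k))"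

definition SubG_design :: "real \<Rightarrow> nat \<Rightarrow> nat \<Rightarrow> (nat \<Rightarrow> nat \<Rightarrow> real) measure \<Rightarrow> bool" where
  "SubG_design \<sigma>2 n p \<mu> \<longleftrightarrow>
     (\<exists>\<nu>. subG_row \<sigma>2 p \<nu> \<and> \<mu> = PiM {..<n} (\<lambda>_. \<nu>)) \<and> (AE X in \<mu>. gram_pd n p X)"

definition Orth_design :: "nat \<Rightarrow> nat \<Rightarrow> (nat \<Rightarrow> nat \<Rightarrow> real) measure \<Rightarrow> bool" where
  "Orth_design n p \<mu> \<longleftrightarrow> prob_space \<mu> \<and> sets \<mu> = sets (Xspace n p) \<and>
     (AE X in \<mu>. \<forall>j<p. \<forall>k<p. (\<Sum>i<n. X i j * X i k) = (if j = k then real n else 0))"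

definition rho_star :: "real \<Rightarrow> real" where
  "rho_star \<alpha> = (if \<alpha> < 3/4 then \<alpha> - 1/2 else (1 - sqrt (1 - \<alpha>))\<^sup>2)"

definition rate :: "(nat \<Rightarrow> nat) \<Rightarrow> (nat \<Rightarrow> (nat \<Rightarrow> nat \<Rightarrow> real) measure) \<Rightarrow> real \<Rightarrow> real \<Rightarrow> nat \<Rightarrow> real" where
  "rate n \<mu> \<alpha> r p =
     ln (1 - minimax_risk (n p) p (\<mu> p) (nat (round (real p powr (1 - \<alpha>))))
              (sqrt (2 * r * ln (real p) / real (n p)))) / ln (real p)"

end

(*
  Let e(r) = 1/2 - alpha + r - (max 0 (2 sqrt r - 1))^2 / 2, which is the claimed limit in both cases
  and is continuous in r.  When the entries of X^T X / n are within eta/p of those of the identity,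
  n (1 + eta) I - X^T X is diagonally dominant, hence a sum of explicit rank-one matrices; appending
  the corresponding rows to X gives a design with Gram matrix n (1 + eta) I, which is more informative
  and equivalent to the Gaussian sequence model with r replaced by r (1 + eta).  In the same way,
  adding independent Gaussian noise to the least squares estimator gives exactly the sequence model
  with r (1 - eta).  For sub-Gaussian rows the entrywise condition fails with probability
  O(p^2 exp (- c n / p^2)), which is negligible because n / (p^2 log p) diverges.

  In the sequence model, the upper bound on 1 - Risk is a second moment computation for the likelihood
  ratio truncated at sqrt (2 log p), under a prior with one spike in each of s blocks.  The lower
  bound comes from counting coordinates above sqrt (2 q log p) in absolute value, q = min 1 (4 r): a
  clamped linear function of this count with slope of order p^(-(1-q)/2) gains s times the difference
  of the exceedance probabilities times that slope.
*)
theory Submission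
  imports Defs "HOL-Real_Asymp.Real_Asymp"
begin

section \<open>Standard Gaussian vectors\<close>

text \<open>The obstacle is that \<open>1 - Risk\<close> itself decays like a power of p. Showing
  that the risk tends to 1 is far too weak: every error must be compared with p^e(r), which leaves
  little room for approximating the law of the data. Both comparisons with the sequence model are
  therefore exact given the design, and the only loss besides the change of r is the probability of
  a bad design, which is eventually below every power of p. No rate for eta is required: the
  argument runs at fixed eta, continuity of e closes the gap at the end, and the logarithmic scale
  forgives constants and factors p^epsilon.

  The decompositions are explicit, with no matrix square root, for a second reason: on the testing
  side the added noise depends on X and becomes part of a test, so it has to be measurable in X.

  The truncation acts only for 4r > 1. The second moment of the plain likelihood ratio is then
  dominated by observations near 2 sqrt (2 r log p), beyond the maximum that p null coordinates
  typically reach.\<close>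

lemma sets_std_gauss [simp, measurable_cong]: "sets std_gauss = sets borel"
  by (simp add: std_gauss_def)

lemma space_std_gauss [simp]: "space std_gauss = UNIV"
  by (simp add: std_gauss_def)

lemma prob_space_std_gauss: "prob_space std_gauss"
  unfolding std_gauss_def by (rule prob_space_normal_density) simp

abbreviation gauss :: "nat set \<Rightarrow> (nat \<Rightarrow> real) measure" where
  "gauss I \<equiv> PiM I (\<lambda>_. std_gauss)"

interpretation gauss: product_sigma_finite "\<lambda>_::nat. std_gauss"
  by (simp add: product_sigma_finite_def prob_space_std_gauss prob_space_imp_sigma_finite)

lemma prob_space_gauss: "prob_space (gauss I)"
  by (intro prob_space_PiM prob_space_std_gauss)

lemma sets_gauss [measurable_cong]: "sets (gauss I) = sets (PiM I (\<lambda>_. borel))"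
  by (intro sets_PiM_cong) auto

lemma nn_integral_std_gauss:
  assumes [measurable]: "f \<in> borel_measurable borel"
  shows "(\<integral>\<^sup>+x. f x \<partial>std_gauss) = (\<integral>\<^sup>+x. ennreal (std_normal_density x) * f x \<partial>lborel)"
  unfolding std_gauss_def by (subst nn_integral_density) auto

text \<open>One-dimensional Cameron-Martin formula: the density of a unit-variance normal with mean
  \<open>v\<close> relative to \<open>std_gauss\<close> is
  \<open>exp (v * x - v\<^sup>2 / 2)\<close>.\<close>

lemma nn_integral_std_gauss_shift:
  assumes [measurable]: "f \<in> borel_measurable borel"
  shows "(\<integral>\<^sup>+x. f (x + v) \<partial>std_gauss) = (\<integral>\<^sup>+x. f x * ennreal (exp (v * x - v\<^sup>2 / 2)) \<partial>std_gauss)"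
proof -
  have "(\<integral>\<^sup>+x. f x * ennreal (exp (v * x - v\<^sup>2 / 2)) \<partial>std_gauss)
      = (\<integral>\<^sup>+x. ennreal (std_normal_density (x - v)) * f x \<partial>lborel)"
    by (subst nn_integral_std_gauss, simp)
       (auto intro!: nn_integral_cong simp: std_normal_density_def mult.commute mult.left_commute
          ennreal_mult'[symmetric] exp_add[symmetric] power2_eq_square algebra_simps diff_divide_distrib add_divide_distrib)
  also have "\<dots> = (\<integral>\<^sup>+x. ennreal (std_normal_density x) * f (x + v) \<partial>lborel)"
    by (subst nn_integral_real_affine[where c=1 and t=v]) (auto simp: add.commute)
  finally show ?thesis by (simp add: nn_integral_std_gauss)
qed

text \<open>The shift formula applied to the constant function 1.\<close>

lemma nn_integral_std_gauss_exp:
  "(\<integral>\<^sup>+x. ennreal (exp (v * x)) \<partial>std_gauss) = ennreal (exp (v\<^sup>2 / 2))"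
proof -
  interpret prob_space std_gauss by (rule prob_space_std_gauss)
  have "(\<integral>\<^sup>+x. ennreal (exp (v * x)) \<partial>std_gauss)
      = (\<integral>\<^sup>+x. ennreal (exp (v\<^sup>2/2)) * (1 * ennreal (exp (v * x - v\<^sup>2 / 2))) \<partial>std_gauss)"
    by (intro nn_integral_cong) (auto simp: ennreal_mult'[symmetric] exp_add[symmetric])
  also have "\<dots> = ennreal (exp (v\<^sup>2/2)) * (\<integral>\<^sup>+x. 1 \<partial>std_gauss)"
    by (subst nn_integral_cmult, simp, subst nn_integral_std_gauss_shift[symmetric]) auto
  finally show ?thesis by (simp add: emeasure_space_1[simplified])
qed

lemma std_gauss_exp_moment:
  "integrable std_gauss (\<lambda>x. exp (v * x))" "(\<integral>x. exp (v * x) \<partial>std_gauss) = exp (v\<^sup>2 / 2)"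
  using integral_eq_nn_integral[of "\<lambda>x. exp (v * x)" std_gauss] nn_integral_std_gauss_exp[of v]
  by (auto intro!: integrableI_nonneg)

text \<open>The weight turns the standard density into \<open>sqrt 2\<close> times the density of a
  centred normal law with variance 2.\<close>

lemma nn_integral_std_gauss_exp_sq:
  "(\<integral>\<^sup>+x. ennreal (exp (x\<^sup>2 / 4)) \<partial>std_gauss) = ennreal (sqrt 2)"
proof -
  have e: "x\<^sup>2 / 4 - x\<^sup>2/2 = - x\<^sup>2/4" for x::real by simp
  have "(\<integral>\<^sup>+x. ennreal (exp (x\<^sup>2 / 4)) \<partial>std_gauss)
     = (\<integral>\<^sup>+x. ennreal (sqrt 2) * ennreal (normal_density 0 (sqrt 2) x) \<partial>lborel)"
    by (subst nn_integral_std_gauss, simp, intro nn_integral_cong)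
       (simp add: std_normal_density_def normal_density_def ennreal_mult'[symmetric] exp_add[symmetric] real_sqrt_mult field_simps)
  also have "\<dots> = ennreal (sqrt 2) * emeasure (density lborel (normal_density 0 (sqrt 2))) UNIV"
    by (simp add: nn_integral_cmult emeasure_density)
  also have "\<dots> = ennreal (sqrt 2)"
    using prob_space.emeasure_space_1[OF prob_space_normal_density[of "sqrt 2" 0]] by simp
  finally show ?thesis .
qed

lemma nn_integral_std_gauss_uminus:
  assumes [measurable]: "f \<in> borel_measurable borel"
  shows "(\<integral>\<^sup>+x. f (- x) \<partial>std_gauss) = (\<integral>\<^sup>+x. f x \<partial>std_gauss)"
  by (simp add: nn_integral_std_gauss)
     (subst (2) nn_integral_real_affine[where c="-1" and t=0], auto simp: std_normal_density_def)

text \<open>A rotation is a composition of one-dimensional affine substitutions. For fixed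
  \<open>y\<close> the first argument becomes the new variable, the order of integration is swapped,
  and then the second argument is substituted; the Jacobians \<open>1 / \<bar>c\<bar>\<close> and
  \<open>\<bar>c\<bar>\<close> cancel. Division by \<open>c\<close> forces the separate case
  \<open>c = 0\<close>, a swap of the axes with a sign.\<close>

lemma nn_integral_lborel_rotation:
  fixes G :: "real \<Rightarrow> real \<Rightarrow> ennreal"
  assumes [measurable]: "case_prod G \<in> borel_measurable (borel \<Otimes>\<^sub>M borel)" and cs: "c\<^sup>2 + s\<^sup>2 = 1"
  shows "(\<integral>\<^sup>+y. (\<integral>\<^sup>+x. G (c * x + s * y) (c * y - s * x) \<partial>lborel) \<partial>lborel) = (\<integral>\<^sup>+y. (\<integral>\<^sup>+x. G x y \<partial>lborel) \<partial>lborel)"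
proof (cases "c = 0")
  case True
  then have s: "s \<noteq> 0" "\<bar>s\<bar> = 1" using cs by (auto simp: power2_eq_1_iff)
  have "(\<integral>\<^sup>+x. G (s * y) (- s * x) \<partial>lborel) = (\<integral>\<^sup>+x. G (s * y) x \<partial>lborel)" for y
    by (subst (2) nn_integral_real_affine[where c="-s" and t=0]) (auto simp: s)
  then have "(\<integral>\<^sup>+y. (\<integral>\<^sup>+x. G (c * x + s * y) (c * y - s * x) \<partial>lborel) \<partial>lborel)
      = (\<integral>\<^sup>+y. (\<integral>\<^sup>+x. G (s * y) x \<partial>lborel) \<partial>lborel)"
    by (simp add: True)
  also have "\<dots> = (\<integral>\<^sup>+y. (\<integral>\<^sup>+x. G x y \<partial>lborel) \<partial>lborel)"
  proof -
    have "(\<integral>\<^sup>+y. (\<integral>\<^sup>+x. G y x \<partial>lborel) \<partial>lborel) = \<bar>s\<bar> * (\<integral>\<^sup>+y. (\<integral>\<^sup>+x. G (0 + s * y) x \<partial>lborel) \<partial>lborel)"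
      by (rule nn_integral_real_affine) (use s in auto)
    moreover have "(\<integral>\<^sup>+y. (\<integral>\<^sup>+x. G y x \<partial>lborel) \<partial>lborel) = (\<integral>\<^sup>+y. (\<integral>\<^sup>+x. G x y \<partial>lborel) \<partial>lborel)"
      by (rule lborel_pair.Fubini') measurable
    ultimately show ?thesis using s by simp
  qed
  finally show ?thesis .
next
  case False
  have e: "(\<integral>\<^sup>+x. G (c * x + s * y) (c * y - s * x) \<partial>lborel)
      = ennreal (1 / \<bar>c\<bar>) * (\<integral>\<^sup>+x. G x (y / c - s * x / c) \<partial>lborel)" for y
  proof -
    \<comment> \<open>The second argument rewritten in terms of the new variable
      \<open>c * x + s * y\<close>, using \<open>1 - s\<^sup>2 = c\<^sup>2\<close>.\<close>
    have eq: "y / c - s * (c * x + s * y) / c = c * y - s * x" for x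
    proof -
      have "y / c - s * (c * x + s * y) / c = y * (1 - s\<^sup>2) / c - s * x"
        using False by (simp add: field_simps power2_eq_square)
      also have "1 - s\<^sup>2 = c * c" using cs by (simp add: power2_eq_square)
      finally show ?thesis using False by simp
    qed
    show ?thesis
      by (subst nn_integral_real_affine[where c=c and t="s * y" and f="\<lambda>x. G x (y / c - s * x / c)"])
         (use False in \<open>auto simp: mult.assoc[symmetric] ennreal_mult'[symmetric] eq add.commute\<close>)
  qed
  have "(\<integral>\<^sup>+y. (\<integral>\<^sup>+x. G (c * x + s * y) (c * y - s * x) \<partial>lborel) \<partial>lborel)
     = ennreal (1 / \<bar>c\<bar>) * (\<integral>\<^sup>+y. (\<integral>\<^sup>+x. G x (y / c - s * x / c) \<partial>lborel) \<partial>lborel)"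
    unfolding e by (subst nn_integral_cmult) auto
  also have "(\<integral>\<^sup>+y. (\<integral>\<^sup>+x. G x (y / c - s * x / c) \<partial>lborel) \<partial>lborel)
      = (\<integral>\<^sup>+x. (\<integral>\<^sup>+y. G x (y / c - s * x / c) \<partial>lborel) \<partial>lborel)"
    by (rule lborel_pair.Fubini') measurable
  also have "\<dots> = (\<integral>\<^sup>+x. ennreal \<bar>c\<bar> * (\<integral>\<^sup>+y. G x y \<partial>lborel) \<partial>lborel)"
  proof (intro nn_integral_cong)
    fix x
    show "(\<integral>\<^sup>+y. G x (y / c - s * x / c) \<partial>lborel) = ennreal \<bar>c\<bar> * (\<integral>\<^sup>+y. G x y \<partial>lborel)"
      by (subst (2) nn_integral_real_affine[where c="1/c" and t="- s * x / c"])
         (use False in \<open>auto simp: mult.assoc[symmetric] ennreal_mult'[symmetric] add.commute\<close>)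
  qed
  also have "\<dots> = ennreal \<bar>c\<bar> * (\<integral>\<^sup>+x. (\<integral>\<^sup>+y. G x y \<partial>lborel) \<partial>lborel)"
    by (subst nn_integral_cmult) auto
  also have "(\<integral>\<^sup>+x. (\<integral>\<^sup>+y. G x y \<partial>lborel) \<partial>lborel) = (\<integral>\<^sup>+y. (\<integral>\<^sup>+x. G x y \<partial>lborel) \<partial>lborel)"
    by (rule lborel_pair.Fubini') measurable
  finally show ?thesis
    using False by (simp add: mult.assoc[symmetric] ennreal_mult'[symmetric])
qed

text \<open>The joint density depends only on \<open>x\<^sup>2 + y\<^sup>2\<close>, which a rotation
  preserves.\<close>

lemma nn_integral_std_gauss_rotation:
  fixes F :: "real \<Rightarrow> real \<Rightarrow> ennreal"
  assumes [measurable]: "case_prod F \<in> borel_measurable (borel \<Otimes>\<^sub>M borel)" and cs: "c\<^sup>2 + s\<^sup>2 = 1"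
  shows "(\<integral>\<^sup>+y. (\<integral>\<^sup>+x. F (c * x + s * y) (c * y - s * x) \<partial>std_gauss) \<partial>std_gauss) = (\<integral>\<^sup>+y. (\<integral>\<^sup>+x. F x y \<partial>std_gauss) \<partial>std_gauss)"
proof -
  define w where "w x = ennreal (std_normal_density x)" for x
  have [measurable]: "w \<in> borel_measurable borel" unfolding w_def by measurable
  have ww: "w (c * x + s * y) * w (c * y - s * x) = w x * w y" for x y
  proof -
    have "(c * x + s * y)\<^sup>2 + (c * y - s * x)\<^sup>2 = (c\<^sup>2 + s\<^sup>2) * (x\<^sup>2 + y\<^sup>2)"
      by (simp add: power2_eq_square algebra_simps)
    then have "- (c * x + s * y)\<^sup>2/2 + - (c * y - s * x)\<^sup>2/2 = - x\<^sup>2/2 + - y\<^sup>2/2"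
      using cs by (simp add: field_simps)
    then show ?thesis
      unfolding w_def std_normal_density_def
      by (simp add: ennreal_mult'[symmetric] exp_add[symmetric] mult.commute mult.left_commute)
  qed
  have *: "(\<integral>\<^sup>+y. (\<integral>\<^sup>+x. H x y \<partial>std_gauss) \<partial>std_gauss) = (\<integral>\<^sup>+y. (\<integral>\<^sup>+x. (w x * w y) * H x y \<partial>lborel) \<partial>lborel)"
    if [measurable]: "case_prod H \<in> borel_measurable (borel \<Otimes>\<^sub>M borel)" for H
    by (simp add: nn_integral_std_gauss w_def[symmetric] nn_integral_cmult[symmetric] mult_ac)
  show ?thesis
    by (subst (1 2) *, measurable, measurable, subst nn_integral_lborel_rotation[OF _ cs, symmetric])
       (auto simp: ww)
qed

text \<open>Fubini isolates coordinates \<open>i\<close> and \<open>k\<close>; with all others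
  frozen, the planar rotation invariance applies.\<close>

lemma nn_integral_gauss_givens:
  fixes f :: "(nat \<Rightarrow> real) \<Rightarrow> ennreal"
  assumes f[measurable]: "f \<in> borel_measurable (gauss I)" and I: "finite I" "i \<in> I" "k \<in> I" "i \<noteq> k"
    and cs: "c\<^sup>2 + s\<^sup>2 = 1"
  shows "(\<integral>\<^sup>+g. f (g(i := c * g i + s * g k, k := c * g k - s * g i)) \<partial>gauss I) = (\<integral>\<^sup>+g. f g \<partial>gauss I)"
proof -
  define J where "J = I - {i, k}"
  have I': "I = insert i (insert k J)" "finite J" "i \<notin> insert k J" "k \<notin> J"
    using I by (auto simp: J_def)
  have J: "finite (insert k J)" using I' by auto
  have up: "(x(k := y, i := z)) (i := a, k := b) = x(k := b, i := a)" for x :: "nat \<Rightarrow> real" and y z a b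
    using I by (auto simp: fun_eq_iff)
  have fm[measurable]: "f \<in> borel_measurable (PiM (insert i (insert k J)) (\<lambda>_. std_gauss))"
    using f unfolding I'(1) .
  have split: "(\<integral>\<^sup>+g. h g \<partial>gauss I) = (\<integral>\<^sup>+x. \<integral>\<^sup>+y. \<integral>\<^sup>+z. h (x(k := y, i := z)) \<partial>std_gauss \<partial>std_gauss \<partial>gauss J)"
    if [measurable]: "h \<in> borel_measurable (PiM (insert i (insert k J)) (\<lambda>_. std_gauss))" for h
    unfolding I'(1)
    by (subst gauss.product_nn_integral_insert[OF J I'(3)], measurable,
        subst gauss.product_nn_integral_insert[OF I'(2,4)]) (auto)
  have m: "(\<lambda>g. f (g(i := c * g i + s * g k, k := c * g k - s * g i))) \<in> borel_measurable (PiM (insert i (insert k J)) (\<lambda>_. std_gauss))"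
  proof (rule measurable_compose[OF _ fm])
    show "(\<lambda>g. g(i := c * g i + s * g k, k := c * g k - s * g i)) \<in> gauss (insert i (insert k J)) \<rightarrow>\<^sub>M gauss (insert i (insert k J))"
    proof (rule measurable_PiM_single')
      fix j assume "j \<in> insert i (insert k J)"
      then consider "j = i" | "j = k" | "j \<in> J" "j \<noteq> i" "j \<noteq> k" using I' by auto
      then show "(\<lambda>g. (g(i := c * g i + s * g k, k := c * g k - s * g i)) j) \<in> gauss (insert i (insert k J)) \<rightarrow>\<^sub>M std_gauss"
        by cases (use I in simp_all)
    qed (auto simp: space_PiM PiE_def extensional_def)
  qed
  show ?thesis
    unfolding split[OF m] split[OF fm]
  proof (rule nn_integral_cong)
    fix x assume x: "x \<in> space (gauss J)"
    have [measurable]: "(\<lambda>(a,b). x(k := b, i := a)) \<in> borel \<Otimes>\<^sub>M borel \<rightarrow>\<^sub>M gauss (insert i (insert k J))"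
    proof (rule measurable_PiM_single')
      fix j assume "j \<in> insert i (insert k J)"
      then consider "j = i" | "j = k" | "j \<in> J" "j \<noteq> i" "j \<noteq> k" using I' by auto
      then show "(\<lambda>w. (case w of (a, b) \<Rightarrow> x(k := b, i := a)) j) \<in> borel \<Otimes>\<^sub>M borel \<rightarrow>\<^sub>M std_gauss"
        by cases (use I in \<open>simp_all add: case_prod_beta'\<close>)
    qed (use x in \<open>auto simp: space_PiM PiE_def extensional_def\<close>)
    have "case_prod (\<lambda>a b. f (x(k := b, i := a))) \<in> borel_measurable (borel \<Otimes>\<^sub>M borel)"
      using measurable_compose[OF \<open>(\<lambda>(a,b). x(k := b, i := a)) \<in> _\<close> fm] by (simp add: case_prod_beta')
    from nn_integral_std_gauss_rotation[OF this cs]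
    show "(\<integral>\<^sup>+ y. \<integral>\<^sup>+ z. f ((x(k := y, i := z)) (i := c * (x(k := y, i := z)) i + s * (x(k := y, i := z)) k,
                  k := c * (x(k := y, i := z)) k - s * (x(k := y, i := z)) i)) \<partial>std_gauss \<partial>std_gauss) =
         (\<integral>\<^sup>+ y. \<integral>\<^sup>+ z. f (x(k := y, i := z)) \<partial>std_gauss \<partial>std_gauss)"
      unfolding up using I by simp
  qed
qed

text \<open>Orthonormal rows map a standard Gaussian vector to a standard Gaussian vector. Outer
  induction on the number of rows, inner induction on the support size of the last row: a Givens
  rotation removes one of its nonzero entries and preserves all inner products. Once a single entry
  is left it is 1 or -1, orthogonality makes the other rows vanish at that index, and the last
  coordinate splits off; the sign is absorbed by the symmetry of \<open>std_gauss\<close>.\<close>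

lemma gauss_orthonormal:
  fixes u :: "nat \<Rightarrow> nat \<Rightarrow> real"
  assumes I: "finite I" and f[measurable]: "f \<in> borel_measurable (gauss {..<p})"
    and orth: "\<And>j k. j < p \<Longrightarrow> k < p \<Longrightarrow> (\<Sum>i\<in>I. u j i * u k i) = (if j = k then 1 else 0)"
  shows "(\<integral>\<^sup>+g. f (\<lambda>j\<in>{..<p}. \<Sum>i\<in>I. u j i * g i) \<partial>gauss I) = (\<integral>\<^sup>+z. f z \<partial>gauss {..<p})"
  using assms
proof (induction p arbitrary: I u f)
  case 0
  have "(\<integral>\<^sup>+g. f (\<lambda>j\<in>{..<0}. \<Sum>i\<in>I. u j i * g i) \<partial>gauss I) = (\<integral>\<^sup>+g. f (\<lambda>j. undefined) \<partial>gauss I)"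
    by (intro nn_integral_cong arg_cong[where f=f]) auto
  also have "\<dots> = f (\<lambda>j. undefined)"
    using prob_space.emeasure_space_1[OF prob_space_gauss[of I]] by simp
  also have "\<dots> = (\<integral>\<^sup>+z. f z \<partial>gauss {..<0})"
    by (simp add: PiM_empty nn_integral_count_space_finite)
  finally show ?case .
next
  case (Suc p)
  note [measurable] = Suc.prems(2)
  show ?case using Suc.prems(1,3)
  proof (induction "card {i \<in> I. u p i \<noteq> 0}" arbitrary: u rule: less_induct)
    case (less u)
    note fI[simp] = less.prems(1) and on = less.prems(2)
    let ?S = "{i \<in> I. u p i \<noteq> 0}"
    have nrm: "(\<Sum>i\<in>I. u p i * u p i) = 1" using on[of p p] by simp
    then have "?S \<noteq> {}" by (metis (mono_tags, lifting) empty_Collect_eq mult_eq_0_iff sum.neutral zero_neq_one)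
    then obtain i where i: "i \<in> I" "u p i \<noteq> 0" by auto
    have rep: "f (\<lambda>j\<in>{..<Suc p}. h j) = f (restrict h {..<Suc p})" for h by simp
    show ?case
    proof (cases "?S = {i}")
      case True
      define J where "J = I - {i}"
      have IJ: "I = insert i J" "finite J" "i \<notin> J" using i by (auto simp: J_def)
      have uJ: "u p k = 0" if "k \<in> J" for k using True that IJ by auto
      have "u p i * u p i = 1" using nrm uJ IJ by (simp)
      then have eps: "u p i = 1 \<or> u p i = -1" by (simp add: square_eq_1_iff)
      have u0: "u j i = 0" if "j < p" for j
        using on[of j p] that IJ uJ i by simp
      have onJ: "(\<Sum>l\<in>J. u j l * u k l) = (if j = k then 1 else 0)" if "j < p" "k < p" for j k
        using on[of j k] that IJ u0 by simp
      have fm[measurable]: "f \<in> borel_measurable (gauss (insert p {..<p}))"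
        using Suc.prems(2) by (simp add: lessThan_Suc)
      have m[measurable]: "(\<lambda>w. f (w(p := y))) \<in> borel_measurable (gauss {..<p})" for y
        by (rule measurable_compose[OF _ fm], rule measurable_PiM_single')
           (auto simp: space_PiM PiE_def extensional_def)
      have "(\<integral>\<^sup>+g. f (\<lambda>j\<in>{..<Suc p}. \<Sum>i\<in>I. u j i * g i) \<partial>gauss I)
         = (\<integral>\<^sup>+y. (\<integral>\<^sup>+x. f (\<lambda>j\<in>{..<Suc p}. \<Sum>l\<in>I. u j l * (x(i := y)) l) \<partial>gauss J) \<partial>std_gauss)"
        unfolding IJ(1)
      proof (rule gauss.product_nn_integral_insert_rev[OF IJ(2,3)])
        show "(\<lambda>g. f (\<lambda>j\<in>{..<Suc p}. \<Sum>i\<in>insert i J. u j i * g i)) \<in> borel_measurable (gauss (insert i J))"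
          by (rule measurable_compose[OF _ Suc.prems(2)], rule measurable_restrict, measurable)
      qed
      also have "\<dots> = (\<integral>\<^sup>+y. (\<integral>\<^sup>+x. f ((\<lambda>j\<in>{..<p}. \<Sum>l\<in>J. u j l * x l)(p := u p i * y)) \<partial>gauss J) \<partial>std_gauss)"
      proof (intro nn_integral_cong arg_cong[where f=f] ext)
        fix x y j
        have [simp]: "(\<Sum>l\<in>J. u k l * (if l = i then y else x l)) = (\<Sum>l\<in>J. u k l * x l)" for k
          by (rule sum.cong) (use IJ in auto)
        show "(\<lambda>j\<in>{..<Suc p}. \<Sum>l\<in>I. u j l * (x(i := y)) l) j = ((\<lambda>j\<in>{..<p}. \<Sum>l\<in>J. u j l * x l)(p := u p i * y)) j"
          using IJ u0 uJ by (auto simp: restrict_def)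
      qed
      also have "\<dots> = (\<integral>\<^sup>+y. (\<integral>\<^sup>+w. f (w(p := u p i * y)) \<partial>gauss {..<p}) \<partial>std_gauss)"
        by (intro nn_integral_cong Suc.IH[OF IJ(2) m onJ])
      also have "\<dots> = (\<integral>\<^sup>+y. (\<integral>\<^sup>+w. f (w(p := y)) \<partial>gauss {..<p}) \<partial>std_gauss)"
      proof -
        have m1: "(\<lambda>(y,w). w(p := y)) \<in> std_gauss \<Otimes>\<^sub>M gauss {..<p} \<rightarrow>\<^sub>M gauss (insert p {..<p})"
        proof (rule measurable_PiM_single')
          fix j assume "j \<in> insert p {..<p}"
          then show "(\<lambda>a. (case a of (y, w) \<Rightarrow> w(p := y)) j) \<in> std_gauss \<Otimes>\<^sub>M gauss {..<p} \<rightarrow>\<^sub>M std_gauss"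
            by (cases "j = p") (simp_all add: case_prod_beta')
        qed (auto simp: space_PiM space_pair_measure PiE_def extensional_def)
        have [measurable]: "(\<lambda>(y, w). f (w(p := y))) \<in> borel_measurable (std_gauss \<Otimes>\<^sub>M gauss {..<p})"
          using measurable_compose[OF m1 fm] by (simp add: case_prod_beta')
        interpret prob_space "gauss {..<p}" by (rule prob_space_gauss)
        have "(\<lambda>y. \<integral>\<^sup>+w. f (w(p := y)) \<partial>gauss {..<p}) \<in> borel_measurable std_gauss"
          by measurable
        then have "(\<lambda>y. \<integral>\<^sup>+w. f (w(p := y)) \<partial>gauss {..<p}) \<in> borel_measurable borel"
          by simp
        from nn_integral_std_gauss_uminus[OF this] show ?thesis
          using eps by auto
      qed
      also have "\<dots> = (\<integral>\<^sup>+z. f z \<partial>gauss (insert p {..<p}))"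
        by (rule gauss.product_nn_integral_insert_rev[symmetric]) auto
      finally show ?thesis by (simp add: lessThan_Suc)
    next
      case False
      then obtain k where k: "k \<in> I" "u p k \<noteq> 0" "k \<noteq> i" using i by auto
      define J where "J = I - {i, k}"
      have IJ: "I = insert i (insert k J)" "finite J" "i \<notin> J" "k \<notin> J" using i k by (auto simp: J_def)
      define \<rho> where "\<rho> = sqrt ((u p i)\<^sup>2 + (u p k)\<^sup>2)"
      have rho: "\<rho> > 0" "\<rho>\<^sup>2 = (u p i)\<^sup>2 + (u p k)\<^sup>2" using i(2) by (auto simp: \<rho>_def sum_power2_gt_zero_iff)
      \<comment> \<open>The angle for which the rotated last row vanishes at
        \<open>k\<close>.\<close>
      define c s where "c = u p i / \<rho>" and "s = - u p k / \<rho>"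
      have cs: "c\<^sup>2 + s\<^sup>2 = 1"
        using rho(1) by (simp add: c_def s_def power_divide add_divide_distrib[symmetric] flip: rho(2))
      define v where "v j = (u j)(i := c * u j i - s * u j k, k := s * u j i + c * u j k)" for j
      have vk: "v p k = 0" by (simp add: v_def c_def s_def mult.commute)
      have Jc: "(\<Sum>l\<in>J. F (v j l) (v m l) l) = (\<Sum>l\<in>J. F (u j l) (u m l) l)" for F :: "real \<Rightarrow> real \<Rightarrow> nat \<Rightarrow> real" and j m
        by (rule sum.cong) (use IJ in \<open>auto simp: v_def\<close>)
      have vv: "(\<Sum>l\<in>I. v j l * v m l) = (\<Sum>l\<in>I. u j l * u m l)" for j m
      proof -
        have "v j i * v m i + v j k * v m k = (c\<^sup>2 + s\<^sup>2) * (u j i * u m i + u j k * u m k)"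
          using k by (simp add: v_def power2_eq_square algebra_simps)
        then show ?thesis
          using IJ k Jc[of "\<lambda>a b _. a * b" j m] unfolding cs by simp
      qed
      have card: "card {l \<in> I. v p l \<noteq> 0} < card ?S"
        by (rule psubset_card_mono) (use k i vk in \<open>auto simp: v_def split: if_splits\<close>)
      have up: "(\<Sum>l\<in>I. u j l * (g(i := c * g i + s * g k, k := c * g k - s * g i)) l) = (\<Sum>l\<in>I. v j l * g l)" for j g
      proof -
        have "(\<Sum>l\<in>J. u j l * (g(i := c * g i + s * g k, k := c * g k - s * g i)) l) = (\<Sum>l\<in>J. v j l * g l)"
          by (rule sum.cong) (use IJ in \<open>auto simp: v_def\<close>)
        moreover have "u j i * (c * g i + s * g k) + u j k * (c * g k - s * g i) = v j i * g i + v j k * g k"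
          using k by (simp add: v_def algebra_simps)
        ultimately show ?thesis using IJ k by (simp add: v_def algebra_simps)
      qed
      have "(\<integral>\<^sup>+g. f (\<lambda>j\<in>{..<Suc p}. \<Sum>l\<in>I. u j l * g l) \<partial>gauss I)
        = (\<integral>\<^sup>+g. f (\<lambda>j\<in>{..<Suc p}. \<Sum>l\<in>I. u j l * (g(i := c * g i + s * g k, k := c * g k - s * g i)) l) \<partial>gauss I)"
        by (rule nn_integral_gauss_givens[OF _ fI i(1) k(1) k(3)[symmetric] cs, symmetric],
            rule measurable_compose[OF _ Suc.prems(2)], rule measurable_restrict, measurable)
      also have "\<dots> = (\<integral>\<^sup>+z. f z \<partial>gauss {..<Suc p})"
        unfolding up by (rule less.hyps[of v, OF card fI]) (use vv on in simp)
      finally show ?thesis .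
    qed
  qed
qed

text \<open>Cameron-Martin one coordinate at a time. The exponential weight is the likelihood ratio
  of a mean shift \<open>v\<close>, which is how all alternatives enter the lower bound.\<close>

lemma nn_integral_gauss_shift:
  fixes f :: "(nat \<Rightarrow> real) \<Rightarrow> ennreal"
  assumes "finite I" and "f \<in> borel_measurable (gauss I)"
  shows "(\<integral>\<^sup>+g. f (\<lambda>i\<in>I. g i + v i) \<partial>gauss I)
       = (\<integral>\<^sup>+g. f g * ennreal (exp (\<Sum>i\<in>I. v i * g i - (v i)\<^sup>2 / 2)) \<partial>gauss I)"
  using assms
proof (induction I arbitrary: f rule: finite_induct)
  case empty
  have "(\<lambda>i\<in>{}. g i + v i) = (\<lambda>i. undefined)" for g by auto
  then show ?case
    by (simp add: PiM_empty nn_integral_count_space_finite)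
next
  case (insert k J)
  note fm[measurable] = insert.prems
  define e where "e y = ennreal (exp (v k * y - (v k)\<^sup>2 / 2))" for y
  have [measurable]: "e \<in> borel_measurable borel" unfolding e_def by measurable
  interpret prob_space std_gauss by (rule prob_space_std_gauss)
  have m1: "(\<lambda>(w,y). w(k := y)) \<in> gauss J \<Otimes>\<^sub>M std_gauss \<rightarrow>\<^sub>M gauss (insert k J)"
  proof (rule measurable_PiM_single')
    fix j assume "j \<in> insert k J"
    then show "(\<lambda>a. (case a of (w, y) \<Rightarrow> w(k := y)) j) \<in> gauss J \<Otimes>\<^sub>M std_gauss \<rightarrow>\<^sub>M std_gauss"
      by (cases "j = k") (simp_all add: case_prod_beta')
  qed (auto simp: space_PiM space_pair_measure PiE_def extensional_def)
  have m2[measurable]: "(\<lambda>(w,y). f (w(k := y))) \<in> borel_measurable (gauss J \<Otimes>\<^sub>M std_gauss)"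
    using measurable_compose[OF m1 fm] by (simp add: case_prod_beta')
  define F where "F w = (\<integral>\<^sup>+y. f (w(k := y)) * e y \<partial>std_gauss)" for w
  have Fm[measurable]: "F \<in> borel_measurable (gauss J)"
    unfolding F_def by measurable
  have my[measurable]: "(\<lambda>y. f (w(k := y))) \<in> borel_measurable borel" if "w \<in> space (gauss J)" for w
    using measurable_Pair2[OF m2 that] by simp
  have "(\<integral>\<^sup>+g. f (\<lambda>i\<in>insert k J. g i + v i) \<partial>gauss (insert k J))
    = (\<integral>\<^sup>+x. \<integral>\<^sup>+y. f (\<lambda>i\<in>insert k J. (x(k := y)) i + v i) \<partial>std_gauss \<partial>gauss J)"
    by (rule gauss.product_nn_integral_insert[OF insert.hyps(1,2)],
        rule measurable_compose[OF _ fm], rule measurable_restrict, measurable)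
  also have "\<dots> = (\<integral>\<^sup>+x. F (\<lambda>i\<in>J. x i + v i) \<partial>gauss J)"
  proof (rule nn_integral_cong)
    fix x assume "x \<in> space (gauss J)"
    define w where "w = (\<lambda>i\<in>J. x i + v i)"
    have w: "w \<in> space (gauss J)" by (auto simp: w_def space_PiM)
    have "(\<integral>\<^sup>+y. f (\<lambda>i\<in>insert k J. (x(k := y)) i + v i) \<partial>std_gauss) = (\<integral>\<^sup>+y. f (w(k := y + v k)) \<partial>std_gauss)"
      by (intro nn_integral_cong arg_cong[where f=f]) (use insert.hyps in \<open>auto simp: w_def restrict_def fun_eq_iff\<close>)
    also have "\<dots> = F w"
      unfolding F_def e_def by (rule nn_integral_std_gauss_shift[OF my[OF w]])
    finally show "(\<integral>\<^sup>+y. f (\<lambda>i\<in>insert k J. (x(k := y)) i + v i) \<partial>std_gauss) = F (\<lambda>i\<in>J. x i + v i)"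
      by (simp add: w_def)
  qed
  also have "\<dots> = (\<integral>\<^sup>+x. F x * ennreal (exp (\<Sum>i\<in>J. v i * x i - (v i)\<^sup>2 / 2)) \<partial>gauss J)"
    by (rule insert.IH[OF Fm])
  also have "\<dots> = (\<integral>\<^sup>+x. \<integral>\<^sup>+y. f (x(k := y)) * ennreal (exp (\<Sum>i\<in>insert k J. v i * (x(k := y)) i - (v i)\<^sup>2 / 2)) \<partial>std_gauss \<partial>gauss J)"
  proof (rule nn_integral_cong)
    fix x assume x: "x \<in> space (gauss J)"
    have [measurable]: "(\<lambda>y. f (x(k := y))) \<in> borel_measurable borel" by (rule my[OF x])
    have s: "(\<Sum>i\<in>J. v i * (if i = k then y else x i) - (v i)\<^sup>2 / 2) = (\<Sum>i\<in>J. v i * x i - (v i)\<^sup>2 / 2)" for y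
      by (rule sum.cong) (use insert.hyps in auto)
    show "F x * ennreal (exp (\<Sum>i\<in>J. v i * x i - (v i)\<^sup>2 / 2))
       = (\<integral>\<^sup>+y. f (x(k := y)) * ennreal (exp (\<Sum>i\<in>insert k J. v i * (x(k := y)) i - (v i)\<^sup>2 / 2)) \<partial>std_gauss)"
      unfolding F_def
      by (subst nn_integral_multc[symmetric])
         (use insert.hyps in \<open>auto simp: s e_def mult.assoc ennreal_mult'[symmetric] exp_add[symmetric] intro!: nn_integral_cong\<close>)
  qed
  also have "\<dots> = (\<integral>\<^sup>+g. f g * ennreal (exp (\<Sum>i\<in>insert k J. v i * g i - (v i)\<^sup>2 / 2)) \<partial>gauss (insert k J))"
    by (rule gauss.product_nn_integral_insert[OF insert.hyps(1,2), symmetric]) measurable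
  finally show ?case .
qed

section \<open>Sums of independent Bernoulli variables\<close>

text \<open>The expectation of \<phi>(W), where W counts the successes among \<open>n\<close>
  independent Bernoulli variables with probabilities \<open>\<pi> j\<close>. The recursion
  conditions on the last variable, so that the analysis of the counting test is pure algebra with no
  probability space; \<open>gauss_integral_count\<close> makes the link.\<close>

fun bern_expect :: "nat \<Rightarrow> (nat \<Rightarrow> real) \<Rightarrow> (nat \<Rightarrow> real) \<Rightarrow> real" where
  "bern_expect 0 \<pi> \<phi> = \<phi> 0"
| "bern_expect (Suc n) \<pi> \<phi> = \<pi> n * bern_expect n \<pi> (\<lambda>w. \<phi> (Suc w)) + (1 - \<pi> n) * bern_expect n \<pi> \<phi>"

lemma bern_expect_cong: "(\<And>j. j < n \<Longrightarrow> \<pi> j = \<pi>' j) \<Longrightarrow> bern_expect n \<pi> \<phi> = bern_expect n \<pi>' \<phi>"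
  by (induction n arbitrary: \<phi>) auto

lemma bern_expect_const: "bern_expect n \<pi> (\<lambda>_. c) = c"
  by (induction n) (auto simp: algebra_simps)

lemma bern_expect_diff: "bern_expect n \<pi> (\<lambda>w. \<phi> w - \<psi> w) = bern_expect n \<pi> \<phi> - bern_expect n \<pi> \<psi>"
proof (induction n arbitrary: \<phi> \<psi>)
  case (Suc n)
  show ?case unfolding bern_expect.simps Suc.IH by (simp add: algebra_simps)
qed simp

lemma bern_expect_cmult: "bern_expect n \<pi> (\<lambda>w. a * \<phi> w) = a * bern_expect n \<pi> \<phi>"
  by (induction n arbitrary: \<phi>) (auto simp: algebra_simps)

lemma bern_expect_mono:
  assumes "\<And>j. j < n \<Longrightarrow> 0 \<le> \<pi> j \<and> \<pi> j \<le> 1" and "\<And>w. \<phi> w \<le> \<psi> w"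
  shows "bern_expect n \<pi> \<phi> \<le> bern_expect n \<pi> \<psi>"
  using assms
proof (induction n arbitrary: \<phi> \<psi>)
  case (Suc n)
  then show ?case by (auto intro!: add_mono mult_left_mono)
qed simp

text \<open>The expectation is affine in each single probability. Setting \<open>\<pi> j\<close> to
  0 deletes variable \<open>j\<close>, and the slope is the mean increment of \<open>\<phi>\<close>
  over the remaining count.\<close>

lemma bern_expect_split:
  assumes "j < n"
  shows "bern_expect n \<pi> \<phi> = bern_expect n (\<pi>(j := 0)) \<phi> + \<pi> j * bern_expect n (\<pi>(j := 0)) (\<lambda>w. \<phi> (Suc w) - \<phi> w)"
  using assms
proof (induction n arbitrary: \<phi>)
  case (Suc n)
  show ?case
  proof (cases "j = n")
    case True
    have "bern_expect n (\<pi>(n := 0)) \<psi> = bern_expect n \<pi> \<psi>" for \<psi> by (rule bern_expect_cong) auto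
    then show ?thesis unfolding True bern_expect.simps by (simp add: bern_expect_diff algebra_simps)
  next
    case False
    then have j: "j < n" using Suc.prems by simp
    show ?thesis using False
      unfolding bern_expect.simps Suc.IH[OF j, of "\<lambda>w. \<phi> (Suc w)"] Suc.IH[OF j, of \<phi>]
      by (simp add: bern_expect_diff algebra_simps)
  qed
qed simp

text \<open>Squared bias plus variance. In the induction a success of the last variable is absorbed
  by lowering \<open>c\<close> by 1.\<close>

lemma bern_expect_square:
  "bern_expect n \<pi> (\<lambda>w. (real w - c)\<^sup>2) = ((\<Sum>j<n. \<pi> j) - c)\<^sup>2 + (\<Sum>j<n. \<pi> j * (1 - \<pi> j))"
proof (induction n arbitrary: c)
  case (Suc n)
  have e: "(\<lambda>w. (real (Suc w) - c)\<^sup>2) = (\<lambda>w. (real w - (c - 1))\<^sup>2)" by (simp add: algebra_simps)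
  show ?case unfolding bern_expect.simps e Suc.IH by (simp add: power2_eq_square algebra_simps)
qed simp

text \<open>A ramp of width \<open>K\<close> centred at \<open>c\<close>. A ramp is preferred to a
  sharp threshold because its increments are known exactly near the centre, so two moments of the
  count suffice and no local limit estimate is involved.\<close>

definition clamp_test :: "real \<Rightarrow> real \<Rightarrow> nat \<Rightarrow> real" where
  "clamp_test c K w = max 0 (min 1 (1 / 2 + (real w - c) / K))"

lemma clamp_test_bounds: "0 \<le> clamp_test c K w" "clamp_test c K w \<le> 1"
  by (auto simp: clamp_test_def)

text \<open>Within \<open>K / 4\<close> of the centre the step has full height \<open>1 / K\<close>,
  since \<open>K \<ge> 4\<close> keeps both ends on the ramp; farther out the quadratic minorant is
  nonpositive. A quadratic minorant is what allows integration with second moments only.\<close>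

lemma clamp_test_incr:
  assumes K: "K \<ge> 4"
  shows "0 \<le> clamp_test c K (Suc w) - clamp_test c K w"
    and "1 / K * (1 - 16 / K\<^sup>2 * (real w - c)\<^sup>2) \<le> clamp_test c K (Suc w) - clamp_test c K w"
proof -
  have "(real w - c) / K \<le> (real (Suc w) - c) / K" using K by (intro divide_right_mono) auto
  then show 0: "0 \<le> clamp_test c K (Suc w) - clamp_test c K w"
    unfolding clamp_test_def by linarith
  show "1 / K * (1 - 16 / K\<^sup>2 * (real w - c)\<^sup>2) \<le> clamp_test c K (Suc w) - clamp_test c K w"
  proof (cases "\<bar>real w - c\<bar> \<le> K / 4")
    case True
    have "(real w - c) / K \<ge> - (1/4)" "(real w - c) / K \<le> 1/4" using True K by (auto simp: field_simps abs_if split: if_splits)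
    moreover have "(real (Suc w) - c) / K = (real w - c) / K + 1 / K" "1 / K \<le> 1/4" "1/K > 0"
      using K by (auto simp: field_simps)
    ultimately have "clamp_test c K (Suc w) - clamp_test c K w = 1 / K"
      unfolding clamp_test_def by linarith
    moreover have "1 / K * (1 - 16 / K\<^sup>2 * (real w - c)\<^sup>2) \<le> 1 / K * 1"
      using K by (intro mult_left_mono) auto
    ultimately show ?thesis by simp
  next
    case False
    then have "(K/4)\<^sup>2 \<le> (real w - c)\<^sup>2"
      using K by (subst abs_le_square_iff[symmetric]) auto
    then have "1 - 16 / K\<^sup>2 * (real w - c)\<^sup>2 \<le> 0" using K by (simp add: field_simps)
    then have "1 / K * (1 - 16 / K\<^sup>2 * (real w - c)\<^sup>2) \<le> 0" using K by (simp add: mult_le_0_iff divide_nonpos_pos)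
    then show ?thesis using 0 by linarith
  qed
qed

text \<open>Integrating the quadratic minorant costs 16 / K^2 times the mean squared deviation from
  \<open>c\<close>; the hypothesis makes this at most one half.\<close>

lemma bern_expect_incr_ge:
  assumes \<rho>: "\<And>j. j < n \<Longrightarrow> 0 \<le> \<rho> j \<and> \<rho> j \<le> 1" and K: "K \<ge> 4"
    and v: "32 * (((\<Sum>j<n. \<rho> j) - c)\<^sup>2 + (\<Sum>j<n. \<rho> j * (1 - \<rho> j))) \<le> K\<^sup>2"
  shows "bern_expect n \<rho> (\<lambda>w. clamp_test c K (Suc w) - clamp_test c K w) \<ge> 1 / (2 * K)"
proof -
  have "1 / (2 * K) = 1 / K * (1 - 1 / 2)" by simp
  also have "\<dots> \<le> 1 / K * (1 - 16 / K\<^sup>2 * (((\<Sum>j<n. \<rho> j) - c)\<^sup>2 + (\<Sum>j<n. \<rho> j * (1 - \<rho> j))))"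
    using v K by (intro mult_left_mono) (auto simp: field_simps)
  also have "\<dots> = bern_expect n \<rho> (\<lambda>w. 1 / K * (1 - 16 / K\<^sup>2 * (real w - c)\<^sup>2))"
    unfolding bern_expect_cmult bern_expect_diff bern_expect_const bern_expect_square by simp
  also have "\<dots> \<le> bern_expect n \<rho> (\<lambda>w. clamp_test c K (Suc w) - clamp_test c K w)"
    by (intro bern_expect_mono \<rho> clamp_test_incr K)
  finally show ?thesis .
qed

lemma bern_expect_mono_probs:
  assumes "\<And>j. j < n \<Longrightarrow> 0 \<le> \<pi> j \<and> \<pi> j \<le> \<pi>' j \<and> \<pi>' j \<le> 1" and "\<And>w. \<phi> w \<le> \<phi> (Suc w)"
  shows "bern_expect n \<pi> \<phi> \<le> bern_expect n \<pi>' \<phi>"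
  using assms
proof (induction n arbitrary: \<phi>)
  case (Suc n)
  have a: "bern_expect n \<pi> \<phi> \<le> bern_expect n \<pi>' \<phi>" "bern_expect n \<pi> (\<lambda>w. \<phi> (Suc w)) \<le> bern_expect n \<pi>' (\<lambda>w. \<phi> (Suc w))"
    by (rule Suc.IH; use Suc.prems in simp)+
  have b: "bern_expect n \<pi> \<phi> \<le> bern_expect n \<pi> (\<lambda>w. \<phi> (Suc w))"
    by (rule bern_expect_mono) (use Suc.prems in \<open>auto intro: order_trans simp: less_Suc_eq\<close>)
  have n: "0 \<le> \<pi> n" "\<pi> n \<le> \<pi>' n" "\<pi>' n \<le> 1" using Suc.prems(1)[of n] by auto
  have "bern_expect (Suc n) \<pi> \<phi> = bern_expect n \<pi> \<phi> + \<pi> n * (bern_expect n \<pi> (\<lambda>w. \<phi> (Suc w)) - bern_expect n \<pi> \<phi>)"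
    by (simp add: algebra_simps)
  also have "\<dots> \<le> bern_expect n \<pi> \<phi> + \<pi>' n * (bern_expect n \<pi> (\<lambda>w. \<phi> (Suc w)) - bern_expect n \<pi> \<phi>)"
    using b n by (intro add_left_mono mult_right_mono) auto
  also have "\<dots> = \<pi>' n * bern_expect n \<pi> (\<lambda>w. \<phi> (Suc w)) + (1 - \<pi>' n) * bern_expect n \<pi> \<phi>"
    by (simp add: algebra_simps)
  also have "\<dots> \<le> \<pi>' n * bern_expect n \<pi>' (\<lambda>w. \<phi> (Suc w)) + (1 - \<pi>' n) * bern_expect n \<pi>' \<phi>"
    using a n by (intro add_mono mult_left_mono) auto
  finally show ?case by simp
qed simp

text \<open>The success probabilities on \<open>S\<close> are switched from \<open>\<pi>0\<close> to
  \<open>\<pi>1\<close> one index at a time. Each switch gains \<open>\<pi>1 - \<pi>0\<close> times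
  a mean increment of at least \<open>1 / (2 * K)\<close>. The width \<open>K\<close> has to
  dominate the standard deviation \<open>sqrt (p * \<pi>0)\<close> and the total drift
  \<open>card S * \<pi>1\<close>, so that the count stays on the ramp throughout. Monotonicity
  finally replaces \<open>\<pi>1\<close> by the true \<open>q\<close>.\<close>

lemma bern_expect_advantage:
  fixes \<pi>0 \<pi>1 :: real
  assumes S: "S \<subseteq> {..<p}" and pi: "0 \<le> \<pi>0" "\<pi>0 \<le> \<pi>1" "\<pi>1 \<le> 1"
    and q: "\<And>j. j < p \<Longrightarrow> j \<notin> S \<Longrightarrow> q j = \<pi>0" "\<And>j. j \<in> S \<Longrightarrow> \<pi>1 \<le> q j \<and> q j \<le> 1"
    and K: "K \<ge> 8 * (1 + sqrt (p * \<pi>0) + card S * \<pi>1)"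
  shows "bern_expect p q (clamp_test (p * \<pi>0) K)
     \<ge> bern_expect p (\<lambda>_. \<pi>0) (clamp_test (p * \<pi>0) K) + card S * (\<pi>1 - \<pi>0) / (2 * K)"
proof -
  define c where "c = p * \<pi>0"
  define a where "a = sqrt (p * \<pi>0)"
  define b where "b = card S * \<pi>1"
  have a: "a \<ge> 0" "a\<^sup>2 = p * \<pi>0" and b: "b \<ge> 0" using pi by (auto simp: a_def b_def)
  have K8: "K \<ge> 8 * (1 + a + b)" using K by (simp add: a_def b_def)
  then have K4: "K \<ge> 4" using a b by auto
  define \<pi> where "\<pi> D j = (if j \<in> D then \<pi>1 else \<pi>0)" for D :: "nat set" and j
  have finS: "finite S" using S finite_subset by blast
  have main: "bern_expect p (\<pi> D) (clamp_test c K) \<ge> bern_expect p (\<lambda>_. \<pi>0) (clamp_test c K) + card D * (\<pi>1 - \<pi>0) / (2 * K)"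
    if "D \<subseteq> S" for D
    using finite_subset[OF that finS] that
  proof (induction D rule: finite_induct)
    case empty
    show ?case by (simp add: \<pi>_def[abs_def])
  next
    case (insert j D)
    have jp: "j < p" using insert S by auto
    \<comment> \<open>The probabilities of the current stage with variable \<open>j\<close> deleted;
      they are the same before and after the switch at \<open>j\<close>.\<close>
    define \<rho> where "\<rho> = (\<pi> D)(j := 0)"
    have rho: "0 \<le> \<rho> i" "\<rho> i \<le> 1" for i using pi by (auto simp: \<rho>_def \<pi>_def)
    have D: "D \<subseteq> {..<p}" "card D \<le> card S" using insert S card_mono[OF finS] by auto
    have sumpi: "(\<Sum>i<p. \<pi> D i) = c + card D * (\<pi>1 - \<pi>0)"
    proof -
      have "\<pi> D i = \<pi>0 + (if i \<in> D then \<pi>1 - \<pi>0 else 0)" for i by (simp add: \<pi>_def)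
      then have "(\<Sum>i<p. \<pi> D i) = c + (\<Sum>i<p. if i \<in> D then \<pi>1 - \<pi>0 else 0)" by (simp add: sum.distrib c_def)
      also have "(\<Sum>i<p. if i \<in> D then \<pi>1 - \<pi>0 else 0) = card D * (\<pi>1 - \<pi>0)"
        using D by (simp add: sum.inter_restrict[symmetric] Int_absorb1)
      finally show ?thesis .
    qed
    have sumrho: "(\<Sum>i<p. \<rho> i) = (\<Sum>i<p. \<pi> D i) - \<pi>0"
    proof -
      have "(\<Sum>i<p. \<rho> i) = (\<Sum>i<p. \<pi> D i - (if i = j then \<pi>0 else 0))"
        by (rule sum.cong) (use insert in \<open>auto simp: \<rho>_def \<pi>_def\<close>)
      then show ?thesis using jp by (simp add: sum_subtractf)
    qed
    have cd: "0 \<le> card D * (\<pi>1 - \<pi>0)" "card D * (\<pi>1 - \<pi>0) \<le> b"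
      using pi D by (auto simp: b_def intro!: mult_mono)
    have "\<bar>(\<Sum>j<p. \<rho> j) - c\<bar> \<le> 1 + b" using cd pi b unfolding sumrho sumpi by linarith
    then have 1: "((\<Sum>j<p. \<rho> j) - c)\<^sup>2 \<le> (1 + b)\<^sup>2" by (intro power2_le_iff_abs_le[THEN iffD2]) (use b in auto)
    have "(\<Sum>j<p. \<rho> j * (1 - \<rho> j)) \<le> (\<Sum>j<p. \<rho> j)"
      by (intro sum_mono) (use rho in \<open>auto intro: mult_left_le\<close>)
    then have 2: "(\<Sum>j<p. \<rho> j * (1 - \<rho> j)) \<le> a\<^sup>2 + b" using sumpi sumrho cd pi by (simp add: a c_def)
    have "32 * (((\<Sum>j<p. \<rho> j) - c)\<^sup>2 + (\<Sum>j<p. \<rho> j * (1 - \<rho> j))) \<le> 32 * ((1 + b)\<^sup>2 + a\<^sup>2 + b)"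
      using 1 2 by simp
    also have "\<dots> \<le> (8 * (1 + a + b))\<^sup>2" using a(1) b by (simp add: power2_eq_square algebra_simps)
    also have "\<dots> \<le> K\<^sup>2" by (rule power_mono[OF K8]) (use a b in auto)
    finally have key: "bern_expect p \<rho> (\<lambda>w. clamp_test c K (Suc w) - clamp_test c K w) \<ge> 1 / (2 * K)"
      by (intro bern_expect_incr_ge K4) (use rho in auto)
    have r: "(\<pi> (insert j D))(j := 0) = \<rho>" by (auto simp: \<rho>_def \<pi>_def fun_eq_iff)
    have "bern_expect p (\<pi> (insert j D)) (clamp_test c K) - bern_expect p (\<pi> D) (clamp_test c K)
       = (\<pi>1 - \<pi>0) * bern_expect p \<rho> (\<lambda>w. clamp_test c K (Suc w) - clamp_test c K w)"
      unfolding bern_expect_split[OF jp, of "\<pi> (insert j D)"] bern_expect_split[OF jp, of "\<pi> D"] r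
      using insert by (simp add: \<rho>_def[symmetric]) (simp add: \<pi>_def algebra_simps)
    also have "\<dots> \<ge> (\<pi>1 - \<pi>0) * (1 / (2 * K))" using pi key by (intro mult_left_mono) auto
    finally show ?case using insert
      by (simp add: add_divide_distrib diff_divide_distrib algebra_simps)
  qed
  have "bern_expect p (\<pi> S) (clamp_test c K) \<le> bern_expect p q (clamp_test c K)"
    by (rule bern_expect_mono_probs) (use q pi clamp_test_incr[OF K4] in \<open>auto simp: \<pi>_def\<close>)
  with main[of S] show ?thesis by (simp add: c_def)
qed

text \<open>Integrating out the last coordinate reproduces the recursion of
  \<open>bern_expect\<close>. The event may depend on the coordinate because the means do.\<close>

lemma gauss_integral_count:
  fixes P :: "nat \<Rightarrow> real \<Rightarrow> bool" and \<phi> :: "nat \<Rightarrow> real"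
  assumes [measurable]: "\<And>j. Measurable.pred borel (P j)" and "\<And>w. \<bar>\<phi> w\<bar> \<le> B"
  shows "(\<integral>z. \<phi> (\<Sum>j<p. if P j (z j) then 1 else 0) \<partial>gauss {..<p})
     = bern_expect p (\<lambda>j. measure std_gauss {x. P j x}) \<phi>"
  using assms(2)
proof (induction p arbitrary: \<phi>)
  case 0
  then show ?case by (simp add: PiM_empty lebesgue_integral_count_space_finite)
next
  case (Suc p)
  interpret g: prob_space std_gauss by (rule prob_space_std_gauss)
  interpret G: prob_space "gauss {..<n}" for n by (rule prob_space_gauss)
  define W where "W n z = (\<Sum>j<n. if P j (z j) then 1 else 0 :: nat)" for n and z :: "nat \<Rightarrow> real"
  have [measurable]: "W n \<in> measurable (gauss {..<n}) (count_space UNIV)" for n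
    unfolding W_def by measurable
  define \<rho> where "\<rho> = measure std_gauss {x. P p x}"
  have int: "integrable (gauss {..<n}) (\<lambda>z. \<psi> (W n z))" if "\<And>w. \<bar>\<psi> w\<bar> \<le> B" for n \<psi>
    by (rule G.integrable_const_bound[where B=B]) (use that in auto)
  have int': "integrable (gauss (insert p {..<p})) (\<lambda>z. \<phi> (W (Suc p) z))"
    using int[of \<phi> "Suc p"] Suc.prems by (simp add: lessThan_Suc)
  have meas: "{x. P p x} \<in> sets std_gauss" by simp
  have "(\<integral>z. \<phi> (W (Suc p) z) \<partial>gauss {..<Suc p}) = (\<integral>x. \<integral>y. \<phi> (W (Suc p) (x(p := y))) \<partial>std_gauss \<partial>gauss {..<p})"
    unfolding lessThan_Suc by (rule gauss.product_integral_insert[OF _ _ int']) auto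
  also have "\<dots> = (\<integral>x. \<rho> * \<phi> (Suc (W p x)) + (1 - \<rho>) * \<phi> (W p x) \<partial>gauss {..<p})"
  proof (rule Bochner_Integration.integral_cong)
    fix x
    have w: "W (Suc p) (x(p := y)) = (if P p y then Suc (W p x) else W p x)" for y
    proof -
      have "(\<Sum>j<p. if P j ((x(p := y)) j) then 1 else 0) = W p x"
        unfolding W_def by (rule sum.cong) auto
      then show ?thesis by (simp add: W_def)
    qed
    have "(\<integral>y. \<phi> (W (Suc p) (x(p := y))) \<partial>std_gauss)
       = (\<integral>y. \<phi> (W p x) + (\<phi> (Suc (W p x)) - \<phi> (W p x)) * indicator {y. P p y} y \<partial>std_gauss)"
      by (rule Bochner_Integration.integral_cong) (auto simp: w)
    also have "\<dots> = \<phi> (W p x) + (\<phi> (Suc (W p x)) - \<phi> (W p x)) * \<rho>"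
    proof -
      have "integrable std_gauss (indicator {y. P p y} :: real \<Rightarrow> real)"
        by (rule g.integrable_const_bound[where B=1]) auto
      then show ?thesis
        using meas g.prob_space by (simp add: \<rho>_def)
    qed
    finally show "(\<integral>y. \<phi> (W (Suc p) (x(p := y))) \<partial>std_gauss) = \<rho> * \<phi> (Suc (W p x)) + (1 - \<rho>) * \<phi> (W p x)"
      by (simp add: algebra_simps)
  qed simp
  also have "\<dots> = \<rho> * (\<integral>x. \<phi> (Suc (W p x)) \<partial>gauss {..<p}) + (1 - \<rho>) * (\<integral>x. \<phi> (W p x) \<partial>gauss {..<p})"
    by (subst Bochner_Integration.integral_add)
       (use int[of "\<lambda>w. \<phi> (Suc w)" p] int[of \<phi> p] Suc.prems in auto)
  also have "\<dots> = bern_expect (Suc p) (\<lambda>j. measure std_gauss {x. P j x}) \<phi>"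
    using Suc.IH[of "\<lambda>w. \<phi> (Suc w)"] Suc.IH[of \<phi>] Suc.prems by (simp add: W_def \<rho>_def)
  finally show ?case by (simp add: W_def)
qed

section \<open>Truncated likelihood ratio of the block prior\<close>

text \<open>Restriction to \<open>I\<close> is the identity on the product space, so the joint law
  of the coordinates is the product measure itself.\<close>

lemma indep_vars_PiM_coordinates:
  assumes M: "\<And>i. i \<in> I \<Longrightarrow> prob_space (M i)"
  shows "prob_space.indep_vars (PiM I M) M (\<lambda>i x. x i) I"
proof (cases "I = {}")
  case True
  interpret prob_space "PiM I M" by (intro prob_space_PiM M)
  show ?thesis unfolding indep_vars_def indep_sets_def by (simp add: True)
next
  case False
  interpret prob_space "PiM I M" by (intro prob_space_PiM M)
  have "distr (PiM I M) (PiM I M) (\<lambda>x. \<lambda>i\<in>I. x i) = distr (PiM I M) (PiM I M) (\<lambda>x. x)"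
    by (intro distr_cong) (auto simp: space_PiM)
  also have "\<dots> = PiM I (\<lambda>i. distr (PiM I M) (M i) (\<lambda>x. x i))"
    by (simp add: distr_PiM_component M cong: PiM_cong)
  finally show ?thesis
    by (subst indep_vars_iff_distr_eq_PiM'[OF False]) auto
qed

text \<open>The likelihood ratio of a mean shift \<open>\<mu>\<close>, cut off above
  \<open>t\<close>. Under the squared ratio the mass sits near \<open>2 * \<mu>\<close>, so the cut
  lowers the second moment substantially when \<open>2 * \<mu> > t\<close>, while the first moment
  loses little as long as \<open>\<mu> < t\<close>.\<close>

definition trunc_lr :: "real \<Rightarrow> real \<Rightarrow> real \<Rightarrow> real" where
  "trunc_lr \<mu> t x = exp (\<mu> * x - \<mu>\<^sup>2 / 2) * indicator {..t} x"

lemma trunc_lr_measurable [measurable]: "trunc_lr \<mu> t \<in> borel_measurable borel"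
  unfolding trunc_lr_def by measurable

lemma trunc_lr_nonneg: "0 \<le> trunc_lr \<mu> t x"
  by (simp add: trunc_lr_def)

lemma integrable_std_gauss_exp_affine: "integrable std_gauss (\<lambda>x. exp (a * x + b))"
  and integral_std_gauss_exp_affine: "(\<integral>x. exp (a * x + b) \<partial>std_gauss) = exp (a\<^sup>2 / 2 + b)"
  using std_gauss_exp_moment[of a] by (simp_all add: exp_add)

text \<open>The lost mass is bounded as in a Chernoff bound: beyond \<open>t\<close> the ratio may
  be multiplied by exp((t - \<mu>)(x - t)), which is at least 1 there, and the resulting exponential
  integrates to \<open>exp (- (t - \<mu>)\<^sup>2 / 2)\<close>.\<close>

lemma trunc_lr_first_moment:
  assumes "\<mu> \<le> t"
  shows "integrable std_gauss (trunc_lr \<mu> t)" "0 \<le> (\<integral>x. trunc_lr \<mu> t x \<partial>std_gauss)"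
    "(\<integral>x. trunc_lr \<mu> t x \<partial>std_gauss) \<le> 1"
    "1 - exp (- (t - \<mu>)\<^sup>2 / 2) \<le> (\<integral>x. trunc_lr \<mu> t x \<partial>std_gauss)"
proof -
  have i1: "integrable std_gauss (\<lambda>x. exp (\<mu> * x + - \<mu>\<^sup>2 / 2))" and v1: "(\<integral>x. exp (\<mu> * x + - \<mu>\<^sup>2 / 2) \<partial>std_gauss) = 1"
    using integrable_std_gauss_exp_affine[of \<mu> "- \<mu>\<^sup>2/2"] integral_std_gauss_exp_affine[of \<mu> "- \<mu>\<^sup>2/2"] by auto
  show int: "integrable std_gauss (trunc_lr \<mu> t)"
    by (rule Bochner_Integration.integrable_bound[OF i1]) (auto simp: trunc_lr_def indicator_def)
  show "0 \<le> (\<integral>x. trunc_lr \<mu> t x \<partial>std_gauss)" by (intro Bochner_Integration.integral_nonneg trunc_lr_nonneg)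
  have "(\<integral>x. trunc_lr \<mu> t x \<partial>std_gauss) \<le> (\<integral>x. exp (\<mu> * x + - \<mu>\<^sup>2 / 2) \<partial>std_gauss)"
    by (intro integral_mono int i1) (auto simp: trunc_lr_def indicator_def)
  then show "(\<integral>x. trunc_lr \<mu> t x \<partial>std_gauss) \<le> 1" using v1 by simp
  have i2: "integrable std_gauss (\<lambda>x. exp (t * x + (- \<mu>\<^sup>2/2 - (t - \<mu>) * t)))"
    and v2: "(\<integral>x. exp (t * x + (- \<mu>\<^sup>2/2 - (t - \<mu>) * t)) \<partial>std_gauss) = exp (t\<^sup>2/2 + (- \<mu>\<^sup>2/2 - (t - \<mu>) * t))"
    by (rule integrable_std_gauss_exp_affine, rule integral_std_gauss_exp_affine)
  have "exp (\<mu> * x + - \<mu>\<^sup>2 / 2) - exp (t * x + (- \<mu>\<^sup>2/2 - (t - \<mu>) * t)) \<le> trunc_lr \<mu> t x" for x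
  proof (cases "x \<le> t")
    case False
    then have "0 \<le> (t - \<mu>) * (x - t)" using assms by auto
    then have "\<mu> * x + - \<mu>\<^sup>2 / 2 \<le> t * x + (- \<mu>\<^sup>2/2 - (t - \<mu>) * t)" by (simp add: algebra_simps)
    then show ?thesis using False by (simp add: trunc_lr_def)
  qed (auto simp: trunc_lr_def)
  then have "(\<integral>x. exp (\<mu> * x + - \<mu>\<^sup>2 / 2) - exp (t * x + (- \<mu>\<^sup>2/2 - (t - \<mu>) * t)) \<partial>std_gauss) \<le> (\<integral>x. trunc_lr \<mu> t x \<partial>std_gauss)"
    by (intro integral_mono int Bochner_Integration.integrable_diff i1 i2)
  then have "1 - exp (t\<^sup>2/2 + (- \<mu>\<^sup>2/2 - (t - \<mu>) * t)) \<le> (\<integral>x. trunc_lr \<mu> t x \<partial>std_gauss)"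
    using v1 v2 i1 i2 by simp
  moreover have "t\<^sup>2/2 + (- \<mu>\<^sup>2/2 - (t - \<mu>) * t) = - (t - \<mu>)\<^sup>2 / 2"
    by (simp add: power2_eq_square field_simps)
  ultimately show "1 - exp (- (t - \<mu>)\<^sup>2 / 2) \<le> (\<integral>x. trunc_lr \<mu> t x \<partial>std_gauss)" by simp
qed

text \<open>Below \<open>t\<close> the factor exp(a (t - x)) is at least 1 for every nonnegative
  \<open>a\<close>. The choice \<open>a = max 0 (2 * \<mu> - t)\<close> minimises the integral after
  tilting and is 0 exactly when \<open>2 * \<mu> \<le> t\<close>.\<close>

lemma trunc_lr_second_moment:
  shows "integrable std_gauss (\<lambda>x. (trunc_lr \<mu> t x)\<^sup>2)"
    "(\<integral>x. (trunc_lr \<mu> t x)\<^sup>2 \<partial>std_gauss) \<le> exp (\<mu>\<^sup>2 - (max 0 (2 * \<mu> - t))\<^sup>2 / 2)"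
proof -
  define a where "a = max 0 (2 * \<mu> - t)"
  have i: "integrable std_gauss (\<lambda>x. exp ((2 * \<mu> - a) * x + (a * t - \<mu>\<^sup>2)))"
    and v: "(\<integral>x. exp ((2 * \<mu> - a) * x + (a * t - \<mu>\<^sup>2)) \<partial>std_gauss) = exp ((2 * \<mu> - a)\<^sup>2/2 + (a * t - \<mu>\<^sup>2))"
    by (rule integrable_std_gauss_exp_affine, rule integral_std_gauss_exp_affine)
  have le: "(trunc_lr \<mu> t x)\<^sup>2 \<le> exp ((2 * \<mu> - a) * x + (a * t - \<mu>\<^sup>2))" for x
  proof (cases "x \<le> t")
    case True
    have "0 \<le> a * (t - x)" using True by (auto simp: a_def)
    then have "2 * (\<mu> * x - \<mu>\<^sup>2 / 2) \<le> (2 * \<mu> - a) * x + (a * t - \<mu>\<^sup>2)" by (simp add: algebra_simps)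
    then show ?thesis using True by (simp add: trunc_lr_def power2_eq_square exp_add[symmetric])
  qed (auto simp: trunc_lr_def)
  show int: "integrable std_gauss (\<lambda>x. (trunc_lr \<mu> t x)\<^sup>2)"
    by (rule Bochner_Integration.integrable_bound[OF i]) (use le in auto)
  have "(\<integral>x. (trunc_lr \<mu> t x)\<^sup>2 \<partial>std_gauss) \<le> exp ((2 * \<mu> - a)\<^sup>2/2 + (a * t - \<mu>\<^sup>2))"
    unfolding v[symmetric] by (intro integral_mono int i le)
  moreover have eq: "(2 * \<mu> - a)\<^sup>2/2 + (a * t - \<mu>\<^sup>2) = \<mu>\<^sup>2 - a\<^sup>2 / 2"
  proof -
    have "a * a = a * (2 * \<mu> - t)" by (auto simp: a_def max_def)
    then show ?thesis by (simp add: power2_eq_square field_simps)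
  qed
  ultimately show "(\<integral>x. (trunc_lr \<mu> t x)\<^sup>2 \<partial>std_gauss) \<le> exp (\<mu>\<^sup>2 - (max 0 (2 * \<mu> - t))\<^sup>2 / 2)"
    unfolding eq unfolding a_def by blast
qed

text \<open>The increment of the power grows with the base. It serves to bound the variance of a
  product whose factors have mean slightly below 1.\<close>

lemma power_add_diff_le:
  fixes a x :: real assumes "0 \<le> a" "a \<le> 1" "0 \<le> x"
  shows "(a + x) ^ s - a ^ s \<le> (1 + x) ^ s - 1"
proof (induction s)
  case (Suc s)
  have "0 \<le> (a + x) ^ s - a ^ s" using assms by (simp add: power_mono)
  then have 1: "a * ((a + x) ^ s - a ^ s) \<le> (1 + x) ^ s - 1"
    using Suc assms mult_left_le_one_le[of "(a + x) ^ s - a ^ s" a] by linarith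
  have 2: "x * (a + x) ^ s \<le> x * (1 + x) ^ s" using assms by (intro mult_left_mono power_mono) auto
  show ?case using 1 2 by (simp add: algebra_simps)
qed simp

text \<open>The prior puts one spike, at a uniformly chosen position, into each of \<open>s\<close> disjoint blocks of
  length \<open>m\<close>, so that its likelihood ratio factorizes over independent blocks.\<close>

definition block_lr :: "nat \<Rightarrow> nat \<Rightarrow> real \<Rightarrow> (nat \<Rightarrow> real) \<Rightarrow> real" where
  "block_lr s m \<mu> z = (\<Prod>k<s. (\<Sum>l<m. exp (\<mu> * z (k * m + l) - \<mu>\<^sup>2 / 2)) / m)"

lemma block_index_less: "k < s \<Longrightarrow> l < m \<Longrightarrow> s * m \<le> p \<Longrightarrow> k * m + l < (p::nat)"
  by (metis add_less_cancel_left less_eq_Suc_le less_le_trans mult.commute mult_Suc_right mult_le_mono2 add.commute)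

text \<open>The integral is the smallest sum of error probabilities against the block prior in the
  sequence model. Truncation gives \<open>L \<le> block_lr\<close>, and
  \<open>1 - \<bar>1 - L\<bar> \<le> min 1 L\<close>, so it suffices to bound the mean of
  \<open>\<bar>1 - L\<bar>\<close> by a second moment. The blocks are independent, hence both
  moments of \<open>L\<close> factorize; inside a block only the m diagonal pairs can exceed
  \<open>e1\<^sup>2\<close>, and after averaging they contribute at most
  \<open>v / m\<close>.\<close>

lemma block_lr_min_integral:
  fixes \<mu> t \<tau> v :: real and s m p :: nat
  assumes mt: "\<mu> \<le> t" and m: "0 < m" and sm: "s * m \<le> p"
  defines "\<tau> \<equiv> exp (- (t - \<mu>)\<^sup>2 / 2)" and "v \<equiv> exp (\<mu>\<^sup>2 - (max 0 (2 * \<mu> - t))\<^sup>2 / 2)"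
  assumes small: "s * v / m \<le> 1"
  shows "1 - sqrt ((s * \<tau>)\<^sup>2 + 2 * (s * v / m)) \<le> (\<integral>z. min 1 (block_lr s m \<mu> z) \<partial>gauss {..<p})"
proof -
  interpret G: prob_space "gauss {..<p}" by (rule prob_space_gauss)
  define h where "h = trunc_lr \<mu> t"
  define e1 where "e1 = (\<integral>x. h x \<partial>std_gauss)"
  define e2 where "e2 = (\<integral>x. (h x)\<^sup>2 \<partial>std_gauss)"
  have [measurable]: "h \<in> borel_measurable borel" by (simp add: h_def)
  have h0: "h x \<ge> 0" for x by (simp add: h_def trunc_lr_nonneg)
  note hi = trunc_lr_first_moment[OF mt, folded h_def, folded e1_def \<tau>_def]
    trunc_lr_second_moment[of \<mu> t, folded h_def v_def, folded e2_def]
  have e2: "0 \<le> e2" unfolding e2_def by simp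
  have comp: "distr (gauss {..<p}) std_gauss (\<lambda>z. z j) = std_gauss" if "j < p" for j
    using distr_PiM_component[of "{..<p}" "\<lambda>_. std_gauss" j] prob_space_std_gauss that by auto
  have c_int: "integrable (gauss {..<p}) (\<lambda>z. f (z j))" and c_val: "(\<integral>z. f (z j) \<partial>gauss {..<p}) = (\<integral>x. f x \<partial>std_gauss)"
    if "j < p" and [measurable]: "f \<in> borel_measurable borel" and f: "integrable std_gauss f" for f :: "real \<Rightarrow> real" and j
  proof -
    have mj: "(\<lambda>z. z j) \<in> gauss {..<p} \<rightarrow>\<^sub>M std_gauss" using that by simp
    show "integrable (gauss {..<p}) (\<lambda>z. f (z j))"
      using integrable_distr[OF mj, of f] f comp[OF that(1)] by simp
    show "(\<integral>z. f (z j) \<partial>gauss {..<p}) = (\<integral>x. f x \<partial>std_gauss)"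
      using integral_distr[OF mj, of f] comp[OF that(1)] by simp
  qed
  have ind: "G.indep_vars (\<lambda>_. std_gauss) (\<lambda>j z. z j) {..<p}"
    by (rule indep_vars_PiM_coordinates) (rule prob_space_std_gauss)
  have ind_h: "G.indep_vars (\<lambda>_. borel) (\<lambda>j z. h (z j)) {..<p}"
    by (rule G.indep_vars_compose2[OF ind]) simp
  have pair: "integrable (gauss {..<p}) (\<lambda>z. h (z i) * h (z j)) \<and> (\<integral>z. h (z i) * h (z j) \<partial>gauss {..<p}) = (if i = j then e2 else e1\<^sup>2)"
    if "i < p" "j < p" for i j
  proof (cases "i = j")
    case True
    then show ?thesis using c_int[of j "\<lambda>x. (h x)\<^sup>2"] c_val[of j "\<lambda>x. (h x)\<^sup>2"] that hi
      by (simp add: power2_eq_square e2_def)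
  next
    case False
    have ij: "G.indep_vars (\<lambda>_. borel) (\<lambda>j z. h (z j)) {i, j}"
      by (rule G.indep_vars_subset[OF ind_h]) (use that in auto)
    have "integrable (gauss {..<p}) (\<lambda>z. \<Prod>k\<in>{i,j}. h (z k))"
      by (rule G.indep_vars_integrable[OF _ ij]) (use that hi c_int in auto)
    moreover have "(\<integral>z. (\<Prod>k\<in>{i,j}. h (z k)) \<partial>gauss {..<p}) = (\<Prod>k\<in>{i,j}. (\<integral>z. h (z k) \<partial>gauss {..<p}))"
      by (rule G.indep_vars_lebesgue_integral[OF _ ij]) (use that hi c_int in auto)
    ultimately show ?thesis using False that hi c_val by (simp add: e1_def power2_eq_square)
  qed
  define Y where "Y k w = (\<Sum>l<m. h (w (k * m + l))) / m" for k and w :: "nat \<Rightarrow> real"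
  define K where "K k = {k * m..<k * m + m}" for k
  have idx: "k * m + l < p" if "k < s" "l < m" for k l
    using block_index_less[OF that sm] .
  have Ksub: "K k \<subseteq> {..<p}" if "k < s" for k
    using idx[OF that, of "m - 1"] m by (auto simp: K_def)
  have disj: "disjoint_family_on K {..<s}"
  proof -
    have "j div m = k" if "j \<in> K k" for j k
      using that m unfolding K_def by (metis add.commute atLeastLessThan_iff div_nat_eqI mult.commute mult_Suc_right)
    then show ?thesis by (auto simp: disjoint_family_on_def)
  qed
  have YK: "Y k (restrict z (K k)) = Y k z" for k z
    unfolding Y_def by (intro arg_cong2[where f="(/)"] sum.cong) (auto simp: K_def)
  have Ym: "Y k \<in> borel_measurable (PiM (K k) (\<lambda>_. std_gauss))" for k
    unfolding Y_def K_def by measurable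
  have indK: "G.indep_vars (\<lambda>k. PiM (K k) (\<lambda>_. std_gauss)) (\<lambda>k z. restrict (\<lambda>j. z j) (K k)) {..<s}"
    by (rule G.indep_vars_restrict[OF ind _ disj]) (use Ksub in auto)
  have indY: "G.indep_vars (\<lambda>_. borel) (\<lambda>k z. Y k z) {..<s}"
    using G.indep_vars_compose2[OF indK, of Y "\<lambda>_. borel"] Ym by (simp add: YK)
  have indY2: "G.indep_vars (\<lambda>_. borel) (\<lambda>k z. (Y k z)\<^sup>2) {..<s}"
    by (rule G.indep_vars_compose2[OF indY]) simp
  have Y0: "Y k z \<ge> 0" for k z by (simp add: Y_def sum_nonneg h0)
  have Y1: "integrable (gauss {..<p}) (Y k)" "(\<integral>z. Y k z \<partial>gauss {..<p}) = e1" if "k < s" for k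
  proof -
    have i: "integrable (gauss {..<p}) (\<lambda>z. h (z (k * m + l)))" if "l < m" for l
      using c_int[OF idx[OF \<open>k < s\<close> that], of h] hi by simp
    show "integrable (gauss {..<p}) (Y k)" unfolding Y_def
      by (intro Bochner_Integration.integrable_divide_zero Bochner_Integration.integrable_sum i) auto
    show "(\<integral>z. Y k z \<partial>gauss {..<p}) = e1"
      unfolding Y_def using i c_val[OF idx[OF \<open>k < s\<close>], of _ h] hi m by (simp add: e1_def)
  qed
  have Y2: "integrable (gauss {..<p}) (\<lambda>z. (Y k z)\<^sup>2)" "(\<integral>z. (Y k z)\<^sup>2 \<partial>gauss {..<p}) \<le> e1\<^sup>2 + v / m" if "k < s" for k
  proof -
    have sq: "(Y k z)\<^sup>2 = (\<Sum>l<m. \<Sum>l'<m. h (z (k * m + l)) * h (z (k * m + l'))) / m\<^sup>2" for z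
      by (simp add: Y_def power_divide power2_eq_square sum_product)
    have pl: "integrable (gauss {..<p}) (\<lambda>z. h (z (k * m + l)) * h (z (k * m + l')))"
       "(\<integral>z. h (z (k * m + l)) * h (z (k * m + l')) \<partial>gauss {..<p}) = (if l = l' then e2 else e1\<^sup>2)" if "l < m" "l' < m" for l l'
      using pair[OF idx[OF \<open>k < s\<close> that(1)] idx[OF \<open>k < s\<close> that(2)]] by auto
    show "integrable (gauss {..<p}) (\<lambda>z. (Y k z)\<^sup>2)" unfolding sq
      by (intro Bochner_Integration.integrable_divide_zero Bochner_Integration.integrable_sum pl) auto
    have "(\<integral>z. (Y k z)\<^sup>2 \<partial>gauss {..<p}) = (\<Sum>l<m. \<Sum>l'<m. if l = l' then e2 else e1\<^sup>2) / m\<^sup>2"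
    proof -
      have "(\<integral>z. (\<Sum>l<m. \<Sum>l'<m. h (z (k * m + l)) * h (z (k * m + l'))) \<partial>gauss {..<p})
          = (\<Sum>l<m. \<integral>z. (\<Sum>l'<m. h (z (k * m + l)) * h (z (k * m + l'))) \<partial>gauss {..<p})"
        by (intro Bochner_Integration.integral_sum Bochner_Integration.integrable_sum pl) auto
      also have "\<dots> = (\<Sum>l<m. \<Sum>l'<m. \<integral>z. h (z (k * m + l)) * h (z (k * m + l')) \<partial>gauss {..<p})"
        by (intro sum.cong refl Bochner_Integration.integral_sum pl) auto
      also have "\<dots> = (\<Sum>l<m. \<Sum>l'<m. if l = l' then e2 else e1\<^sup>2)"
        by (intro sum.cong refl pl) auto
      finally show ?thesis unfolding sq by simp
    qed
    also have "(\<Sum>l<m. \<Sum>l'<m. if l = l' then e2 else e1\<^sup>2) \<le> (\<Sum>l<m. \<Sum>l'<m. (if l = l' then e2 else 0) + e1\<^sup>2)"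
      by (intro sum_mono) auto
    also have "\<dots> = m * e2 + m\<^sup>2 * e1\<^sup>2" by (simp add: sum.distrib power2_eq_square algebra_simps)
    also have "m * e2 + m\<^sup>2 * e1\<^sup>2 \<le> m * v + m\<^sup>2 * e1\<^sup>2" using hi by (intro add_right_mono mult_left_mono) auto
    also have "(m * v + m\<^sup>2 * e1\<^sup>2) / m\<^sup>2 = e1\<^sup>2 + v / m" using m by (simp add: field_simps power2_eq_square)
    finally show "(\<integral>z. (Y k z)\<^sup>2 \<partial>gauss {..<p}) \<le> e1\<^sup>2 + v / m" by (simp add: divide_right_mono)
  qed
  define L where "L z = (\<Prod>k<s. Y k z)" for z
  have L0: "L z \<ge> 0" for z by (auto simp: L_def intro: prod_nonneg Y0)
  have L1: "integrable (gauss {..<p}) L" "(\<integral>z. L z \<partial>gauss {..<p}) = e1 ^ s"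
    using G.indep_vars_integrable[OF _ indY] G.indep_vars_lebesgue_integral[OF _ indY] Y1
    by (simp_all add: L_def[abs_def])
  have sqL: "(L z)\<^sup>2 = (\<Prod>k<s. (Y k z)\<^sup>2)" for z by (simp add: L_def prod_power_distrib)
  have L2: "integrable (gauss {..<p}) (\<lambda>z. (L z)\<^sup>2)" 
    using G.indep_vars_integrable[OF _ indY2] Y2 by (simp add: sqL)
  have "(\<integral>z. (L z)\<^sup>2 \<partial>gauss {..<p}) = (\<Prod>k<s. \<integral>z. (Y k z)\<^sup>2 \<partial>gauss {..<p})"
    using G.indep_vars_lebesgue_integral[OF _ indY2] Y2 by (simp add: sqL)
  also have "\<dots> \<le> (\<Prod>k<s. e1\<^sup>2 + v / m)" by (intro prod_mono) (use Y2 in auto)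
  finally have L2v: "(\<integral>z. (L z)\<^sup>2 \<partial>gauss {..<p}) \<le> (e1\<^sup>2 + v / m) ^ s" by simp
  have v0: "v \<ge> 0" by (simp add: v_def)
  have i1L: "integrable (gauss {..<p}) (\<lambda>z. 1 - L z)" using L1 by auto
  have sqdiff: "(1 - L z)\<^sup>2 = 1 - 2 * L z + (L z)\<^sup>2" for z by (simp add: power2_eq_square algebra_simps)
  have i1L2: "integrable (gauss {..<p}) (\<lambda>z. (1 - L z)\<^sup>2)" unfolding sqdiff using L1 L2 by auto
  have "(\<integral>z. (1 - L z)\<^sup>2 \<partial>gauss {..<p}) = 1 - 2 * e1 ^ s + (\<integral>z. (L z)\<^sup>2 \<partial>gauss {..<p})"
    unfolding sqdiff using L1 L2 by (simp add: G.prob_space)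
  also have "\<dots> \<le> 1 - 2 * e1 ^ s + (e1\<^sup>2 + v / m) ^ s" using L2v by simp
  \<comment> \<open>As \<open>e1\<^sup>2 \<le> 1\<close>, the perturbation \<open>v / m\<close>
    costs at most what it would cost around 1; what remains is the perfect square of
    \<open>1 - e1 ^ s\<close>.\<close>
  also have "\<dots> \<le> 1 - 2 * e1 ^ s + (e1\<^sup>2) ^ s + ((1 + v / m) ^ s - 1)"
    using power_add_diff_le[of "e1\<^sup>2" "v / m" s] hi v0 m by (simp add: power_le_one)
  also have "\<dots> = (1 - e1 ^ s)\<^sup>2 + ((1 + v / m) ^ s - 1)"
    by (simp add: power2_eq_square algebra_simps power_mult_distrib)
  also have "\<dots> \<le> (s * \<tau>)\<^sup>2 + 2 * (s * v / m)"
  proof (rule add_mono)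
    have "1 + s * (e1 - 1) \<le> (1 + (e1 - 1)) ^ s" by (rule Bernoulli_inequality) (use hi in auto)
    moreover have "s * (1 - e1) \<le> s * \<tau>" using hi by (intro mult_left_mono) auto
    ultimately have "1 - e1 ^ s \<le> s * \<tau>" by (simp add: algebra_simps)
    then show "(1 - e1 ^ s)\<^sup>2 \<le> (s * \<tau>)\<^sup>2" using hi by (intro power_mono) (auto simp: power_le_one)
    have "(1 + v / m) ^ s \<le> exp (v / m) ^ s" by (intro power_mono exp_ge_add_one_self) (use v0 in auto)
    also have "\<dots> = exp (s * v / m)" by (simp add: exp_of_nat_mult[symmetric])
    also have "\<dots> \<le> 1 + s * v / m + (s * v / m)\<^sup>2" by (rule exp_bound) (use small v0 in auto)
    also have "(s * v / m)\<^sup>2 \<le> s * v / m" using small v0 mult_left_le[of "s * v / m" "s * v / m"] by (simp only: power2_eq_square) simp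
    finally show "(1 + v / m) ^ s - 1 \<le> 2 * (s * v / m)" by (simp add: mult.commute)
  qed
  finally have var: "(\<integral>z. (1 - L z)\<^sup>2 \<partial>gauss {..<p}) \<le> (s * \<tau>)\<^sup>2 + 2 * (s * v / m)" .
  have ia: "integrable (gauss {..<p}) (\<lambda>z. \<bar>1 - L z\<bar>)" using i1L by auto
  \<comment> \<open>Nonnegativity of this variance is the Cauchy-Schwarz inequality that passes from
    the second moment to the first.\<close>
  have "0 \<le> G.variance (\<lambda>z. \<bar>1 - L z\<bar>)" by (rule G.variance_positive)
  also have "\<dots> = (\<integral>z. (1 - L z)\<^sup>2 \<partial>gauss {..<p}) - (\<integral>z. \<bar>1 - L z\<bar> \<partial>gauss {..<p})\<^sup>2"
    using i1L2 ia by (subst G.variance_eq) auto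
  finally have "(\<integral>z. \<bar>1 - L z\<bar> \<partial>gauss {..<p}) \<le> sqrt ((s * \<tau>)\<^sup>2 + 2 * (s * v / m))"
    using var by (intro real_le_rsqrt) auto
  then have "1 - sqrt ((s * \<tau>)\<^sup>2 + 2 * (s * v / m)) \<le> (\<integral>z. 1 - \<bar>1 - L z\<bar> \<partial>gauss {..<p})"
    using ia by (simp add: G.prob_space)
  also have "\<dots> \<le> (\<integral>z. min 1 (block_lr s m \<mu> z) \<partial>gauss {..<p})"
  proof (rule integral_mono)
    show "integrable (gauss {..<p}) (\<lambda>z. 1 - \<bar>1 - L z\<bar>)" using ia by auto
    show "integrable (gauss {..<p}) (\<lambda>z. min 1 (block_lr s m \<mu> z))"
    proof (rule G.integrable_const_bound[where B=1])
      have "(\<lambda>z. z (k * m + l)) \<in> borel_measurable (gauss {..<p})" if "k < s" "l < m" for k l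
        using idx[OF that] by simp
      then show "(\<lambda>z. min 1 (block_lr s m \<mu> z)) \<in> borel_measurable (gauss {..<p})"
        unfolding block_lr_def by (intro borel_measurable_min borel_measurable_prod borel_measurable_divide borel_measurable_sum) auto
      have "0 \<le> block_lr s m \<mu> z" for z by (auto simp: block_lr_def intro!: prod_nonneg divide_nonneg_nonneg sum_nonneg)
      then show "AE z in gauss {..<p}. norm (min 1 (block_lr s m \<mu> z)) \<le> 1" by (auto simp: min_def)
    qed
    fix z
    have hle: "h x \<le> exp (\<mu> * x - \<mu>\<^sup>2 / 2)" for x by (simp add: h_def trunc_lr_def indicator_def)
    have "L z \<le> block_lr s m \<mu> z"
      unfolding L_def block_lr_def
      by (intro prod_mono conjI Y0) (auto simp: Y_def intro!: divide_right_mono sum_mono hle)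
    then show "1 - \<bar>1 - L z\<bar> \<le> min 1 (block_lr s m \<mu> z)" by (auto simp: abs_if min_def)
  qed
  finally show ?thesis .
qed

section \<open>Diagonally dominant matrices and Neumann series\<close>

lemma sum_mult_delta:
  fixes f :: "nat \<Rightarrow> real"
  assumes "a < p"
  shows "(\<Sum>k<p. f k * (if a = k then 1 else 0)) = f a" "(\<Sum>k<p. (if a = k then 1 else 0) * f k) = f a"
    "(\<Sum>k<p. f k * (if k = a then 1 else 0)) = f a" "(\<Sum>k<p. (if k = a then 1 else 0) * f k) = f a"
  using assms by (simp_all add: if_distrib if_distribR cong: if_cong)

text \<open>Entry \<open>a\<close> of the vector attached to the pair \<open>(j, k)\<close>. Every
  off-diagonal position occurs twice, as \<open>(j, k)\<close> and \<open>(k, j)\<close>, which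
  explains the division by 2. The diagonal pairs carry the slack of the dominance condition.\<close>

definition dd_factor :: "nat \<Rightarrow> (nat \<Rightarrow> nat \<Rightarrow> real) \<Rightarrow> nat \<Rightarrow> nat \<times> nat \<Rightarrow> real" where
  "dd_factor p D a = (\<lambda>(j, k).
     if j = k then sqrt (D j j - (\<Sum>l\<in>{..<p} - {j}. \<bar>D j l\<bar>)) * (if a = j then 1 else 0)
     else sqrt (\<bar>D j k\<bar> / 2) * ((if a = j then 1 else 0) + sgn (D j k) * (if a = k then 1 else 0)))"

text \<open>A symmetric diagonally dominant matrix is a nonnegative combination of the rank-one matrices
  \<open>(e\<^sub>j \<plusminus> e\<^sub>k)(e\<^sub>j \<plusminus> e\<^sub>k)\<^sup>T\<close> and \<open>e\<^sub>j e\<^sub>j\<^sup>T\<close>.\<close>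

lemma dd_factor_product:
  assumes sym: "\<And>j k. j < p \<Longrightarrow> k < p \<Longrightarrow> D j k = D k j"
    and dom: "\<And>j. j < p \<Longrightarrow> (\<Sum>l\<in>{..<p} - {j}. \<bar>D j l\<bar>) \<le> D j j"
    and ab: "a < p" "b < p"
  shows "(\<Sum>c\<in>{..<p} \<times> {..<p}. dd_factor p D a c * dd_factor p D b c) = D a b"
proof -
  define \<delta> where "\<delta> x y = (if x = y then 1 else 0 :: real)" for x y :: nat
  define R where "R j = D j j - (\<Sum>l\<in>{..<p} - {j}. \<bar>D j l\<bar>)" for j
  define Q where "Q j k = (if j = k then 0 else D j k)" for j k
  have R0: "0 \<le> R j" if "j < p" for j using dom[OF that] by (simp add: R_def)
  have delta: "(\<Sum>k<p. f k * \<delta> x k) = f x" "(\<Sum>k<p. \<delta> x k * f k) = f x" if "x < p" for x and f :: "nat \<Rightarrow> real"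
    using sum_mult_delta[OF that] by (auto simp: \<delta>_def)
  \<comment> \<open>With \<open>Q\<close> the off-diagonal part of \<open>D\<close>, the two terms
    in \<open>\<bar>Q j k\<bar>\<close> fall on the diagonal and sum to exactly the amount
    subtracted in \<open>R\<close>, whereas the two signed terms rebuild \<open>D\<close> off the
    diagonal.\<close>
  have tm: "dd_factor p D a (j, k) * dd_factor p D b (j, k)
     = \<delta> j k * (R j * (\<delta> a j * \<delta> b j)) + \<bar>Q j k\<bar> / 2 * (\<delta> a j * \<delta> b j) + \<bar>Q j k\<bar> / 2 * (\<delta> a k * \<delta> b k)
       + Q j k / 2 * (\<delta> a j * \<delta> b k) + Q j k / 2 * (\<delta> a k * \<delta> b j)" if "j < p" "k < p" for j k
  proof (cases "j = k")
    case True
    then show ?thesis using R0[OF that(1)]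
      by (simp add: dd_factor_def Q_def \<delta>_def R_def)
  next
    case False
    define x where "x = D j k"
    have s: "sqrt (\<bar>x\<bar> / 2) * sqrt (\<bar>x\<bar> / 2) = \<bar>x\<bar> / 2" by simp
    have "dd_factor p D a (j, k) * dd_factor p D b (j, k)
      = (sqrt (\<bar>x\<bar> / 2) * sqrt (\<bar>x\<bar> / 2)) * ((\<delta> a j + sgn x * \<delta> a k) * (\<delta> b j + sgn x * \<delta> b k))"
      using False by (simp add: dd_factor_def \<delta>_def x_def algebra_simps)
    also have "\<dots> = \<bar>x\<bar> / 2 * (\<delta> a j * \<delta> b j) + (\<bar>x\<bar> * sgn x * sgn x) / 2 * (\<delta> a k * \<delta> b k)
       + (\<bar>x\<bar> * sgn x) / 2 * (\<delta> a j * \<delta> b k) + (\<bar>x\<bar> * sgn x) / 2 * (\<delta> a k * \<delta> b j)"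
      unfolding s by (simp add: field_simps)
    also have "\<bar>x\<bar> * sgn x * sgn x = \<bar>x\<bar>" by (simp add: sgn_if)
    also have "\<bar>x\<bar> * sgn x = x" by (simp add: abs_mult_sgn)
    finally show ?thesis using False by (simp add: Q_def \<delta>_def[of j k] x_def)
  qed
  have swap: "(\<Sum>j<p. \<Sum>k<p. f j k) = (\<Sum>k<p. \<Sum>j<p. f j k)" for f :: "nat \<Rightarrow> nat \<Rightarrow> real"
    by (rule sum.swap)
  have Qs: "Q j k = Q k j" if "j < p" "k < p" for j k using sym[OF that] by (simp add: Q_def)
  have "(\<Sum>c\<in>{..<p} \<times> {..<p}. dd_factor p D a c * dd_factor p D b c)
      = (\<Sum>j<p. \<Sum>k<p. dd_factor p D a (j, k) * dd_factor p D b (j, k))"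
    by (subst sum.cartesian_product) (simp add: case_prod_beta')
  also have "\<dots> = (\<Sum>j<p. \<Sum>k<p. \<delta> j k * (R j * (\<delta> a j * \<delta> b j))) + (\<Sum>j<p. \<Sum>k<p. \<bar>Q j k\<bar> / 2 * (\<delta> a j * \<delta> b j))
     + (\<Sum>j<p. \<Sum>k<p. \<bar>Q j k\<bar> / 2 * (\<delta> a k * \<delta> b k)) + (\<Sum>j<p. \<Sum>k<p. Q j k / 2 * (\<delta> a j * \<delta> b k))
     + (\<Sum>j<p. \<Sum>k<p. Q j k / 2 * (\<delta> a k * \<delta> b j))"
    by (simp add: tm sum.distrib)
  also have "(\<Sum>j<p. \<Sum>k<p. \<delta> j k * (R j * (\<delta> a j * \<delta> b j))) = R a * \<delta> b a"
  proof -
    have "(\<Sum>k<p. \<delta> j k * (R j * (\<delta> a j * \<delta> b j))) = \<delta> a j * (R j * \<delta> b j)" if "j < p" for j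
      using that delta(2)[of j "\<lambda>_. R j * (\<delta> a j * \<delta> b j)"] by simp
    then show ?thesis using delta(2)[OF ab(1), of "\<lambda>j. R j * \<delta> b j"] by simp
  qed
  also have "(\<Sum>j<p. \<Sum>k<p. \<bar>Q j k\<bar> / 2 * (\<delta> a j * \<delta> b j)) = (\<Sum>k<p. \<bar>Q a k\<bar>) / 2 * \<delta> b a"
    unfolding sum_distrib_right[symmetric]
    using delta(2)[OF ab(1), of "\<lambda>j. (\<Sum>k<p. \<bar>Q j k\<bar> / 2) * \<delta> b j"]
    by (simp add: mult.left_commute sum_divide_distrib)
  also have "(\<Sum>j<p. \<Sum>k<p. \<bar>Q j k\<bar> / 2 * (\<delta> a k * \<delta> b k)) = (\<Sum>k<p. \<bar>Q a k\<bar>) / 2 * \<delta> b a"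
  proof -
    have "(\<Sum>j<p. \<Sum>k<p. \<bar>Q j k\<bar> / 2 * (\<delta> a k * \<delta> b k)) = (\<Sum>k<p. (\<Sum>j<p. \<bar>Q j k\<bar> / 2) * (\<delta> a k * \<delta> b k))"
      by (subst swap) (simp add: sum_distrib_right)
    also have "\<dots> = (\<Sum>j<p. \<bar>Q j a\<bar> / 2) * \<delta> b a"
      using delta(2)[OF ab(1), of "\<lambda>k. (\<Sum>j<p. \<bar>Q j k\<bar> / 2) * \<delta> b k"] by (simp add: mult.left_commute)
    also have "(\<Sum>j<p. \<bar>Q j a\<bar> / 2) = (\<Sum>k<p. \<bar>Q a k\<bar>) / 2"
      using Qs ab by (simp add: sum_divide_distrib)
    finally show ?thesis .
  qed
  also have "(\<Sum>j<p. \<Sum>k<p. Q j k / 2 * (\<delta> a j * \<delta> b k)) = Q a b / 2"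
  proof -
    have "(\<Sum>k<p. Q j k / 2 * (\<delta> a j * \<delta> b k)) = \<delta> a j * (Q j b / 2)" for j
      using delta(1)[OF ab(2), of "\<lambda>k. Q j k / 2 * \<delta> a j"] by (simp add: mult_ac)
    then have "(\<Sum>j<p. \<Sum>k<p. Q j k / 2 * (\<delta> a j * \<delta> b k)) = (\<Sum>j<p. \<delta> a j * (Q j b / 2))"
      by (intro sum.cong refl)
    also have "\<dots> = Q a b / 2" by (rule delta(2)[OF ab(1)])
    finally show ?thesis .
  qed
  also have "(\<Sum>j<p. \<Sum>k<p. Q j k / 2 * (\<delta> a k * \<delta> b j)) = Q b a / 2"
  proof -
    have "(\<Sum>k<p. Q j k / 2 * (\<delta> a k * \<delta> b j)) = \<delta> b j * (Q j a / 2)" for j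
      using delta(1)[OF ab(1), of "\<lambda>k. Q j k / 2 * \<delta> b j"] by (simp add: mult_ac)
    then have "(\<Sum>j<p. \<Sum>k<p. Q j k / 2 * (\<delta> a k * \<delta> b j)) = (\<Sum>j<p. \<delta> b j * (Q j a / 2))"
      by (intro sum.cong refl)
    also have "\<dots> = Q b a / 2" by (rule delta(2)[OF ab(2)])
    finally show ?thesis .
  qed
  also have "(\<Sum>k<p. \<bar>Q a k\<bar>) = (\<Sum>l\<in>{..<p} - {a}. \<bar>D a l\<bar>)"
    by (rule sum.mono_neutral_cong_right) (auto simp: Q_def)
  finally show ?thesis
    using Qs[OF ab] by (auto simp: \<delta>_def R_def Q_def)
qed

text \<open>Entries of the powers of \<open>- E\<close>, so that \<open>neumann_inverse\<close> is
  the inverse of the identity plus \<open>E\<close>. As a series of polynomials in the entries it is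
  visibly measurable in \<open>E\<close>.\<close>

fun neumann_term :: "nat \<Rightarrow> (nat \<Rightarrow> nat \<Rightarrow> real) \<Rightarrow> nat \<Rightarrow> nat \<Rightarrow> nat \<Rightarrow> real" where
  "neumann_term p E 0 j k = (if j = k then 1 else 0)"
| "neumann_term p E (Suc q) j k = - (\<Sum>m<p. neumann_term p E q j m * E m k)"

definition neumann_inverse :: "nat \<Rightarrow> (nat \<Rightarrow> nat \<Rightarrow> real) \<Rightarrow> nat \<Rightarrow> nat \<Rightarrow> real" where
  "neumann_inverse p E j k = (\<Sum>q. neumann_term p E q j k)"

context
  fixes p :: nat and E :: "nat \<Rightarrow> nat \<Rightarrow> real" and \<epsilon> :: real
  assumes E: "\<And>j k. j < p \<Longrightarrow> k < p \<Longrightarrow> \<bar>E j k\<bar> \<le> \<epsilon>" and eps: "0 \<le> \<epsilon>" "p * \<epsilon> \<le> 1 / 2"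
begin

text \<open>Each further multiplication by \<open>E\<close> costs a factor
  \<open>p * \<epsilon> \<le> 1 / 2\<close>. The bound starts at index 1 because the term of index 0
  is the identity and not small.\<close>

lemma neumann_term_bound:
  assumes "j < p" "k < p"
  shows "\<bar>neumann_term p E (Suc q) j k\<bar> \<le> \<epsilon> * (1 / 2) ^ q"
  using assms(2)
proof (induction q arbitrary: k)
  case 0
  have "neumann_term p E (Suc 0) j k = - E j k"
    using sum_mult_delta(2)[OF assms(1), of "\<lambda>m. E m k"] by simp
  then show ?case using E assms(1) 0 by simp
next
  case (Suc q)
  have "\<bar>neumann_term p E (Suc (Suc q)) j k\<bar> \<le> (\<Sum>m<p. \<bar>neumann_term p E (Suc q) j m\<bar> * \<bar>E m k\<bar>)"
    by (subst neumann_term.simps, subst abs_minus, subst abs_mult[symmetric]) (rule sum_abs)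
  also have "\<dots> \<le> (\<Sum>m<p. \<epsilon> * (1 / 2) ^ q * \<epsilon>)"
    by (intro sum_mono mult_mono Suc.IH E) (use Suc.prems eps in auto)
  also have "\<dots> = (p * \<epsilon>) * (\<epsilon> * (1 / 2) ^ q)" by simp
  also have "\<dots> \<le> 1 / 2 * (\<epsilon> * (1 / 2) ^ q)" using eps by (intro mult_right_mono) auto
  finally show ?case by simp
qed

lemma neumann_term_summable:
  assumes "j < p" "k < p"
  shows "summable (\<lambda>q. neumann_term p E (Suc q) j k)" "summable (\<lambda>q. neumann_term p E q j k)"
proof -
  show *: "summable (\<lambda>q. neumann_term p E (Suc q) j k)"
    by (rule summable_comparison_test[of _ "\<lambda>q. \<epsilon> * (1 / 2) ^ q"])
       (use neumann_term_bound[OF assms] in \<open>auto intro: summable_mult summable_geometric\<close>)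
  then show "summable (\<lambda>q. neumann_term p E q j k)"
    using summable_Suc_iff[of "\<lambda>q. neumann_term p E q j k"] by blast
qed

lemma neumann_inverse_Suc:
  assumes "j < p" "k < p"
  shows "neumann_inverse p E j k = (if j = k then 1 else 0) + (\<Sum>q. neumann_term p E (Suc q) j k)"
  using suminf_split_head[OF neumann_term_summable(2)[OF assms]]
  unfolding neumann_inverse_def by (simp del: neumann_term.simps add: neumann_term.simps(1))

lemma neumann_inverse_near_identity:
  assumes "j < p" "k < p"
  shows "\<bar>neumann_inverse p E j k - (if j = k then 1 else 0)\<bar> \<le> 2 * \<epsilon>"
proof -
  have s: "summable (\<lambda>q. \<epsilon> * (1 / 2) ^ q)" by (auto intro: summable_mult summable_geometric)
  have "\<bar>\<Sum>q. neumann_term p E (Suc q) j k\<bar> \<le> (\<Sum>q. \<epsilon> * (1 / 2) ^ q)"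
    using norm_suminf_le[of "\<lambda>q. neumann_term p E (Suc q) j k" "\<lambda>q. \<epsilon> * (1 / 2) ^ q"] neumann_term_bound[OF assms] s
    by simp
  also have "\<dots> = 2 * \<epsilon>" by (subst suminf_mult) (auto simp: suminf_geometric intro: summable_geometric)
  finally show ?thesis by (simp add: neumann_inverse_Suc[OF assms] del: neumann_term.simps)
qed

text \<open>Multiplication by \<open>E\<close> shifts the series by one index and flips the sign, so
  everything except the identity cancels.\<close>

lemma neumann_inverse_mult:
  assumes "j < p" "k < p"
  shows "(\<Sum>m<p. neumann_inverse p E j m * ((if m = k then 1 else 0) + E m k)) = (if j = k then 1 else 0)"
proof -
  have "(\<Sum>m<p. neumann_inverse p E j m * E m k) = (\<Sum>m<p. \<Sum>q. neumann_term p E q j m * E m k)"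
    unfolding neumann_inverse_def
    by (intro sum.cong refl suminf_mult2 neumann_term_summable) (use assms in auto)
  also have "\<dots> = (\<Sum>q. \<Sum>m<p. neumann_term p E q j m * E m k)"
    by (rule suminf_sum[symmetric]) (use assms neumann_term_summable in \<open>auto intro!: summable_mult2\<close>)
  also have "\<dots> = (\<Sum>q. - neumann_term p E (Suc q) j k)" by simp
  also have "\<dots> = - (\<Sum>q. neumann_term p E (Suc q) j k)" by (rule suminf_minus[OF neumann_term_summable(1)[OF assms]])
  finally show ?thesis
    using sum_mult_delta(3)[OF assms(2), of "neumann_inverse p E j"]
    by (simp add: distrib_left sum.distrib neumann_inverse_Suc[OF assms] del: neumann_term.simps)
qed

end

section \<open>Concentration of sub-Gaussian Gram matrices\<close>

text \<open>Entrywise closeness suits both ends: summing a row gives diagonal dominance, and a union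
  bound over the entries gives concentration.\<close>

definition good_design :: "nat \<Rightarrow> nat \<Rightarrow> real \<Rightarrow> (nat \<Rightarrow> nat \<Rightarrow> real) \<Rightarrow> bool" where
  "good_design n p \<epsilon> X \<longleftrightarrow> (\<forall>j<p. \<forall>k<p. \<bar>(\<Sum>i<n. X i j * X i k) / n - (if j = k then 1 else 0)\<bar> \<le> \<epsilon>)"

text \<open>Taylor expansion keeping the linear term exact, so that a centred variable contributes
  only at second order.\<close>

lemma exp_le_quadratic: "exp y \<le> 1 + y + y\<^sup>2 * exp \<bar>y\<bar>" for y :: real
proof -
  obtain t where t: "\<bar>t\<bar> \<le> \<bar>y\<bar>" "exp y = (\<Sum>m<2. (y ^ m) / fact m) + (exp t / fact 2) * y ^ 2"
    using Maclaurin_exp_le[of y 2] by blast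
  have "exp t / 2 * y\<^sup>2 \<le> exp \<bar>y\<bar> * y\<^sup>2"
  proof (rule mult_right_mono)
    have "exp t \<le> exp \<bar>y\<bar>" using t(1) by simp
    then show "exp t / 2 \<le> exp \<bar>y\<bar>" using exp_gt_zero[of t] by linarith
  qed simp
  then show ?thesis using t(2) by (simp add: numeral_2_eq_2 mult.commute)
qed

text \<open>Writing \<open>exp (a u\<^sup>2)\<close> as a Gaussian average of \<open>exp (sqrt (2 a) g u)\<close> turns the bound on the
  moment generating function into a square-exponential moment.\<close>

lemma subgaussian_exp_square:
  fixes \<tau> :: real
  assumes "prob_space \<nu>" and [measurable]: "U \<in> borel_measurable \<nu>" and \<tau>: "\<tau> > 0"
    and mgf: "\<And>t. (\<integral>\<^sup>+x. ennreal (exp (t * U x)) \<partial>\<nu>) \<le> ennreal (exp (\<tau> * t\<^sup>2 / 2))"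
  shows "(\<integral>\<^sup>+x. ennreal (exp ((U x)\<^sup>2 / (4 * \<tau>))) \<partial>\<nu>) \<le> ennreal (sqrt 2)"
proof -
  interpret nu: prob_space \<nu> by fact
  interpret g: prob_space std_gauss by (rule prob_space_std_gauss)
  interpret pair_sigma_finite \<nu> std_gauss by unfold_locales
  \<comment> \<open>Chosen so that \<open>(c * U x)\<^sup>2 / 2\<close> is the wanted exponent
    \<open>(U x)\<^sup>2 / (4 * \<tau>)\<close>; the sub-Gaussian bound at \<open>c * y\<close> then
    becomes \<open>y\<^sup>2 / 4\<close>, which is still integrable against
    \<open>std_gauss\<close>.\<close>
  define c where "c = 1 / sqrt (2 * \<tau>)"
  have c2: "c\<^sup>2 = 1 / (2 * \<tau>)" using \<tau> by (simp add: c_def power_divide)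
  have "(\<integral>\<^sup>+x. ennreal (exp ((U x)\<^sup>2 / (4 * \<tau>))) \<partial>\<nu>) = (\<integral>\<^sup>+x. (\<integral>\<^sup>+y. ennreal (exp ((c * U x) * y)) \<partial>std_gauss) \<partial>\<nu>)"
    unfolding nn_integral_std_gauss_exp by (simp add: power_mult_distrib c2 mult.commute)
  also have "\<dots> = (\<integral>\<^sup>+y. (\<integral>\<^sup>+x. ennreal (exp ((c * U x) * y)) \<partial>\<nu>) \<partial>std_gauss)"
    by (rule Fubini'[symmetric]) measurable
  also have "\<dots> \<le> (\<integral>\<^sup>+y. ennreal (exp (y\<^sup>2 / 4)) \<partial>std_gauss)"
  proof (rule nn_integral_mono)
    fix y
    have "\<tau> * (c * y)\<^sup>2 / 2 = y\<^sup>2 / 4" using \<tau> by (simp add: power_mult_distrib c2)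
    then show "(\<integral>\<^sup>+x. ennreal (exp ((c * U x) * y)) \<partial>\<nu>) \<le> ennreal (exp (y\<^sup>2 / 4))"
      using mgf[of "c * y"] by (simp only: mult.commute mult.left_commute)
  qed
  also have "\<dots> = ennreal (sqrt 2)" by (rule nn_integral_std_gauss_exp_sq)
  finally show ?thesis .
qed

text \<open>With a = 1 / (8 \<tau>) this is 2 / a^2 times exp (2 a), from the quadratic remainder,
  times \<open>sqrt 2\<close>, from the square-exponential moment.\<close>

definition bernstein_const :: "real \<Rightarrow> real" where
  "bernstein_const \<tau> = 128 * \<tau>\<^sup>2 * exp (1 / (4 * \<tau>)) * sqrt 2"

text \<open>Second-order expansion of the exponential; the linear term integrates to 0 because the
  second moment of \<open>U\<close> is 1. In the remainder one factor exp (a (w + 1)) absorbs the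
  square of w - 1 and another one bounds exp \<bar>s (w - 1)\<bar>, where w is the square of
  \<open>U x\<close>; together they stay within the available moment exp (2 a w).\<close>

lemma subgaussian_square_mgf:
  fixes \<tau> s :: real
  assumes "prob_space \<nu>" and [measurable]: "U \<in> borel_measurable \<nu>" and \<tau>: "\<tau> > 0"
    and mgf: "\<And>t. (\<integral>\<^sup>+x. ennreal (exp (t * U x)) \<partial>\<nu>) \<le> ennreal (exp (\<tau> * t\<^sup>2 / 2))"
    and U2: "integrable \<nu> (\<lambda>x. (U x)\<^sup>2)" "(\<integral>x. (U x)\<^sup>2 \<partial>\<nu>) = 1" and s: "\<bar>s\<bar> \<le> 1 / (8 * \<tau>)"
  shows "integrable \<nu> (\<lambda>x. exp (s * ((U x)\<^sup>2 - 1)))"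
    "(\<integral>x. exp (s * ((U x)\<^sup>2 - 1)) \<partial>\<nu>) \<le> exp (bernstein_const \<tau> * s\<^sup>2)"
proof -
  interpret nu: prob_space \<nu> by fact
  define a where "a = 1 / (8 * \<tau>)"
  have a: "a > 0" using \<tau> by (simp add: a_def)
  define C where "C = 2 / a\<^sup>2 * exp (2 * a)"
  have C: "C \<ge> 0" by (simp add: C_def)
  have nn: "(\<integral>\<^sup>+x. ennreal (exp (2 * a * (U x)\<^sup>2)) \<partial>\<nu>) \<le> ennreal (sqrt 2)"
    using subgaussian_exp_square[OF assms(1-4)] by (simp add: a_def mult.commute)
  have ie: "integrable \<nu> (\<lambda>x. exp (2 * a * (U x)\<^sup>2))"
    by (rule integrableI_nonneg) (use nn in \<open>auto intro: le_less_trans\<close>)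
  have ve: "(\<integral>x. exp (2 * a * (U x)\<^sup>2) \<partial>\<nu>) \<le> sqrt 2"
    using nn nn_integral_eq_integral[OF ie] by simp
  have pt: "exp (s * ((U x)\<^sup>2 - 1)) \<le> 1 + s * ((U x)\<^sup>2 - 1) + s\<^sup>2 * C * exp (2 * a * (U x)\<^sup>2)" for x
  proof -
    define w where "w = (U x)\<^sup>2"
    have w: "w \<ge> 0" by (simp add: w_def)
    have b: "\<bar>w - 1\<bar> \<le> w + 1" using w by auto
    have b2: "(w - 1)\<^sup>2 \<le> (w + 1)\<^sup>2" using w by (simp add: power2_eq_square algebra_simps)
    have "(a * (w + 1))\<^sup>2 / 2 \<le> exp (a * (w + 1))"
      using exp_lower_Taylor_quadratic[of "a * (w + 1)"] a w mult_nonneg_nonneg[of a "w + 1"] by linarith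
    then have "(a * (w + 1))\<^sup>2 / 2 * (2 / a\<^sup>2) \<le> exp (a * (w + 1)) * (2 / a\<^sup>2)"
      by (rule mult_right_mono) simp
    then have q: "(w + 1)\<^sup>2 \<le> 2 / a\<^sup>2 * exp (a * (w + 1))"
      using a by (simp add: power_mult_distrib) (simp add: mult.commute[of _ 2])
    have e: "\<bar>s * (w - 1)\<bar> \<le> a * (w + 1)"
      unfolding abs_mult using s b a by (intro mult_mono) (auto simp: a_def)
    have "exp (s * (w - 1)) \<le> 1 + s * (w - 1) + (s * (w - 1))\<^sup>2 * exp \<bar>s * (w - 1)\<bar>"
      by (rule exp_le_quadratic)
    also have "(s * (w - 1))\<^sup>2 * exp \<bar>s * (w - 1)\<bar> \<le> (s\<^sup>2 * (2 / a\<^sup>2 * exp (a * (w + 1)))) * exp (a * (w + 1))"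
    proof (rule mult_mono)
      show "(s * (w - 1))\<^sup>2 \<le> s\<^sup>2 * (2 / a\<^sup>2 * exp (a * (w + 1)))"
        unfolding power_mult_distrib using b2 q by (intro mult_left_mono) auto
    qed (use e a in auto)
    also have "\<dots> = s\<^sup>2 * C * exp (2 * a * w)"
      by (simp add: C_def exp_add[symmetric] algebra_simps)
    finally show ?thesis by (simp add: w_def)
  qed
  have ir: "integrable \<nu> (\<lambda>x. 1 + s * ((U x)\<^sup>2 - 1) + s\<^sup>2 * C * exp (2 * a * (U x)\<^sup>2))"
    using U2 ie by auto
  show int: "integrable \<nu> (\<lambda>x. exp (s * ((U x)\<^sup>2 - 1)))"
    by (rule Bochner_Integration.integrable_bound[OF ir]) (auto intro!: AE_I2 order_trans[OF pt abs_ge_self])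
  have "(\<integral>x. exp (s * ((U x)\<^sup>2 - 1)) \<partial>\<nu>) \<le> (\<integral>x. 1 + s * ((U x)\<^sup>2 - 1) + s\<^sup>2 * C * exp (2 * a * (U x)\<^sup>2) \<partial>\<nu>)"
    by (intro integral_mono int ir pt)
  also have "\<dots> = 1 + s\<^sup>2 * C * (\<integral>x. exp (2 * a * (U x)\<^sup>2) \<partial>\<nu>)"
    using U2 ie by (simp add: nu.prob_space)
  also have "\<dots> \<le> 1 + s\<^sup>2 * C * sqrt 2" using ve C by (intro add_left_mono mult_left_mono) auto
  also have "s\<^sup>2 * C * sqrt 2 = bernstein_const \<tau> * s\<^sup>2"
    using \<tau> by (simp add: C_def a_def bernstein_const_def power_divide field_simps)
  also have "1 + bernstein_const \<tau> * s\<^sup>2 \<le> exp (bernstein_const \<tau> * s\<^sup>2)" by (rule exp_ge_add_one_self)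
  finally show "(\<integral>x. exp (s * ((U x)\<^sup>2 - 1)) \<partial>\<nu>) \<le> exp (bernstein_const \<tau> * s\<^sup>2)" .
qed

text \<open>Chernoff bound for both signs. The choice \<open>s = \<epsilon> / (2 * C)\<close>
  minimises C s^2 - s \<epsilon> and leaves - \<epsilon>^2 / (4 C) per row; the upper bound on
  \<open>\<epsilon>\<close> says exactly that \<open>s \<le> 1 / (8 * \<tau>)\<close>, the range of
  the moment bound.\<close>

lemma subgaussian_square_sum_tail:
  fixes \<tau> \<epsilon> :: real and n :: nat
  assumes nu: "prob_space \<nu>" and U[measurable]: "U \<in> borel_measurable \<nu>" and \<tau>: "\<tau> > 0"
    and mgf: "\<And>t. (\<integral>\<^sup>+x. ennreal (exp (t * U x)) \<partial>\<nu>) \<le> ennreal (exp (\<tau> * t\<^sup>2 / 2))"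
    and U2: "integrable \<nu> (\<lambda>x. (U x)\<^sup>2)" "(\<integral>x. (U x)\<^sup>2 \<partial>\<nu>) = 1"
    and eps: "0 < \<epsilon>" "\<epsilon> \<le> bernstein_const \<tau> / (4 * \<tau>)"
  defines "M \<equiv> PiM {..<n} (\<lambda>_. \<nu>)"
  shows "measure M {X \<in> space M. \<bar>(\<Sum>i<n. (U (X i))\<^sup>2) / n - 1\<bar> > \<epsilon>} \<le> 2 * exp (- real n * \<epsilon>\<^sup>2 / (4 * bernstein_const \<tau>))"
proof (cases "n = 0")
  case True
  interpret M: prob_space M unfolding M_def by (intro prob_space_PiM nu)
  show ?thesis using True by (intro order_trans[OF M.prob_le_1]) auto
next
  case False
  interpret M: prob_space M unfolding M_def by (intro prob_space_PiM nu)
  interpret product_sigma_finite "\<lambda>_::nat. \<nu>"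
    by (simp add: product_sigma_finite_def nu prob_space_imp_sigma_finite)
  have mi[measurable]: "(\<lambda>X. U (X i)) \<in> borel_measurable M" if "i < n" for i
    by (rule measurable_compose[OF _ U]) (use that in \<open>simp add: M_def\<close>)
  define C where "C = bernstein_const \<tau>"
  have C: "C > 0" using \<tau> by (simp add: C_def bernstein_const_def)
  define s where "s = \<epsilon> / (2 * C)"
  have s: "0 < s" "s \<le> 1 / (8 * \<tau>)" using eps C \<tau> by (auto simp: s_def C_def field_simps)
  have one: "measure M {X \<in> space M. exp (\<sigma> * (\<Sum>i<n. (U (X i))\<^sup>2 - 1)) \<ge> exp (s * n * \<epsilon>)} \<le> exp (- real n * \<epsilon>\<^sup>2 / (4 * C))"
    if "\<sigma> = s \<or> \<sigma> = - s" for \<sigma>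
  proof -
    have sg: "\<bar>\<sigma>\<bar> \<le> 1 / (8 * \<tau>)" "\<sigma>\<^sup>2 = s\<^sup>2" using that s by auto
    note mg = subgaussian_square_mgf[OF nu U \<tau> mgf U2 sg(1)]
    have pr: "exp (\<sigma> * (\<Sum>i<n. (U (X i))\<^sup>2 - 1)) = (\<Prod>i<n. exp (\<sigma> * ((U (X i))\<^sup>2 - 1)))" for X
      by (simp add: exp_sum sum_distrib_left)
    have int: "integrable M (\<lambda>X. exp (\<sigma> * (\<Sum>i<n. (U (X i))\<^sup>2 - 1)))"
      unfolding pr M_def by (rule product_integrable_prod) (use mg in auto)
    have "(\<integral>X. exp (\<sigma> * (\<Sum>i<n. (U (X i))\<^sup>2 - 1)) \<partial>M) = (\<Prod>i<n. \<integral>x. exp (\<sigma> * ((U x)\<^sup>2 - 1)) \<partial>\<nu>)"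
      unfolding pr M_def by (rule product_integral_prod) (use mg in auto)
    also have "\<dots> \<le> (\<Prod>i<n. exp (C * s\<^sup>2))"
      by (intro prod_mono) (use mg sg in \<open>auto simp: C_def\<close>)
    also have "\<dots> = exp (n * C * s\<^sup>2)" by (simp add: exp_of_nat_mult[symmetric] mult.assoc)
    finally have E: "(\<integral>X. exp (\<sigma> * (\<Sum>i<n. (U (X i))\<^sup>2 - 1)) \<partial>M) \<le> exp (n * C * s\<^sup>2)" .
    have "measure M {X \<in> space M. exp (\<sigma> * (\<Sum>i<n. (U (X i))\<^sup>2 - 1)) \<ge> exp (s * n * \<epsilon>)}
      \<le> (\<integral>X. exp (\<sigma> * (\<Sum>i<n. (U (X i))\<^sup>2 - 1)) \<partial>M) / exp (s * n * \<epsilon>)"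
      by (rule integral_Markov_inequality_measure[OF int, of "{}"]) auto
    also have "\<dots> \<le> exp (n * C * s\<^sup>2) / exp (s * n * \<epsilon>)" using E by (intro divide_right_mono) auto
    also have "\<dots> = exp (- real n * \<epsilon>\<^sup>2 / (4 * C))"
      using C by (simp add: exp_diff[symmetric] s_def power2_eq_square field_simps)
    finally show ?thesis .
  qed
  let ?A = "\<lambda>\<sigma>. {X \<in> space M. exp (\<sigma> * (\<Sum>i<n. (U (X i))\<^sup>2 - 1)) \<ge> exp (s * n * \<epsilon>)}"
  have "measure M {X \<in> space M. \<bar>(\<Sum>i<n. (U (X i))\<^sup>2) / n - 1\<bar> > \<epsilon>} \<le> measure M (?A s \<union> ?A (- s))"
  proof (rule M.finite_measure_mono)
    show "{X \<in> space M. \<bar>(\<Sum>i<n. (U (X i))\<^sup>2) / n - 1\<bar> > \<epsilon>} \<subseteq> ?A s \<union> ?A (- s)"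
    proof
      fix X assume "X \<in> {X \<in> space M. \<bar>(\<Sum>i<n. (U (X i))\<^sup>2) / n - 1\<bar> > \<epsilon>}"
      then have XM: "X \<in> space M" and X: "\<bar>(\<Sum>i<n. (U (X i))\<^sup>2) / n - 1\<bar> > \<epsilon>" by auto
      define V where "V = (\<Sum>i<n. (U (X i))\<^sup>2) - n"
      have V: "(\<Sum>i<n. (U (X i))\<^sup>2 - 1) = V" by (simp add: sum_subtractf V_def)
      have "(\<Sum>i<n. (U (X i))\<^sup>2) / n - 1 = V / n" using False by (simp add: V_def field_simps)
      with X have "\<bar>V\<bar> > n * \<epsilon>" using False by (simp add: abs_divide field_simps)
      then have "n * \<epsilon> \<le> V \<or> n * \<epsilon> \<le> - V" by linarith
      then have "s * (n * \<epsilon>) \<le> s * V \<or> s * (n * \<epsilon>) \<le> s * (- V)"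
        using s(1) by (metis mult_left_mono order_less_imp_le)
      then show "X \<in> ?A s \<union> ?A (- s)"
        using XM by (auto simp: V mult.assoc)
    qed
  qed measurable
  also have "\<dots> \<le> measure M (?A s) + measure M (?A (- s))"
    by (rule measure_Un_le) measurable
  also have "\<dots> \<le> 2 * exp (- real n * \<epsilon>\<^sup>2 / (4 * C))" using one[of s] one[of "-s"] by simp
  finally show ?thesis by (simp add: C_def)
qed

text \<open>Translates the row assumptions into the form of the tail bound for one direction
  \<open>u\<close>. The maximum with 1 provides a positive variance proxy, by which the tail bound
  divides.\<close>

lemma subG_row_linear:
  assumes row: "subG_row \<sigma>2 p \<nu>" and u: "(\<Sum>j<p. (u j)\<^sup>2) = 1"
  defines "U \<equiv> (\<lambda>x. \<Sum>j<p. u j * x j)"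
  shows "U \<in> borel_measurable \<nu>"
    "(\<integral>\<^sup>+x. ennreal (exp (t * U x)) \<partial>\<nu>) \<le> ennreal (exp (max 1 \<sigma>2 * t\<^sup>2 / 2))"
    "integrable \<nu> (\<lambda>x. (U x)\<^sup>2)" "(\<integral>x. (U x)\<^sup>2 \<partial>\<nu>) = 1"
proof -
  have sets: "sets \<nu> = sets (PiM {..<p} (\<lambda>_. borel))" using row by (simp add: subG_row_def Rspace_def)
  show "U \<in> borel_measurable \<nu>"
    unfolding U_def measurable_cong_sets[OF sets refl] by measurable
  have int: "integrable \<nu> (\<lambda>x. exp (t * U x))" and ln: "ln (\<integral>x. exp (t * U x) \<partial>\<nu>) \<le> \<sigma>2 * t\<^sup>2 / 2"
    using row u by (auto simp: subG_row_def U_def)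
  have "(\<integral>x. exp (t * U x) \<partial>\<nu>) \<le> exp (max 1 \<sigma>2 * t\<^sup>2 / 2)"
  \<comment> \<open>The bound on \<open>ln\<close> can be exponentiated only for a positive
    integral; otherwise the claim holds since the right-hand side is positive.\<close>
  proof (cases "(\<integral>x. exp (t * U x) \<partial>\<nu>) > 0")
    case True
    then have "(\<integral>x. exp (t * U x) \<partial>\<nu>) = exp (ln (\<integral>x. exp (t * U x) \<partial>\<nu>))" by simp
    also have "\<dots> \<le> exp (max 1 \<sigma>2 * t\<^sup>2 / 2)"
    proof -
      have "\<sigma>2 * t\<^sup>2 / 2 \<le> max 1 \<sigma>2 * t\<^sup>2 / 2" by (intro divide_right_mono mult_right_mono) auto
      then show ?thesis using ln by simp
    qed
    finally show ?thesis .
  qed (auto intro: order_trans[of _ 0])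
  then show "(\<integral>\<^sup>+x. ennreal (exp (t * U x)) \<partial>\<nu>) \<le> ennreal (exp (max 1 \<sigma>2 * t\<^sup>2 / 2))"
    using nn_integral_eq_integral[OF int] by simp
  have sq: "(U x)\<^sup>2 = (\<Sum>j<p. \<Sum>k<p. u j * u k * (x j * x k))" for x
    by (simp add: U_def power2_eq_square sum_product mult_ac)
  have xx: "integrable \<nu> (\<lambda>x. x j * x k)" "(\<integral>x. x j * x k \<partial>\<nu>) = (if j = k then 1 else 0)" if "j < p" "k < p" for j k
    using row that by (auto simp: subG_row_def)
  show "integrable \<nu> (\<lambda>x. (U x)\<^sup>2)"
    unfolding sq by (intro Bochner_Integration.integrable_sum integrable_mult_right xx) auto
  have "(\<integral>x. (U x)\<^sup>2 \<partial>\<nu>) = (\<Sum>j<p. \<integral>x. (\<Sum>k<p. u j * u k * (x j * x k)) \<partial>\<nu>)"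
    unfolding sq by (intro Bochner_Integration.integral_sum Bochner_Integration.integrable_sum integrable_mult_right xx) auto
  also have "\<dots> = (\<Sum>j<p. \<Sum>k<p. \<integral>x. u j * u k * (x j * x k) \<partial>\<nu>)"
    by (intro sum.cong refl Bochner_Integration.integral_sum integrable_mult_right xx) auto
  also have "\<dots> = (\<Sum>j<p. \<Sum>k<p. if j = k then (u j)\<^sup>2 else 0)"
    by (intro sum.cong refl) (use xx in \<open>auto simp: power2_eq_square\<close>)
  also have "\<dots> = 1" using u by simp
  finally show "(\<integral>x. (U x)\<^sup>2 \<partial>\<nu>) = 1" .
qed

text \<open>Polarization: a product x y is half the square of (x + y) / sqrt 2 minus half the square
  of (x - y) / sqrt 2, and both are squares of the row in unit directions. The factor 4 p^2 counts
  the pairs, the two signs and the two tails.\<close>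

lemma subG_design_concentration:
  fixes \<epsilon> :: real
  assumes row: "subG_row \<sigma>2 p \<nu>" and n: "0 < n"
    and eps: "0 < \<epsilon>" "\<epsilon> \<le> bernstein_const (max 1 \<sigma>2) / (4 * max 1 \<sigma>2)"
  defines "M \<equiv> PiM {..<n} (\<lambda>_. \<nu>)"
  shows "measure M {X \<in> space M. \<not> good_design n p \<epsilon> X}
    \<le> 4 * p\<^sup>2 * exp (- real n * \<epsilon>\<^sup>2 / (4 * bernstein_const (max 1 \<sigma>2)))"
proof -
  have nu: "prob_space \<nu>" using row by (simp add: subG_row_def)
  interpret M: prob_space M unfolding M_def by (intro prob_space_PiM nu)
  have sets: "sets \<nu> = sets (PiM {..<p} (\<lambda>_. borel))" using row by (simp add: subG_row_def Rspace_def)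
  have entry: "(\<lambda>X. X i j) \<in> borel_measurable M" if "i < n" "j < p" for i j
  proof -
    have "(\<lambda>x. x j) \<in> borel_measurable \<nu>" unfolding measurable_cong_sets[OF sets refl] using that by simp
    moreover have "(\<lambda>X. X i) \<in> M \<rightarrow>\<^sub>M \<nu>" unfolding M_def using that by simp
    ultimately show ?thesis by (rule measurable_compose[rotated])
  qed
  define e where "e j l = (if l = j then 1 else 0 :: real)" for j l :: nat
  \<comment> \<open>On the diagonal the direction is the coordinate vector itself, whatever
    \<open>b\<close> is.\<close>
  define u where "u j k b l = (if j = k then e j l else (e j l + b * e k l) / sqrt 2)" for j k l :: nat and b :: real
  define B where "B j k b = {X \<in> space M. \<bar>(\<Sum>i<n. (\<Sum>l<p. u j k b l * X i l)\<^sup>2) / n - 1\<bar> > \<epsilon>}" for j k b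
  define r where "r = exp (- real n * \<epsilon>\<^sup>2 / (4 * bernstein_const (max 1 \<sigma>2)))"
  have esum: "(\<Sum>l<p. e j l * f l) = f j" if "j < p" for f :: "nat \<Rightarrow> real" and j
    using that by (simp add: e_def if_distrib if_distribR cong: if_cong)
  have usum: "(\<Sum>l<p. u j k b l * f l) = (if j = k then f j else (f j + b * f k) / sqrt 2)" if "j < p" "k < p" for j k b f
  proof (cases "j = k")
    case False
    have "(\<Sum>l<p. u j k b l * f l) = ((\<Sum>l<p. e j l * f l) + b * (\<Sum>l<p. e k l * f l)) / sqrt 2"
      using False by (simp add: u_def sum_distrib_left sum.distrib[symmetric] sum_divide_distrib algebra_simps)
    then show ?thesis using False esum that by simp
  qed (simp add: u_def esum that)
  have u1: "(\<Sum>l<p. (u j k b l)\<^sup>2) = 1" if "j < p" "k < p" "b = 1 \<or> b = -1" for j k b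
  proof -
    have b: "b * b = 1" using that by auto
    have "(\<Sum>l<p. (u j k b l)\<^sup>2) = (\<Sum>l<p. u j k b l * u j k b l)" by (simp add: power2_eq_square)
    also have "\<dots> = 1"
      unfolding usum[OF that(1,2)] using b by (auto simp: u_def e_def field_simps)
    finally show ?thesis .
  qed
  have B: "measure M (B j k b) \<le> 2 * r" if "j < p" "k < p" "b = 1 \<or> b = -1" for j k b
    unfolding B_def r_def M_def
    by (rule subgaussian_square_sum_tail[OF nu subG_row_linear(1)[OF row u1[OF that]] _
          subG_row_linear(2)[OF row u1[OF that]] subG_row_linear(3,4)[OF row u1[OF that]] eps]) simp
  have Bm[measurable]: "B j k b \<in> sets M" for j k b
    unfolding B_def using entry by measurable
  have incl: "{X \<in> space M. \<not> good_design n p \<epsilon> X} \<subseteq> (\<Union>(j,k)\<in>{..<p}\<times>{..<p}. B j k 1 \<union> B j k (-1))"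
  proof
    fix X assume "X \<in> {X \<in> space M. \<not> good_design n p \<epsilon> X}"
    then obtain j k where X: "X \<in> space M" and jk: "j < p" "k < p"
      and bad: "\<bar>(\<Sum>i<n. X i j * X i k) / n - (if j = k then 1 else 0)\<bar> > \<epsilon>"
      by (auto simp: good_design_def not_le)
    have "X \<in> B j k 1 \<union> B j k (-1)"
    proof (cases "j = k")
      case True
      then show ?thesis using X bad jk by (simp add: B_def usum power2_eq_square)
    next
      case False
      define P where "P b = (\<Sum>i<n. (\<Sum>l<p. u j k b l * X i l)\<^sup>2) / n - 1" for b
      have P: "P b = (\<Sum>i<n. ((X i j + b * X i k) / sqrt 2)\<^sup>2) / n - 1" for b
        unfolding P_def usum[OF jk] using False by simp
      have "(\<Sum>i<n. X i j * X i k) = (\<Sum>i<n. ((X i j + 1 * X i k) / sqrt 2)\<^sup>2 / 2 - ((X i j + (-1) * X i k) / sqrt 2)\<^sup>2 / 2)"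
        by (intro sum.cong) (auto simp: power_divide power2_eq_square field_simps)
      also have "\<dots> / n = P 1 / 2 - P (-1) / 2"
        unfolding P by (simp only: sum_subtractf sum_divide_distrib[symmetric] diff_divide_distrib) simp
      finally have "\<bar>P 1 / 2 - P (-1) / 2\<bar> > \<epsilon>" using bad False by simp
      then have "\<bar>P 1\<bar> > \<epsilon> \<or> \<bar>P (-1)\<bar> > \<epsilon>" by linarith
      then show ?thesis using X by (auto simp: B_def P_def)
    qed
    then show "X \<in> (\<Union>(j,k)\<in>{..<p}\<times>{..<p}. B j k 1 \<union> B j k (-1))" using jk by blast
  qed
  have "measure M {X \<in> space M. \<not> good_design n p \<epsilon> X} \<le> measure M (\<Union>(j,k)\<in>{..<p}\<times>{..<p}. B j k 1 \<union> B j k (-1))"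
    by (rule M.finite_measure_mono[OF incl]) auto
  also have "\<dots> \<le> (\<Sum>(j,k)\<in>{..<p}\<times>{..<p}. measure M (B j k 1 \<union> B j k (-1)))"
    by (rule order_trans[OF measure_UNION_le]) (auto simp: case_prod_beta')
  also have "\<dots> \<le> (\<Sum>(j,k)\<in>{..<p}\<times>{..<p}. 4 * r)"
  proof (rule sum_mono)
    fix c assume "c \<in> {..<p} \<times> {..<p}"
    then obtain j k where c: "c = (j, k)" "j < p" "k < p" by auto
    then show "(case c of (j, k) \<Rightarrow> measure M (B j k 1 \<union> B j k (-1))) \<le> (case c of (j, k) \<Rightarrow> 4 * r)"
      using B[of j k 1] B[of j k "-1"] measure_Un_le[OF Bm Bm, of j k 1 j k "-1"] by simp
  qed
  also have "\<dots> = 4 * p\<^sup>2 * r" by (simp add: power2_eq_square case_prod_beta')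
  finally show ?thesis by (simp add: r_def)
qed

section \<open>Comparison with the sequence model\<close>

lemma gauss_restrict:
  assumes "finite I" "J \<subseteq> I"
  shows "distr (gauss I) (gauss J) (\<lambda>g. restrict g J) = gauss J"
proof -
  interpret product_prob_space "\<lambda>_. std_gauss" I
    by (simp add: product_prob_space_def product_prob_space_axioms_def product_sigma_finite_def
        prob_space_std_gauss prob_space_imp_sigma_finite)
  show ?thesis by (rule distr_PiM_restrict_finite) (use assms finite_subset in auto)
qed

lemma nn_integral_gauss_restrict:
  assumes I: "finite I" "J \<subseteq> I" and f: "f \<in> borel_measurable (gauss J)"
  shows "(\<integral>\<^sup>+g. f (restrict g J) \<partial>gauss I) = (\<integral>\<^sup>+g. f g \<partial>gauss J)"
proof -
  have "(\<integral>\<^sup>+g. f g \<partial>gauss J) = (\<integral>\<^sup>+g. f g \<partial>distr (gauss I) (gauss J) (\<lambda>g. restrict g J))"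
    by (simp only: gauss_restrict[OF I])
  also have "\<dots> = (\<integral>\<^sup>+g. f (restrict g J) \<partial>gauss I)"
    by (rule nn_integral_distr) (use f I in \<open>auto intro!: measurable_restrict_subset\<close>)
  finally show ?thesis by simp
qed

text \<open>For a fixed design and \<open>v\<close> the mean vector of y, this is the conditional
  rejection probability of the test section \<open>\<phi>\<close>.\<close>

definition gauss_mean :: "nat \<Rightarrow> ((nat \<Rightarrow> real) \<Rightarrow> real) \<Rightarrow> (nat \<Rightarrow> real) \<Rightarrow> real" where
  "gauss_mean n \<phi> v = (\<integral>e. \<phi> (\<lambda>i\<in>{..<n}. v i + e i) \<partial>gauss {..<n})"

lemma shift_measurable:
  "(\<lambda>e. \<lambda>i\<in>I. v i + e i) \<in> gauss I \<rightarrow>\<^sub>M gauss I"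
  by (rule measurable_restrict) simp

lemma nn_integral_gauss_mean:
  assumes m: "\<phi> \<in> borel_measurable (gauss {..<n})"
    and b: "\<And>y. y \<in> space (gauss {..<n}) \<Longrightarrow> 0 \<le> \<phi> y \<and> \<phi> y \<le> 1"
  shows "(\<integral>\<^sup>+e. ennreal (\<phi> (\<lambda>i\<in>{..<n}. v i + e i)) \<partial>gauss {..<n}) = ennreal (gauss_mean n \<phi> v)"
    "integrable (gauss {..<n}) (\<lambda>e. \<phi> (\<lambda>i\<in>{..<n}. v i + e i))"
    "0 \<le> gauss_mean n \<phi> v" "gauss_mean n \<phi> v \<le> 1"
proof -
  interpret prob_space "gauss {..<n}" by (rule prob_space_gauss)
  have sp: "(\<lambda>i\<in>{..<n}. v i + e i) \<in> space (gauss {..<n})" for e by (simp add: space_PiM)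
  show i: "integrable (gauss {..<n}) (\<lambda>e. \<phi> (\<lambda>i\<in>{..<n}. v i + e i))"
    by (rule integrable_const_bound[where B=1]) (use b[OF sp] measurable_compose[OF shift_measurable m] in auto)
  show "(\<integral>\<^sup>+e. ennreal (\<phi> (\<lambda>i\<in>{..<n}. v i + e i)) \<partial>gauss {..<n}) = ennreal (gauss_mean n \<phi> v)"
    unfolding gauss_mean_def by (rule nn_integral_eq_integral[OF i]) (use b[OF sp] in auto)
  show "0 \<le> gauss_mean n \<phi> v" unfolding gauss_mean_def
    by (intro Bochner_Integration.integral_nonneg) (use b[OF sp] in auto)
  have "gauss_mean n \<phi> v \<le> (\<integral>e. 1 \<partial>gauss {..<n})" unfolding gauss_mean_def
    by (intro integral_mono i) (use b[OF sp] in auto)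
  then show "gauss_mean n \<phi> v \<le> 1" by (simp add: prob_space)
qed

text \<open>Adding rows to a design only adds information, so a design that can be completed to one with
  Gram matrix \<open>\<kappa> I\<close> is no more informative than the sequence model with signal \<open>sqrt \<kappa> \<beta>\<close>.\<close>

lemma augmented_bayes_bound:
  fixes X X' :: "nat \<Rightarrow> nat \<Rightarrow> real" and \<beta> :: "'f \<Rightarrow> nat \<Rightarrow> real" and \<kappa> :: real
  assumes I: "finite I" "{..<n} \<subseteq> I" and lam: "\<kappa> > 0"
    and X': "\<And>i j. i < n \<Longrightarrow> X' i j = X i j"
    and gram: "\<And>j k. j < p \<Longrightarrow> k < p \<Longrightarrow> (\<Sum>i\<in>I. X' i j * X' i k) = (if j = k then \<kappa> else 0)"
    and \<phi>: "\<phi> \<in> borel_measurable (gauss {..<n})"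
    and b: "\<And>y. y \<in> space (gauss {..<n}) \<Longrightarrow> 0 \<le> \<phi> y \<and> \<phi> y \<le> 1"
    and F: "finite F" "F \<noteq> {}"
  shows "(\<integral>z. min 1 ((\<Sum>f\<in>F. exp ((\<Sum>j<p. sqrt \<kappa> * \<beta> f j * z j) - \<kappa> * (\<Sum>j<p. (\<beta> f j)\<^sup>2) / 2)) / card F) \<partial>gauss {..<p})
    \<le> gauss_mean n \<phi> (\<lambda>_. 0) + (\<Sum>f\<in>F. 1 - gauss_mean n \<phi> (matvec X p (\<beta> f))) / card F"
proof -
  define c where "c = 1 / real (card F)"
  have c: "c > 0" using F by (simp add: c_def card_gt_0_iff)
  define u where "u j i = X' i j / sqrt \<kappa>" for j i
  define Z where "Z g = (\<lambda>j\<in>{..<p}. \<Sum>i\<in>I. u j i * g i)" for g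
  define E where "E f z = exp ((\<Sum>j<p. sqrt \<kappa> * \<beta> f j * z j) - \<kappa> * (\<Sum>j<p. (\<beta> f j)\<^sup>2) / 2)" for f z
  define L where "L z = (\<Sum>f\<in>F. E f z) * c" for z
  have L0: "L z \<ge> 0" for z using c by (auto simp: L_def E_def intro!: mult_nonneg_nonneg sum_nonneg)
  have Em[measurable]: "E f \<in> borel_measurable (gauss {..<p})" for f unfolding E_def by measurable
  have Lm[measurable]: "L \<in> borel_measurable (gauss {..<p})" unfolding L_def by measurable
  have Zm[measurable]: "Z \<in> gauss I \<rightarrow>\<^sub>M gauss {..<p}"
    unfolding Z_def by (rule measurable_restrict) measurable
  define \<psi> where "\<psi> g = \<phi> (restrict g {..<n})" for g
  have rm: "(\<lambda>g. restrict g {..<n}) \<in> gauss I \<rightarrow>\<^sub>M gauss {..<n}" using I(2) by (rule measurable_restrict_subset)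
  have psi[measurable]: "\<psi> \<in> borel_measurable (gauss I)"
    unfolding \<psi>_def by (rule measurable_compose[OF rm \<phi>])
  have psib: "0 \<le> \<psi> g" "\<psi> g \<le> 1" for g
    using b[of "restrict g {..<n}"] by (auto simp: \<psi>_def space_PiM)
  define v where "v f i = (\<Sum>j<p. X' i j * \<beta> f j)" for f i
  \<comment> \<open>By the Gram identity the log likelihood ratio depends on the enlarged noise only
    through the p coordinates \<open>Z g\<close>.\<close>
  have quad: "(\<Sum>i\<in>I. v f i * g i - (v f i)\<^sup>2 / 2)
      = (\<Sum>j<p. sqrt \<kappa> * \<beta> f j * Z g j) - \<kappa> * (\<Sum>j<p. (\<beta> f j)\<^sup>2) / 2" for f g
  proof -
    have "(\<Sum>i\<in>I. v f i * g i) = (\<Sum>i\<in>I. \<Sum>j<p. \<beta> f j * (X' i j * g i))"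
      by (simp add: v_def sum_distrib_left sum_distrib_right mult_ac)
    also have "\<dots> = (\<Sum>j<p. \<beta> f j * (\<Sum>i\<in>I. X' i j * g i))"
      by (subst sum.swap) (simp add: sum_distrib_left)
    also have "\<dots> = (\<Sum>j<p. sqrt \<kappa> * \<beta> f j * Z g j)"
    proof (rule sum.cong)
      fix j assume "j \<in> {..<p}"
      then have "sqrt \<kappa> * Z g j = (\<Sum>i\<in>I. X' i j * g i)"
        using lam by (simp add: Z_def u_def sum_distrib_left)
      then show "\<beta> f j * (\<Sum>i\<in>I. X' i j * g i) = sqrt \<kappa> * \<beta> f j * Z g j" by (simp add: mult_ac)
    qed simp
    finally have 1: "(\<Sum>i\<in>I. v f i * g i) = (\<Sum>j<p. sqrt \<kappa> * \<beta> f j * Z g j)" .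
    have "(\<Sum>i\<in>I. (v f i)\<^sup>2) = (\<Sum>i\<in>I. \<Sum>j<p. \<Sum>k<p. \<beta> f j * \<beta> f k * (X' i j * X' i k))"
      by (simp add: v_def power2_eq_square sum_product mult_ac)
    also have "\<dots> = (\<Sum>j<p. \<Sum>i\<in>I. \<Sum>k<p. \<beta> f j * \<beta> f k * (X' i j * X' i k))"
      by (rule sum.swap)
    also have "\<dots> = (\<Sum>j<p. \<Sum>k<p. \<beta> f j * \<beta> f k * (\<Sum>i\<in>I. X' i j * X' i k))"
    proof (rule sum.cong)
      fix j
      have "(\<Sum>i\<in>I. \<Sum>k<p. \<beta> f j * \<beta> f k * (X' i j * X' i k)) = (\<Sum>k<p. \<Sum>i\<in>I. \<beta> f j * \<beta> f k * (X' i j * X' i k))"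
        by (rule sum.swap)
      then show "(\<Sum>i\<in>I. \<Sum>k<p. \<beta> f j * \<beta> f k * (X' i j * X' i k)) = (\<Sum>k<p. \<beta> f j * \<beta> f k * (\<Sum>i\<in>I. X' i j * X' i k))"
        by (simp add: sum_distrib_left)
    qed simp
    also have "\<dots> = (\<Sum>j<p. \<Sum>k<p. if j = k then \<kappa> * (\<beta> f j)\<^sup>2 else 0)"
      by (intro sum.cong refl) (auto simp: gram power2_eq_square)
    also have "\<dots> = \<kappa> * (\<Sum>j<p. (\<beta> f j)\<^sup>2)" by (simp add: sum_distrib_left)
    finally have 2: "(\<Sum>i\<in>I. (v f i)\<^sup>2) = \<kappa> * (\<Sum>j<p. (\<beta> f j)\<^sup>2)" .
    show ?thesis by (simp add: sum_subtractf sum_divide_distrib[symmetric] 1 2)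
  qed
  have null: "(\<integral>\<^sup>+g. ennreal (\<psi> g) \<partial>gauss I) = ennreal (gauss_mean n \<phi> (\<lambda>_. 0))"
  proof -
    have "(\<integral>\<^sup>+g. ennreal (\<psi> g) \<partial>gauss I) = (\<integral>\<^sup>+e. ennreal (\<phi> e) \<partial>gauss {..<n})"
      unfolding \<psi>_def by (rule nn_integral_gauss_restrict[OF I, of "\<lambda>y. ennreal (\<phi> y)"]) (use \<phi> in measurable)
    also have "\<dots> = (\<integral>\<^sup>+e. ennreal (\<phi> (\<lambda>i\<in>{..<n}. 0 + e i)) \<partial>gauss {..<n})"
      by (intro nn_integral_cong arg_cong[where f="\<lambda>x. ennreal (\<phi> x)"])
         (auto simp: space_PiM PiE_def extensional_def fun_eq_iff)
    finally show ?thesis by (simp only: nn_integral_gauss_mean(1)[OF \<phi> b, of "\<lambda>_. 0"])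
  qed
  \<comment> \<open>The weight \<open>E f (Z g)\<close> is the density of the shift by
    \<open>v f\<close>. Undoing the shift turns the first n coordinates into an observation under
    \<open>\<beta> f\<close>, and \<open>\<psi>\<close> looks at no other coordinate.\<close>
  have alt: "(\<integral>\<^sup>+g. ennreal (1 - \<psi> g) * ennreal (E f (Z g)) \<partial>gauss I) = ennreal (1 - gauss_mean n \<phi> (matvec X p (\<beta> f)))"
    if "f \<in> F" for f
  proof -
    have m1: "(\<lambda>y. 1 - \<phi> y) \<in> borel_measurable (gauss {..<n})" using \<phi> by measurable
    have b1: "0 \<le> 1 - \<phi> y \<and> 1 - \<phi> y \<le> 1" if "y \<in> space (gauss {..<n})" for y using b[OF that] by auto
    have vm: "(\<lambda>i\<in>{..<n}. g i + v f i) = (\<lambda>i\<in>{..<n}. matvec X p (\<beta> f) i + g i)" for g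
      by (auto simp: v_def matvec_def X' fun_eq_iff)
    have "(\<integral>\<^sup>+g. ennreal (1 - \<psi> g) * ennreal (E f (Z g)) \<partial>gauss I)
        = (\<integral>\<^sup>+g. ennreal (1 - \<psi> (\<lambda>i\<in>I. g i + v f i)) \<partial>gauss I)"
      by (subst nn_integral_gauss_shift[OF I(1)]) (auto simp: quad E_def)
    also have "\<dots> = (\<integral>\<^sup>+g. ennreal (1 - \<phi> (\<lambda>i\<in>{..<n}. matvec X p (\<beta> f) i + (restrict g {..<n}) i)) \<partial>gauss I)"
    proof (intro nn_integral_cong arg_cong[where f="\<lambda>x. ennreal (1 - x)"])
      fix g
      have "restrict (\<lambda>i\<in>I. g i + v f i) {..<n} = (\<lambda>i\<in>{..<n}. g i + v f i)"
        using I(2) by (auto simp: fun_eq_iff)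
      then show "\<psi> (\<lambda>i\<in>I. g i + v f i) = \<phi> (\<lambda>i\<in>{..<n}. matvec X p (\<beta> f) i + (restrict g {..<n}) i)"
        unfolding \<psi>_def vm by (simp cong: restrict_cong)
    qed
    also have "\<dots> = (\<integral>\<^sup>+e. ennreal (1 - \<phi> (\<lambda>i\<in>{..<n}. matvec X p (\<beta> f) i + e i)) \<partial>gauss {..<n})"
      by (rule nn_integral_gauss_restrict[OF I, of "\<lambda>e. ennreal (1 - \<phi> (\<lambda>i\<in>{..<n}. matvec X p (\<beta> f) i + e i))"])
         (use measurable_compose[OF shift_measurable m1] in measurable)
    also have "\<dots> = ennreal (gauss_mean n (\<lambda>y. 1 - \<phi> y) (matvec X p (\<beta> f)))"
      by (rule nn_integral_gauss_mean(1)[OF m1 b1])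
    also have "gauss_mean n (\<lambda>y. 1 - \<phi> y) (matvec X p (\<beta> f)) = 1 - gauss_mean n \<phi> (matvec X p (\<beta> f))"
    proof -
      interpret pn: prob_space "gauss {..<n}" by (rule prob_space_gauss)
      show ?thesis
        unfolding gauss_mean_def
        using nn_integral_gauss_mean(2)[OF \<phi> b, of "matvec X p (\<beta> f)"] by (simp add: pn.prob_space)
    qed
    finally show ?thesis .
  qed
  have "ennreal (\<integral>z. min 1 (L z) \<partial>gauss {..<p}) = (\<integral>\<^sup>+z. ennreal (min 1 (L z)) \<partial>gauss {..<p})"
  proof (rule nn_integral_eq_integral[symmetric])
    interpret prob_space "gauss {..<p}" by (rule prob_space_gauss)
    show "integrable (gauss {..<p}) (\<lambda>z. min 1 (L z))"
      by (rule integrable_const_bound[where B=1]) (use L0 in \<open>auto simp: min_def\<close>)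
  qed (use L0 in auto)
  also have "\<dots> = (\<integral>\<^sup>+g. ennreal (min 1 (L (Z g))) \<partial>gauss I)"
    unfolding Z_def
    by (rule gauss_orthonormal[OF I(1), symmetric])
       (use lam in \<open>auto simp: u_def gram sum_divide_distrib[symmetric] real_sqrt_mult_self\<close>)
  also have "\<dots> \<le> (\<integral>\<^sup>+g. ennreal (\<psi> g) + ennreal c * (\<Sum>f\<in>F. ennreal (1 - \<psi> g) * ennreal (E f (Z g))) \<partial>gauss I)"
  proof (rule nn_integral_mono)
    fix g
    have E0: "0 \<le> E f z" for f z by (simp add: E_def)
    \<comment> \<open>Pointwise Neyman-Pearson inequality: \<open>min 1 L\<close> is a convex
      combination of itself, bounded by 1 where the weight is \<open>\<psi>\<close> and by
      \<open>L\<close> elsewhere.\<close>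
    have "min 1 (L (Z g)) = \<psi> g * min 1 (L (Z g)) + (1 - \<psi> g) * min 1 (L (Z g))" by (simp add: algebra_simps)
    also have "\<dots> \<le> \<psi> g * 1 + (1 - \<psi> g) * L (Z g)"
      using psib[of g] by (intro add_mono mult_left_mono) auto
    also have "\<dots> = \<psi> g + c * (\<Sum>f\<in>F. (1 - \<psi> g) * E f (Z g))"
      by (simp add: L_def sum_distrib_left mult_ac)
    finally have "ennreal (min 1 (L (Z g))) \<le> ennreal (\<psi> g + c * (\<Sum>f\<in>F. (1 - \<psi> g) * E f (Z g)))"
      by (rule ennreal_leI)
    also have "\<dots> = ennreal (\<psi> g) + ennreal c * (\<Sum>f\<in>F. ennreal (1 - \<psi> g) * ennreal (E f (Z g)))"
      using psib[of g] c E0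
      by (subst ennreal_plus) (auto simp: ennreal_mult sum_nonneg sum_ennreal[symmetric] intro!: mult_nonneg_nonneg)
    finally show "ennreal (min 1 (L (Z g))) \<le> ennreal (\<psi> g) + ennreal c * (\<Sum>f\<in>F. ennreal (1 - \<psi> g) * ennreal (E f (Z g)))" .
  qed
  also have "\<dots> = (\<integral>\<^sup>+g. ennreal (\<psi> g) \<partial>gauss I) + ennreal c * (\<Sum>f\<in>F. (\<integral>\<^sup>+g. ennreal (1 - \<psi> g) * ennreal (E f (Z g)) \<partial>gauss I))"
    by (subst nn_integral_add, measurable, subst nn_integral_cmult, measurable, subst nn_integral_sum, measurable)
  also have "\<dots> = ennreal (gauss_mean n \<phi> (\<lambda>_. 0)) + ennreal c * (\<Sum>f\<in>F. ennreal (1 - gauss_mean n \<phi> (matvec X p (\<beta> f))))"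
    by (simp add: null alt)
  also have "\<dots> = ennreal (gauss_mean n \<phi> (\<lambda>_. 0) + c * (\<Sum>f\<in>F. 1 - gauss_mean n \<phi> (matvec X p (\<beta> f))))"
    using nn_integral_gauss_mean(3,4)[OF \<phi> b] c
    by (subst ennreal_plus) (auto simp: ennreal_mult sum_nonneg sum_ennreal intro!: mult_nonneg_nonneg)
  finally have "(\<integral>z. min 1 (L z) \<partial>gauss {..<p}) \<le> gauss_mean n \<phi> (\<lambda>_. 0) + c * (\<Sum>f\<in>F. 1 - gauss_mean n \<phi> (matvec X p (\<beta> f)))"
    by (rule ennreal_le_iff[THEN iffD1, rotated])
       (use nn_integral_gauss_mean(3,4)[OF \<phi> b] c in \<open>auto intro!: add_nonneg_nonneg mult_nonneg_nonneg sum_nonneg\<close>)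
  then show ?thesis by (simp add: L_def E_def c_def)
qed


section \<open>Auxiliary rows that complete a Gram matrix\<close>

definition gram_deficit :: "nat \<Rightarrow> real \<Rightarrow> (nat \<Rightarrow> nat \<Rightarrow> real) \<Rightarrow> nat \<Rightarrow> nat \<Rightarrow> real" where
  "gram_deficit n \<kappa> X j k = (if j = k then \<kappa> else 0) - (\<Sum>i<n. X i j * X i k)"

text \<open>The extra rows come indexed by pairs, while Gaussian vectors are indexed by naturals;
  shifting the pairing function by \<open>n\<close> keeps the extra indices clear of the original
  rows.\<close>

definition pair_code :: "nat \<Rightarrow> nat \<times> nat \<Rightarrow> nat" where
  "pair_code n c = n + prod_encode c"

definition pair_decode :: "nat \<Rightarrow> nat \<Rightarrow> nat \<times> nat" where
  "pair_decode n i = prod_decode (i - n)"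

definition aux_index :: "nat \<Rightarrow> nat \<Rightarrow> nat set" where
  "aux_index n p = pair_code n ` ({..<p} \<times> {..<p})"

lemma finite_aux_index [simp]: "finite (aux_index n p)"
  by (simp add: aux_index_def)

lemma aux_index_disjoint: "{..<n} \<inter> aux_index n p = {}"
  by (auto simp: aux_index_def pair_code_def)

lemma pair_decode_code [simp]: "pair_decode n (pair_code n c) = c"
  by (simp add: pair_decode_def pair_code_def)

lemma sum_aux_index: "(\<Sum>i\<in>aux_index n p. f (pair_decode n i)) = (\<Sum>c\<in>{..<p} \<times> {..<p}. f c)"
proof -
  have "inj_on (pair_code n) ({..<p} \<times> {..<p})" by (rule inj_on_inverseI[of _ "pair_decode n"]) simp
  then show ?thesis unfolding aux_index_def by (subst sum.reindex) auto
qed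

text \<open>The tolerance \<open>\<eta> / p\<close> is just enough: a diagonal entry of the deficit
  is at least n \<eta> - n \<eta> / p, and the p - 1 other entries of its row add up to at most the
  same number.\<close>

lemma good_design_augment:
  fixes \<eta> :: real
  assumes good: "good_design n p (\<eta> / p) X" and n: "0 < n" and eta: "0 \<le> \<eta>"
  defines "X' \<equiv> \<lambda>i j. if i < n then X i j else dd_factor p (gram_deficit n (n * (1 + \<eta>)) X) j (pair_decode n i)"
  assumes jk: "j < p" "k < p"
  shows "(\<Sum>i\<in>{..<n} \<union> aux_index n p. X' i j * X' i k) = (if j = k then n * (1 + \<eta>) else 0)"
proof -
  define D where "D = gram_deficit n (n * (1 + \<eta>)) X"
  have near: "\<bar>(\<Sum>i<n. X i a * X i b) / n - (if a = b then 1 else 0)\<bar> \<le> \<eta> / p" if "a < p" "b < p" for a b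
    using good that by (auto simp: good_design_def)
  have off: "\<bar>D a b\<bar> \<le> n * (\<eta> / p)" if "a < p" "b < p" "a \<noteq> b" for a b
    using near[OF that(1,2)] that n by (simp add: D_def gram_deficit_def abs_divide field_simps)
  have diag: "n * \<eta> - n * (\<eta> / p) \<le> D a a" if "a < p" for a
  proof -
    have "(\<Sum>i<n. X i a * X i a) / n \<le> 1 + \<eta> / p" using near[OF that that] by (simp add: abs_le_iff)
    then have "(\<Sum>i<n. X i a * X i a) \<le> n * (1 + \<eta> / p)" using n by (simp add: field_simps)
    then show ?thesis by (simp add: D_def gram_deficit_def algebra_simps)
  qed
  have dom: "(\<Sum>l\<in>{..<p} - {a}. \<bar>D a l\<bar>) \<le> D a a" if "a < p" for a
  proof -
    have "(\<Sum>l\<in>{..<p} - {a}. \<bar>D a l\<bar>) \<le> (\<Sum>l\<in>{..<p} - {a}. n * (\<eta> / p))"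
      by (rule sum_mono) (use off that in auto)
    also have "\<dots> = (real p - 1) * (n * (\<eta> / p))" using that by (simp add: of_nat_diff)
    also have "\<dots> = n * \<eta> - n * (\<eta> / p)" using that by (simp add: field_simps)
    also have "\<dots> \<le> D a a" by (rule diag[OF that])
    finally show ?thesis .
  qed
  have sym: "D a b = D b a" for a b by (auto simp: D_def gram_deficit_def mult.commute)
  have "(\<Sum>i\<in>aux_index n p. X' i j * X' i k) = (\<Sum>i\<in>aux_index n p. (\<lambda>c. dd_factor p D j c * dd_factor p D k c) (pair_decode n i))"
    by (rule sum.cong) (auto simp: X'_def D_def aux_index_def pair_code_def)
  also have "\<dots> = D j k"
    using sum_aux_index[of "\<lambda>c. dd_factor p D j c * dd_factor p D k c" n p] dd_factor_product[OF sym dom jk]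
    by simp
  finally have 1: "(\<Sum>i\<in>aux_index n p. X' i j * X' i k) = D j k" .
  have 2: "(\<Sum>i<n. X' i j * X' i k) = (\<Sum>i<n. X i j * X i k)" by (rule sum.cong) (auto simp: X'_def)
  show ?thesis
    by (subst sum.union_disjoint) (auto simp: aux_index_disjoint 1 2 D_def gram_deficit_def)
qed

section \<open>The block prior as a family of parameters\<close>

definition block_spikes :: "nat \<Rightarrow> nat \<Rightarrow> real \<Rightarrow> (nat \<Rightarrow> nat) \<Rightarrow> nat \<Rightarrow> real" where
  "block_spikes s m A f j = (if j \<in> (\<lambda>k. k * m + f k) ` {..<s} then A else 0)"

lemma block_spikes_inj:
  fixes f :: "nat \<Rightarrow> nat"
  assumes "f \<in> PiE {..<s} (\<lambda>_. {..<m})"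
  shows "inj_on (\<lambda>k. k * m + f k) {..<s}"
proof (rule inj_on_inverseI[of _ "\<lambda>j. j div m"])
  fix k assume "k \<in> {..<s}"
  then have "f k < m" using assms by auto
  then show "(k * m + f k) div m = k" by simp
qed

lemma block_spikes_sum:
  assumes f: "f \<in> PiE {..<s} (\<lambda>_. {..<m})" and sm: "s * m \<le> p"
  shows "(\<Sum>j<p. block_spikes s m A f j * w j) = (\<Sum>k<s. A * w (k * m + f k))"
proof -
  have sub: "(\<lambda>k. k * m + f k) ` {..<s} \<subseteq> {..<p}"
    using block_index_less[OF _ _ sm] f by auto
  have "(\<Sum>j<p. block_spikes s m A f j * w j) = (\<Sum>j\<in>(\<lambda>k. k * m + f k) ` {..<s}. A * w j)"
    by (rule sum.mono_neutral_cong_right) (use sub in \<open>auto simp: block_spikes_def\<close>)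
  then show ?thesis by (simp add: sum.reindex[OF block_spikes_inj[OF f]])
qed

lemma block_spikes_in_Xi:
  assumes f: "f \<in> PiE {..<s} (\<lambda>_. {..<m})" and sm: "s * m \<le> p" and A: "A > 0"
  shows "block_spikes s m A f \<in> Xi p s A"
proof -
  have sub: "(\<lambda>k. k * m + f k) ` {..<s} \<subseteq> {..<p}"
    using block_index_less[OF _ _ sm] f by auto
  have "{j \<in> {..<p}. block_spikes s m A f j \<noteq> 0} = (\<lambda>k. k * m + f k) ` {..<s}"
    using sub A by (auto simp: block_spikes_def)
  then have "card {j \<in> {..<p}. block_spikes s m A f j \<noteq> 0} = s"
    using card_image[OF block_spikes_inj[OF f]] by simp
  moreover have "block_spikes s m A f j = 0" if "p \<le> j" for j
    using sub that unfolding block_spikes_def by (meson lessThan_iff not_le subsetD)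
  ultimately show ?thesis using A by (auto simp: Xi_def block_spikes_def)
qed

text \<open>Averaging over all choice functions a product with one factor per block gives the
  product of the block averages, so the mixture likelihood ratio is \<open>block_lr\<close>; the
  signal per spike is \<open>sqrt (n * (1 + \<eta>)) * A\<close> after completion of the
  design.\<close>

lemma good_design_bayes_bound:
  fixes \<eta> A :: real
  assumes good: "good_design n p (\<eta> / p) X" and n: "0 < n" and eta: "0 \<le> \<eta>"
    and sm: "s * m \<le> p" "0 < m"
    and \<phi>: "\<phi> \<in> borel_measurable (gauss {..<n})"
    and b: "\<And>y. y \<in> space (gauss {..<n}) \<Longrightarrow> 0 \<le> \<phi> y \<and> \<phi> y \<le> 1"
  defines "F \<equiv> PiE {..<s} (\<lambda>_. {..<m})"
  shows "(\<integral>z. min 1 (block_lr s m (sqrt (n * (1 + \<eta>)) * A) z) \<partial>gauss {..<p})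
    \<le> gauss_mean n \<phi> (\<lambda>_. 0) + (\<Sum>f\<in>F. 1 - gauss_mean n \<phi> (matvec X p (block_spikes s m A f))) / card F"
proof -
  define \<kappa> where "\<kappa> = n * (1 + \<eta>)"
  have kappa: "\<kappa> > 0" using n eta by (simp add: \<kappa>_def)
  define X' where "X' = (\<lambda>i j. if i < n then X i j else dd_factor p (gram_deficit n \<kappa> X) j (pair_decode n i))"
  have F: "finite F" "F \<noteq> {}" "card F = m ^ s"
    using sm by (auto simp: F_def finite_PiE PiE_eq_empty_iff card_PiE)
  have L: "(\<Sum>f\<in>F. exp ((\<Sum>j<p. sqrt \<kappa> * block_spikes s m A f j * z j) - \<kappa> * (\<Sum>j<p. (block_spikes s m A f j)\<^sup>2) / 2)) / card F
      = block_lr s m (sqrt \<kappa> * A) z" for z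
  proof -
    have e: "exp ((\<Sum>j<p. sqrt \<kappa> * block_spikes s m A f j * z j) - \<kappa> * (\<Sum>j<p. (block_spikes s m A f j)\<^sup>2) / 2)
       = (\<Prod>k<s. exp (sqrt \<kappa> * A * z (k * m + f k) - (sqrt \<kappa> * A)\<^sup>2 / 2))" if f: "f \<in> F" for f
    proof -
      have f': "f \<in> PiE {..<s} (\<lambda>_. {..<m})" using f by (simp add: F_def)
      have "(\<Sum>j<p. sqrt \<kappa> * block_spikes s m A f j * z j) = (\<Sum>k<s. A * (sqrt \<kappa> * z (k * m + f k)))"
        using block_spikes_sum[OF f' sm(1), of A "\<lambda>j. sqrt \<kappa> * z j"] by (simp add: mult_ac)
      moreover have "(\<Sum>j<p. (block_spikes s m A f j)\<^sup>2) = (\<Sum>k<s. A * block_spikes s m A f (k * m + f k))"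
        using block_spikes_sum[OF f' sm(1), of A "block_spikes s m A f"] by (simp add: power2_eq_square)
      moreover have "(\<Sum>k<s. A * block_spikes s m A f (k * m + f k)) = (\<Sum>k<s. A\<^sup>2)"
        by (intro sum.cong refl) (simp add: block_spikes_def power2_eq_square)
      ultimately have "(\<Sum>j<p. sqrt \<kappa> * block_spikes s m A f j * z j) - \<kappa> * (\<Sum>j<p. (block_spikes s m A f j)\<^sup>2) / 2
         = (\<Sum>k<s. A * (sqrt \<kappa> * z (k * m + f k))) - s * (\<kappa> * A\<^sup>2 / 2)" by simp
      also have "\<dots> = (\<Sum>k<s. A * (sqrt \<kappa> * z (k * m + f k)) - \<kappa> * A\<^sup>2 / 2)" by (simp add: sum_subtractf)
      also have "\<dots> = (\<Sum>k<s. sqrt \<kappa> * A * z (k * m + f k) - (sqrt \<kappa> * A)\<^sup>2 / 2)"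
        using kappa by (intro sum.cong refl) (simp add: power_mult_distrib)
      finally show ?thesis by (simp add: exp_sum)
    qed
    have "block_lr s m (sqrt \<kappa> * A) z = (\<Prod>k<s. \<Sum>l<m. exp (sqrt \<kappa> * A * z (k * m + l) - (sqrt \<kappa> * A)\<^sup>2 / 2)) / m ^ s"
      by (simp add: block_lr_def prod_dividef)
    also have "\<dots> = (\<Sum>f\<in>F. \<Prod>k<s. exp (sqrt \<kappa> * A * z (k * m + f k) - (sqrt \<kappa> * A)\<^sup>2 / 2)) / card F"
      unfolding F_def by (subst prod_sum_PiE) (auto simp: F(3)[unfolded F_def])
    also have "\<dots> = (\<Sum>f\<in>F. exp ((\<Sum>j<p. sqrt \<kappa> * block_spikes s m A f j * z j) - \<kappa> * (\<Sum>j<p. (block_spikes s m A f j)\<^sup>2) / 2)) / card F"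
      by (intro arg_cong2[where f="(/)"] sum.cong refl) (rule e[symmetric])
    finally show ?thesis by simp
  qed
  have "(\<integral>z. min 1 ((\<Sum>f\<in>F. exp ((\<Sum>j<p. sqrt \<kappa> * block_spikes s m A f j * z j) - \<kappa> * (\<Sum>j<p. (block_spikes s m A f j)\<^sup>2) / 2)) / card F) \<partial>gauss {..<p})
    \<le> gauss_mean n \<phi> (\<lambda>_. 0) + (\<Sum>f\<in>F. 1 - gauss_mean n \<phi> (matvec X p (block_spikes s m A f))) / card F"
  proof (rule augmented_bayes_bound[where I="{..<n} \<union> aux_index n p" and X'=X'])
    show "(\<Sum>i\<in>{..<n} \<union> aux_index n p. X' i j * X' i k) = (if j = k then \<kappa> else 0)" if "j < p" "k < p" for j k
      unfolding X'_def \<kappa>_def by (rule good_design_augment[OF good n eta that])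
  qed (use kappa \<phi> b F in \<open>auto simp: X'_def\<close>)
  then show ?thesis unfolding L by (simp add: \<kappa>_def)
qed

section \<open>Lower bound on the minimax risk\<close>

lemma Rspace_sets [measurable_cong]: "sets (Rspace n) = sets (gauss {..<n})"
  unfolding Rspace_def by (intro sets_PiM_cong) auto

lemma Rspace_space: "space (Rspace n) = space (gauss {..<n})"
  by (rule sets_eq_imp_space_eq) (rule Rspace_sets)

lemma Xspace_entry [measurable]:
  assumes "i < n" "j < p"
  shows "(\<lambda>X. X i j) \<in> borel_measurable (Xspace n p)"
proof -
  have "(\<lambda>X. X i) \<in> Xspace n p \<rightarrow>\<^sub>M Rspace p" using assms by (simp add: Xspace_def)
  moreover have "(\<lambda>x. x j) \<in> borel_measurable (Rspace p)" using assms by (simp add: Rspace_def)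
  ultimately show ?thesis by (rule measurable_compose)
qed

lemma good_design_measurable [measurable]: "Measurable.pred (Xspace n p) (good_design n p \<epsilon>)"
proof -
  have "good_design n p \<epsilon> = (\<lambda>X. \<forall>j\<in>{..<p}. \<forall>k\<in>{..<p}. \<bar>(\<Sum>i<n. X i j * X i k) / n - (if j = k then 1 else 0)\<bar> \<le> \<epsilon>)"
    by (auto simp: good_design_def fun_eq_iff)
  also have "Measurable.pred (Xspace n p) \<dots>" by measurable
  finally show ?thesis .
qed

context
  fixes n p :: nat and \<mu> :: "(nat \<Rightarrow> nat \<Rightarrow> real) measure"
  assumes mu: "prob_space \<mu>" and sets_mu: "sets \<mu> = sets (Xspace n p)"
begin

lemma data_map_measurable:
  "(\<lambda>(X, e). (\<lambda>i\<in>{..<n}. matvec X p \<beta> i + e i, X)) \<in> \<mu> \<Otimes>\<^sub>M gauss {..<n} \<rightarrow>\<^sub>M Dspace n p"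
proof -
  have sets: "sets (\<mu> \<Otimes>\<^sub>M gauss {..<n}) = sets (Xspace n p \<Otimes>\<^sub>M gauss {..<n})"
    by (intro sets_pair_measure_cong sets_mu refl)
  have "(\<lambda>(X, e). (\<lambda>i\<in>{..<n}. matvec X p \<beta> i + e i)) \<in> Xspace n p \<Otimes>\<^sub>M gauss {..<n} \<rightarrow>\<^sub>M Rspace n"
    unfolding Rspace_def case_prod_beta' matvec_def
    by (rule measurable_restrict) (intro borel_measurable_add borel_measurable_sum borel_measurable_times;
        auto intro: measurable_compose[OF measurable_fst Xspace_entry])
  then show ?thesis
    unfolding Dspace_def measurable_cong_sets[OF sets refl] by (auto simp: case_prod_beta' intro!: measurable_Pair)
qed

lemma data_law_prob_space: "prob_space (data_law n p \<mu> \<beta>)"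
proof -
  interpret prob_space \<mu> by (rule mu)
  interpret g: prob_space "gauss {..<n}" by (rule prob_space_gauss)
  interpret pair_prob_space \<mu> "gauss {..<n}" ..
  show ?thesis unfolding data_law_def by (rule prob_space_distr[OF data_map_measurable])
qed

lemma test_section:
  assumes T: "is_test n p T" and X: "X \<in> space \<mu>"
  shows "(\<lambda>y. T (y, X)) \<in> borel_measurable (gauss {..<n})"
    "\<And>y. y \<in> space (gauss {..<n}) \<Longrightarrow> 0 \<le> T (y, X) \<and> T (y, X) \<le> 1"
proof -
  have X': "X \<in> space (Xspace n p)" using X sets_eq_imp_space_eq[OF sets_mu] by simp
  have "(\<lambda>y. T (y, X)) \<in> borel_measurable (Rspace n)"
    using T X' unfolding is_test_def Dspace_def by (auto intro: measurable_Pair1)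
  then show "(\<lambda>y. T (y, X)) \<in> borel_measurable (gauss {..<n})"
    by (simp add: measurable_cong_sets[OF Rspace_sets refl])
  show "0 \<le> T (y, X) \<and> T (y, X) \<le> 1" if "y \<in> space (gauss {..<n})" for y
    using T X' that by (auto simp: is_test_def Dspace_def space_pair_measure Rspace_space)
qed

lemma data_law_integral:
  assumes T: "is_test n p T"
  shows "(\<integral>z. T z \<partial>data_law n p \<mu> \<beta>) = (\<integral>X. gauss_mean n (\<lambda>y. T (y, X)) (matvec X p \<beta>) \<partial>\<mu>)"
    "integrable \<mu> (\<lambda>X. gauss_mean n (\<lambda>y. T (y, X)) (matvec X p \<beta>))"
    "(\<integral>z. 1 - T z \<partial>data_law n p \<mu> \<beta>) = 1 - (\<integral>X. gauss_mean n (\<lambda>y. T (y, X)) (matvec X p \<beta>) \<partial>\<mu>)"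
proof -
  interpret m: prob_space \<mu> by (rule mu)
  interpret g: prob_space "gauss {..<n}" by (rule prob_space_gauss)
  interpret pair_prob_space \<mu> "gauss {..<n}" ..
  interpret d: prob_space "data_law n p \<mu> \<beta>" by (rule data_law_prob_space)
  let ?f = "\<lambda>(X, e). (\<lambda>i\<in>{..<n}. matvec X p \<beta> i + e i, X)"
  have Tm: "T \<in> borel_measurable (Dspace n p)" using T by (simp add: is_test_def)
  have int: "integrable (data_law n p \<mu> \<beta>) T"
    by (rule d.integrable_const_bound[where B=1]) (use T in \<open>auto simp: is_test_def data_law_def\<close>)
  then have int2: "integrable (\<mu> \<Otimes>\<^sub>M gauss {..<n}) (\<lambda>w. T (?f w))"
    unfolding data_law_def by (simp only: integrable_distr_eq[OF data_map_measurable Tm])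
  have "(\<integral>z. T z \<partial>data_law n p \<mu> \<beta>) = (\<integral>w. T (?f w) \<partial>(\<mu> \<Otimes>\<^sub>M gauss {..<n}))"
    unfolding data_law_def by (rule integral_distr[OF data_map_measurable Tm])
  also have "\<dots> = (\<integral>X. \<integral>e. T (?f (X, e)) \<partial>gauss {..<n} \<partial>\<mu>)"
    by (rule integral_fst'[OF int2, symmetric])
  finally show *: "(\<integral>z. T z \<partial>data_law n p \<mu> \<beta>) = (\<integral>X. gauss_mean n (\<lambda>y. T (y, X)) (matvec X p \<beta>) \<partial>\<mu>)"
    by (simp add: gauss_mean_def)
  show "integrable \<mu> (\<lambda>X. gauss_mean n (\<lambda>y. T (y, X)) (matvec X p \<beta>))"
    using integrable_fst'[OF int2] by (simp add: gauss_mean_def)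
  show "(\<integral>z. 1 - T z \<partial>data_law n p \<mu> \<beta>) = 1 - (\<integral>X. gauss_mean n (\<lambda>y. T (y, X)) (matvec X p \<beta>) \<partial>\<mu>)"
    using int by (simp add: *[symmetric] d.prob_space)
qed

lemma good_design_event: "{X \<in> space \<mu>. good_design n p \<epsilon> X} \<in> sets \<mu>"
proof -
  have "{X \<in> space (Xspace n p). good_design n p \<epsilon> X} \<in> sets (Xspace n p)" by measurable
  then show ?thesis by (simp add: sets_mu sets_eq_imp_space_eq[OF sets_mu])
qed

text \<open>The supremum dominates the average over the prior. Conditionally on a good design the
  Bayes bound applies; on a bad one only nonnegativity of the errors is used. Because the Bayes
  bound \<open>b\<close> is at most 1, bad designs cost no more than their probability.\<close>

lemma risk_test_lower_bound:
  fixes \<eta> A :: real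
  assumes T: "is_test n p T" and n: "0 < n" and eta: "0 \<le> \<eta>" and sm: "s * m \<le> p" "0 < m" and A: "0 < A"
  shows "(\<integral>z. min 1 (block_lr s m (sqrt (n * (1 + \<eta>)) * A) z) \<partial>gauss {..<p})
     - measure \<mu> {X \<in> space \<mu>. \<not> good_design n p (\<eta> / p) X} \<le> risk_test n p \<mu> T s A"
proof -
  interpret m: prob_space \<mu> by (rule mu)
  define F where "F = PiE {..<s} (\<lambda>_. {..<m})"
  have F: "finite F" "F \<noteq> {}" using sm by (auto simp: F_def finite_PiE PiE_eq_empty_iff)
  then have cF: "card F > 0" by (simp add: card_gt_0_iff)
  define b where "b = (\<integral>z. min 1 (block_lr s m (sqrt (n * (1 + \<eta>)) * A) z) \<partial>gauss {..<p})"
  define J where "J \<beta> X = gauss_mean n (\<lambda>y. T (y, X)) (matvec X p \<beta>)" for \<beta> X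
  define G where "G = {X \<in> space \<mu>. good_design n p (\<eta> / p) X}"
  have Gm: "G \<in> sets \<mu>" unfolding G_def by (rule good_design_event)
  have Ji: "integrable \<mu> (J \<beta>)" for \<beta> unfolding J_def by (rule data_law_integral(2)[OF T])
  have J01: "0 \<le> J \<beta> X" "J \<beta> X \<le> 1" if "X \<in> space \<mu>" for X \<beta>
    using nn_integral_gauss_mean(3,4)[OF test_section[OF T that]] by (auto simp: J_def)
  have b1: "b \<le> 1"
  proof -
    interpret g: prob_space "gauss {..<p}" by (rule prob_space_gauss)
    \<comment> \<open>A non-integrable integrand would have integral 0, which is also at most
      1.\<close>
    show ?thesis
    proof (cases "integrable (gauss {..<p}) (\<lambda>z. min 1 (block_lr s m (sqrt (n * (1 + \<eta>)) * A) z))")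
      case True
      then have "b \<le> (\<integral>z. 1 \<partial>gauss {..<p})" unfolding b_def by (intro integral_mono) auto
      then show ?thesis by (simp add: g.prob_space)
    qed (simp add: b_def not_integrable_integral_eq)
  qed
  have alt: "(\<integral>z. 1 - T z \<partial>data_law n p \<mu> \<beta>) = 1 - (\<integral>X. J \<beta> X \<partial>\<mu>)" for \<beta>
    unfolding J_def by (rule data_law_integral(3)[OF T])
  have J_le: "0 \<le> (\<integral>X. J \<beta> X \<partial>\<mu>)" for \<beta>
    by (rule integral_nonneg_AE) (use J01 in auto)
  have bdd: "bdd_above ((\<lambda>\<beta>. \<integral>z. 1 - T z \<partial>data_law n p \<mu> \<beta>) ` Xi p s A)"
    by (rule bdd_aboveI[of _ 1]) (use J_le alt in auto)
  define S where "S = (SUP \<beta>\<in>Xi p s A. \<integral>z. 1 - T z \<partial>data_law n p \<mu> \<beta>)"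
  have S: "1 - (\<integral>X. J (block_spikes s m A f) X \<partial>\<mu>) \<le> S" if "f \<in> F" for f
    unfolding S_def alt[symmetric]
    by (rule cSUP_upper[OF _ bdd]) (use that sm A in \<open>auto simp: F_def intro: block_spikes_in_Xi\<close>)
  have avg: "(\<Sum>f\<in>F. 1 - (\<integral>X. J (block_spikes s m A f) X \<partial>\<mu>)) / card F \<le> S"
  proof -
    have "(\<Sum>f\<in>F. 1 - (\<integral>X. J (block_spikes s m A f) X \<partial>\<mu>)) \<le> (\<Sum>f\<in>F. S)" by (intro sum_mono S)
    then show ?thesis using cF by (simp add: field_simps)
  qed
  define R where "R X = J (\<lambda>_. 0) X + (\<Sum>f\<in>F. 1 - J (block_spikes s m A f) X) / card F" for X
  have Ri: "integrable \<mu> R" unfolding R_def using Ji by auto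
  have IR: "(\<integral>X. R X \<partial>\<mu>) = (\<integral>X. J (\<lambda>_. 0) X \<partial>\<mu>) + (\<Sum>f\<in>F. 1 - (\<integral>X. J (block_spikes s m A f) X \<partial>\<mu>)) / card F"
    unfolding R_def using Ji by (simp add: m.prob_space)
  have RG: "b * indicator G X \<le> R X" if X: "X \<in> space \<mu>" for X
  proof (cases "X \<in> G")
    case True
    then have good: "good_design n p (\<eta> / p) X" by (simp add: G_def)
    have z: "matvec X p (\<lambda>_. 0) = (\<lambda>_. 0)" by (simp add: matvec_def fun_eq_iff)
    show ?thesis
      using good_design_bayes_bound[OF good n eta sm test_section[OF T X], of A] True
      by (simp add: R_def J_def b_def F_def z)
  next
    case False
    have "0 \<le> R X" unfolding R_def using J01[OF X]
      by (auto intro!: add_nonneg_nonneg divide_nonneg_nonneg sum_nonneg)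
    then show ?thesis using False by simp
  qed
  have "b * measure \<mu> G = (\<integral>X. b * indicator G X \<partial>\<mu>)" using Gm by simp
  also have "\<dots> \<le> (\<integral>X. R X \<partial>\<mu>)"
  proof (rule integral_mono_AE)
    show "integrable \<mu> (\<lambda>X. b * indicator G X)" using Gm
      by (intro integrable_mult_right m.integrable_const_bound[where B=1]) auto
  qed (use RG Ri in auto)
  also have "\<dots> \<le> (\<integral>X. J (\<lambda>_. 0) X \<partial>\<mu>) + S" using IR avg by simp
  also have "\<dots> = risk_test n p \<mu> T s A"
    unfolding risk_test_def S_def data_law_integral(1)[OF T] by (simp add: J_def)
  finally have 1: "b * measure \<mu> G \<le> risk_test n p \<mu> T s A" .
  have "{X \<in> space \<mu>. \<not> good_design n p (\<eta> / p) X} = space \<mu> - G" by (auto simp: G_def)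
  then have 2: "measure \<mu> {X \<in> space \<mu>. \<not> good_design n p (\<eta> / p) X} = 1 - measure \<mu> G"
    using m.prob_compl[OF Gm] by simp
  have "b * (1 - measure \<mu> G) \<le> 1 * (1 - measure \<mu> G)" by (intro mult_right_mono b1) simp
  then have "b - measure \<mu> {X \<in> space \<mu>. \<not> good_design n p (\<eta> / p) X} \<le> risk_test n p \<mu> T s A"
    using 1 2 by (simp add: algebra_simps)
  then show ?thesis by (simp only: b_def)
qed

text \<open>Shows that the set of tests is nonempty, as required for a real infimum over it.\<close>

lemma is_test_zero: "is_test n p (\<lambda>_. 0)"
  by (simp add: is_test_def)

lemma minimax_risk_lower_bound:
  fixes \<eta> A :: real
  assumes "0 < n" "0 \<le> \<eta>" "s * m \<le> p" "0 < m" "0 < A"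
  shows "(\<integral>z. min 1 (block_lr s m (sqrt (n * (1 + \<eta>)) * A) z) \<partial>gauss {..<p})
     - measure \<mu> {X \<in> space \<mu>. \<not> good_design n p (\<eta> / p) X} \<le> minimax_risk n p \<mu> s A"
  unfolding minimax_risk_def
  by (rule cINF_greatest) (use is_test_zero risk_test_lower_bound[OF _ assms] in auto)

text \<open>A real infimum lies below its members only if the set is bounded below; the lower bound
  on the risk, taken with \<open>\<eta> = 0\<close> and blocks of length 1, provides this.\<close>

lemma minimax_risk_le:
  assumes "is_test n p T" "0 < n" "0 < s" "s \<le> p" "0 < A"
  shows "minimax_risk n p \<mu> s A \<le> risk_test n p \<mu> T s A"
  unfolding minimax_risk_def
proof (rule cINF_lower)
  show "bdd_below ((\<lambda>T. risk_test n p \<mu> T s A) ` {T. is_test n p T})"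
    using risk_test_lower_bound[of _ 0 s 1 A] assms by (intro bdd_belowI2) auto
qed (use assms in auto)

end

section \<open>The counting test\<close>

lemma gauss_orthonormal_distr:
  fixes u :: "nat \<Rightarrow> nat \<Rightarrow> real"
  assumes I: "finite I"
    and orth: "\<And>j k. j < p \<Longrightarrow> k < p \<Longrightarrow> (\<Sum>i\<in>I. u j i * u k i) = (if j = k then 1 else 0)"
  shows "distr (gauss I) (gauss {..<p}) (\<lambda>g. \<lambda>j\<in>{..<p}. \<Sum>i\<in>I. u j i * g i) = gauss {..<p}"
proof (rule measure_eqI)
  have m: "(\<lambda>g. \<lambda>j\<in>{..<p}. \<Sum>i\<in>I. u j i * g i) \<in> gauss I \<rightarrow>\<^sub>M gauss {..<p}"
    by (rule measurable_restrict) measurable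
  fix A assume "A \<in> sets (distr (gauss I) (gauss {..<p}) (\<lambda>g. \<lambda>j\<in>{..<p}. \<Sum>i\<in>I. u j i * g i))"
  then have A: "A \<in> sets (gauss {..<p})" by simp
  let ?D = "distr (gauss I) (gauss {..<p}) (\<lambda>g. \<lambda>j\<in>{..<p}. \<Sum>i\<in>I. u j i * g i)"
  have "emeasure ?D A = (\<integral>\<^sup>+z. indicator A z \<partial>?D)" using A by simp
  also have "\<dots> = (\<integral>\<^sup>+g. indicator A (\<lambda>j\<in>{..<p}. \<Sum>i\<in>I. u j i * g i) \<partial>gauss I)"
    by (rule nn_integral_distr[OF m]) (use A in auto)
  also have "\<dots> = (\<integral>\<^sup>+z. indicator A z \<partial>gauss {..<p})"
    by (rule gauss_orthonormal[OF I _ orth]) (use A in auto)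
  finally show "emeasure ?D A = emeasure (gauss {..<p}) A" using A by simp
qed simp

definition gram_error :: "nat \<Rightarrow> (nat \<Rightarrow> nat \<Rightarrow> real) \<Rightarrow> nat \<Rightarrow> nat \<Rightarrow> real" where
  "gram_error n X j k = (\<Sum>i<n. X i j * X i k) / n - (if j = k then 1 else 0)"

text \<open>Row \<open>j\<close> of the matrix that maps y to the least squares estimator times
  \<open>sqrt (n * (1 - \<eta>))\<close>, the inverse Gram matrix being written as a Neumann
  series.\<close>

definition ols_row :: "nat \<Rightarrow> nat \<Rightarrow> real \<Rightarrow> (nat \<Rightarrow> nat \<Rightarrow> real) \<Rightarrow> nat \<Rightarrow> nat \<Rightarrow> real" where
  "ols_row n p \<eta> X j i = sqrt ((1 - \<eta>) / n) * (\<Sum>k<p. neumann_inverse p (gram_error n X) j k * X i k)"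

text \<open>Factor of the identity minus the covariance of the rescaled estimator. The arguments are
  swapped because here the rows of the estimator play the part of design columns.\<close>

definition noise_row :: "nat \<Rightarrow> nat \<Rightarrow> real \<Rightarrow> (nat \<Rightarrow> nat \<Rightarrow> real) \<Rightarrow> nat \<Rightarrow> nat \<Rightarrow> real" where
  "noise_row n p \<eta> X j i = dd_factor p (gram_deficit n 1 (\<lambda>i j. ols_row n p \<eta> X j i)) j (pair_decode n i)"

text \<open>The rescaled least squares estimator has covariance slightly below the identity; independent
  noise with the missing covariance turns it into an exact Gaussian sequence.\<close>

lemma ols_row_facts:
  fixes \<eta> :: real
  assumes good: "good_design n p (\<eta> / 2 / p) X" and n: "0 < n" and eta: "0 \<le> \<eta>" "\<eta> \<le> 1"
    and jl: "j < p" "l < p"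
  shows "(\<Sum>i<n. ols_row n p \<eta> X j i * X i l) = (if j = l then sqrt (n * (1 - \<eta>)) else 0)"
    and "(\<Sum>i<n. ols_row n p \<eta> X j i * ols_row n p \<eta> X l i)
       + (\<Sum>i\<in>aux_index n p. noise_row n p \<eta> X j i * noise_row n p \<eta> X l i) = (if j = l then 1 else 0)"
proof -
  define E where "E = gram_error n X"
  define H where "H = neumann_inverse p E"
  define B where "B = ols_row n p \<eta> X"
  define D where "D = gram_deficit n 1 (\<lambda>i j. B j i)"
  have E: "\<bar>E a b\<bar> \<le> \<eta> / 2 / p" if "a < p" "b < p" for a b
    using good that by (auto simp: good_design_def E_def gram_error_def)
  have e1: "0 \<le> \<eta> / 2 / p" using eta by simp
  have e2: "p * (\<eta> / 2 / p) \<le> 1 / 2" using eta jl by simp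
  have XX: "(\<Sum>i<n. X i a * X i b) = n * ((if a = b then 1 else 0) + E a b)" for a b
    using n by (simp add: E_def gram_error_def)
  have BX: "(\<Sum>i<n. B a i * X i b) = (if a = b then sqrt (n * (1 - \<eta>)) else 0)" if ab: "a < p" "b < p" for a b
  proof -
    have "(\<Sum>i<n. B a i * X i b) = (\<Sum>i<n. \<Sum>k<p. sqrt ((1 - \<eta>) / n) * (H a k * (X i k * X i b)))"
      by (simp add: B_def ols_row_def H_def E_def sum_distrib_left sum_distrib_right mult_ac)
    also have "\<dots> = (\<Sum>k<p. \<Sum>i<n. sqrt ((1 - \<eta>) / n) * (H a k * (X i k * X i b)))" by (rule sum.swap)
    also have "\<dots> = (\<Sum>k<p. sqrt ((1 - \<eta>) / n) * (H a k * (\<Sum>i<n. X i k * X i b)))"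
      by (simp add: sum_distrib_left)
    also have "\<dots> = sqrt ((1 - \<eta>) / n) * n * (\<Sum>k<p. H a k * ((if k = b then 1 else 0) + E k b))"
      unfolding XX by (simp add: sum_distrib_left mult_ac)
    also have "\<dots> = sqrt ((1 - \<eta>) / n) * n * (if a = b then 1 else 0)"
      unfolding H_def by (simp only: neumann_inverse_mult[of p E "\<eta> / 2 / p" a b, OF E e1 e2 ab])
    also have "sqrt ((1 - \<eta>) / n) * n = sqrt (n * (1 - \<eta>))"
    proof -
      have "sqrt ((1 - \<eta>) / n) * n = sqrt ((1 - \<eta>) / n) * sqrt (real n * real n)" by simp
      also have "\<dots> = sqrt ((1 - \<eta>) / n * (real n * real n))" by (simp only: real_sqrt_mult)
      also have "(1 - \<eta>) / n * (real n * real n) = n * (1 - \<eta>)" using n by simp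
      finally show ?thesis .
    qed
    finally show ?thesis by simp
  qed
  show "(\<Sum>i<n. ols_row n p \<eta> X j i * X i l) = (if j = l then sqrt (n * (1 - \<eta>)) else 0)"
    using BX[OF jl] by (simp add: B_def)
  \<comment> \<open>Only the second factor is expanded; \<open>BX\<close> evaluates the products
    that arise, and an entry of the Neumann inverse is left.\<close>
  have BB: "(\<Sum>i<n. B a i * B b i) = (1 - \<eta>) * H b a" if ab: "a < p" "b < p" for a b
  proof -
    have "(\<Sum>i<n. B a i * B b i) = (\<Sum>i<n. \<Sum>k<p. sqrt ((1 - \<eta>) / n) * (H b k * (B a i * X i k)))"
      by (simp add: B_def[THEN fun_cong, THEN fun_cong, of b] ols_row_def H_def E_def sum_distrib_left mult_ac)
    also have "\<dots> = (\<Sum>k<p. \<Sum>i<n. sqrt ((1 - \<eta>) / n) * (H b k * (B a i * X i k)))" by (rule sum.swap)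
    also have "\<dots> = (\<Sum>k<p. sqrt ((1 - \<eta>) / n) * (H b k * (\<Sum>i<n. B a i * X i k)))"
      by (simp add: sum_distrib_left)
    also have "\<dots> = (\<Sum>k<p. (sqrt ((1 - \<eta>) / n) * sqrt (n * (1 - \<eta>)) * H b k) * (if a = k then 1 else 0))"
      by (intro sum.cong refl) (use BX ab in auto)
    also have "\<dots> = sqrt ((1 - \<eta>) / n) * sqrt (n * (1 - \<eta>)) * H b a"
      by (rule sum_mult_delta(1)[OF ab(1)])
    also have "sqrt ((1 - \<eta>) / n) * sqrt (n * (1 - \<eta>)) = 1 - \<eta>"
      using n eta by (simp add: real_sqrt_mult[symmetric])
    finally show ?thesis .
  qed
  \<comment> \<open>The Neumann series doubles the entrywise error, hence the tolerance
    \<open>\<eta> / 2 / p\<close> on the design.\<close>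
  have near: "\<bar>H a b - (if a = b then 1 else 0)\<bar> \<le> \<eta> / p" if "a < p" "b < p" for a b
    using neumann_inverse_near_identity[OF E e1 e2 that] by (simp add: H_def)
  have sym: "D a b = D b a" for a b by (auto simp: D_def gram_deficit_def mult.commute)
  have DD: "D a b = (if a = b then 1 else 0) - (1 - \<eta>) * H b a" if "a < p" "b < p" for a b
    by (simp add: D_def gram_deficit_def BB that)
  have off: "\<bar>D a b\<bar> \<le> \<eta> / p" if "a < p" "b < p" "a \<noteq> b" for a b
  proof -
    have "\<bar>D a b\<bar> = (1 - \<eta>) * \<bar>H b a\<bar>" using that eta by (simp add: DD abs_mult)
    also have "\<dots> \<le> 1 * (\<eta> / p)" using near[of b a] that eta by (intro mult_mono) auto
    finally show ?thesis by simp
  qed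
  \<comment> \<open>Shrinking by \<open>1 - \<eta>\<close> frees an amount \<eta> on the diagonal.
    It pays for the error \<eta> / p of the diagonal entry and for p - 1 off-diagonal entries of
    that size.\<close>
  have diag: "\<eta> - \<eta> / p \<le> D a a" if "a < p" for a
  proof -
    have "H a a \<le> 1 + \<eta> / p" using near[OF that that] by (simp add: abs_le_iff)
    then have "(1 - \<eta>) * H a a \<le> (1 - \<eta>) * (1 + \<eta> / p)" using eta by (intro mult_left_mono) auto
    also have "\<dots> = 1 - \<eta> + (1 - \<eta>) * (\<eta> / p)" by (simp add: algebra_simps)
    also have "(1 - \<eta>) * (\<eta> / p) \<le> 1 * (\<eta> / p)" using eta by (intro mult_right_mono) auto
    finally show ?thesis using that by (simp add: DD)
  qed
  have dom: "(\<Sum>l\<in>{..<p} - {a}. \<bar>D a l\<bar>) \<le> D a a" if "a < p" for a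
  proof -
    have "(\<Sum>l\<in>{..<p} - {a}. \<bar>D a l\<bar>) \<le> (\<Sum>l\<in>{..<p} - {a}. \<eta> / p)"
      by (rule sum_mono) (use off that in auto)
    also have "\<dots> = (real p - 1) * (\<eta> / p)" using that by (simp add: of_nat_diff)
    also have "\<dots> = \<eta> - \<eta> / p" using that by (simp add: field_simps)
    also have "\<dots> \<le> D a a" by (rule diag[OF that])
    finally show ?thesis .
  qed
  have "(\<Sum>i\<in>aux_index n p. noise_row n p \<eta> X j i * noise_row n p \<eta> X l i) = D j l"
    using sum_aux_index[of "\<lambda>c. dd_factor p D j c * dd_factor p D l c" n p] dd_factor_product[OF sym dom jl]
    by (simp add: noise_row_def D_def B_def)
  then show "(\<Sum>i<n. ols_row n p \<eta> X j i * ols_row n p \<eta> X l i)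
       + (\<Sum>i\<in>aux_index n p. noise_row n p \<eta> X j i * noise_row n p \<eta> X l i) = (if j = l then 1 else 0)"
    by (simp add: D_def gram_deficit_def B_def)
qed

section \<open>Measurability of the randomized statistic in the data\<close>

lemma neumann_term_measurable:
  assumes "\<And>j k. j < p \<Longrightarrow> k < p \<Longrightarrow> (\<lambda>x. E x j k) \<in> borel_measurable M" and "j < p" "k < p"
  shows "(\<lambda>x. neumann_term p (E x) q j k) \<in> borel_measurable M"
  using assms(3)
proof (induction q arbitrary: k)
  case (Suc q)
  show ?case unfolding neumann_term.simps
    by (intro borel_measurable_uminus borel_measurable_sum borel_measurable_times Suc.IH assms(1))
       (use assms(2) Suc.prems in auto)
qed simp

lemma dd_factor_measurable:
  assumes D: "\<And>j k. j < p \<Longrightarrow> k < p \<Longrightarrow> (\<lambda>x. D x j k) \<in> borel_measurable M" and c: "fst c < p" "snd c < p"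
  shows "(\<lambda>x. dd_factor p (D x) a c) \<in> borel_measurable M"
proof -
  obtain j k where jk: "c = (j, k)" by force
  then have [measurable]: "(\<lambda>x. D x j k) \<in> borel_measurable M" "(\<lambda>x. D x j j) \<in> borel_measurable M"
    using c D by auto
  have [measurable]: "(\<lambda>x. D x j l) \<in> borel_measurable M" if "l \<in> {..<p} - {j}" for l
    using c D jk that by auto
  have sg: "sgn x = (if x > 0 then 1 else if x < 0 then - 1 else 0)" for x :: real by (simp add: sgn_if)
  show ?thesis
    unfolding jk dd_factor_def prod.case sg by measurable
qed

lemma ols_row_measurable:
  assumes "j < p" "i < n"
  shows "(\<lambda>X. ols_row n p \<eta> X j i) \<in> borel_measurable (Xspace n p)"
proof -
  have E: "(\<lambda>X. gram_error n X a b) \<in> borel_measurable (Xspace n p)" if "a < p" "b < p" for a b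
    unfolding gram_error_def using that by measurable
  have H: "(\<lambda>X. neumann_inverse p (gram_error n X) j k) \<in> borel_measurable (Xspace n p)" if "k < p" for k
    unfolding neumann_inverse_def
    by (intro borel_measurable_suminf neumann_term_measurable E) (use assms that in auto)
  show ?thesis unfolding ols_row_def
    by (intro borel_measurable_times borel_measurable_sum borel_measurable_const H Xspace_entry) (use assms in auto)
qed

lemma noise_row_measurable:
  assumes "j < p" "i \<in> aux_index n p"
  shows "(\<lambda>X. noise_row n p \<eta> X j i) \<in> borel_measurable (Xspace n p)"
  unfolding noise_row_def
proof (rule dd_factor_measurable)
  show "(\<lambda>X. gram_deficit n 1 (\<lambda>i j. ols_row n p \<eta> X j i) a b) \<in> borel_measurable (Xspace n p)" if "a < p" "b < p" for a b
    unfolding gram_deficit_def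
    by (intro borel_measurable_diff borel_measurable_const borel_measurable_sum borel_measurable_times ols_row_measurable)
       (use that in auto)
qed (use assms in \<open>auto simp: aux_index_def\<close>)

definition ols_stat :: "nat \<Rightarrow> nat \<Rightarrow> real \<Rightarrow> (nat \<Rightarrow> nat \<Rightarrow> real) \<Rightarrow> (nat \<Rightarrow> real) \<Rightarrow> (nat \<Rightarrow> real) \<Rightarrow> nat \<Rightarrow> real" where
  "ols_stat n p \<eta> X y \<xi> j = (\<Sum>i<n. ols_row n p \<eta> X j i * y i) + (\<Sum>i\<in>aux_index n p. noise_row n p \<eta> X j i * \<xi> i)"

definition exceed_count :: "nat \<Rightarrow> real \<Rightarrow> (nat \<Rightarrow> real) \<Rightarrow> nat" where
  "exceed_count p t z = (\<Sum>j<p. if \<bar>z j\<bar> > t then 1 else 0)"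

text \<open>The auxiliary noise is integrated out, so that a randomized procedure becomes a function
  of the data with values between 0 and 1. On bad designs the test never rejects.\<close>

definition count_test :: "nat \<Rightarrow> nat \<Rightarrow> real \<Rightarrow> real \<Rightarrow> (nat \<Rightarrow> real) \<Rightarrow> (nat \<Rightarrow> real) \<times> (nat \<Rightarrow> nat \<Rightarrow> real) \<Rightarrow> real" where
  "count_test n p \<eta> t \<phi> = (\<lambda>(y, X). if good_design n p (\<eta> / 2 / p) X
     then (\<integral>\<xi>. \<phi> (exceed_count p t (ols_stat n p \<eta> X y \<xi>)) \<partial>gauss (aux_index n p)) else 0)"

lemma ols_stat_measurable:
  assumes "j < p"
  shows "(\<lambda>(w, \<xi>). ols_stat n p \<eta> (snd w) (fst w) \<xi> j) \<in> borel_measurable (Dspace n p \<Otimes>\<^sub>M gauss (aux_index n p))"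
proof -
  let ?M = "Dspace n p \<Otimes>\<^sub>M gauss (aux_index n p)"
  have X: "(\<lambda>q. snd (fst q)) \<in> ?M \<rightarrow>\<^sub>M Xspace n p" unfolding Dspace_def by measurable
  have y: "(\<lambda>q. fst (fst q) i) \<in> borel_measurable ?M" if "i < n" for i
  proof -
    have "(\<lambda>q. fst (fst q)) \<in> ?M \<rightarrow>\<^sub>M Rspace n" unfolding Dspace_def by measurable
    moreover have "(\<lambda>y. y i) \<in> borel_measurable (Rspace n)" using that by (simp add: Rspace_def)
    ultimately show ?thesis by (rule measurable_compose)
  qed
  have xi: "(\<lambda>q. snd q i) \<in> borel_measurable ?M" if "i \<in> aux_index n p" for i
    using that by measurable
  show ?thesis unfolding ols_stat_def case_prod_beta'
    by (intro borel_measurable_add borel_measurable_sum borel_measurable_times y xi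
          measurable_compose[OF X ols_row_measurable] measurable_compose[OF X noise_row_measurable])
       (use assms in auto)
qed

lemma exceed_count_measurable:
  assumes "\<And>j. j < p \<Longrightarrow> (\<lambda>x. z x j) \<in> borel_measurable M"
  shows "(\<lambda>x. exceed_count p t (z x)) \<in> measurable M (count_space UNIV)"
proof -
  have [measurable]: "(\<lambda>x. z x j) \<in> borel_measurable M" if "j \<in> {..<p}" for j using assms that by simp
  show ?thesis unfolding exceed_count_def by measurable
qed

lemma count_test_is_test:
  assumes \<phi>: "\<And>w. 0 \<le> \<phi> w \<and> \<phi> w \<le> 1"
  shows "is_test n p (count_test n p \<eta> t \<phi>)"
proof -
  interpret g: prob_space "gauss (aux_index n p)" by (rule prob_space_gauss)
  have m: "(\<lambda>q. exceed_count p t (ols_stat n p \<eta> (snd (fst q)) (fst (fst q)) (snd q)))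
      \<in> measurable (Dspace n p \<Otimes>\<^sub>M gauss (aux_index n p)) (count_space UNIV)"
    using ols_stat_measurable[of _ p n \<eta>] by (intro exceed_count_measurable) (simp add: case_prod_beta')
  have "(\<lambda>q. \<phi> (exceed_count p t (ols_stat n p \<eta> (snd (fst q)) (fst (fst q)) (snd q))))
      \<in> borel_measurable (Dspace n p \<Otimes>\<^sub>M gauss (aux_index n p))"
    by (rule measurable_compose[OF m]) simp
  then have [measurable]: "(\<lambda>(w, \<xi>). \<phi> (exceed_count p t (ols_stat n p \<eta> (snd w) (fst w) \<xi>)))
      \<in> borel_measurable (Dspace n p \<Otimes>\<^sub>M gauss (aux_index n p))"
    by (simp add: case_prod_beta')
  have [measurable]: "snd \<in> Dspace n p \<rightarrow>\<^sub>M Xspace n p" unfolding Dspace_def by measurable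
  have "count_test n p \<eta> t \<phi> = (\<lambda>w. if good_design n p (\<eta> / 2 / p) (snd w)
     then (\<integral>\<xi>. \<phi> (exceed_count p t (ols_stat n p \<eta> (snd w) (fst w) \<xi>)) \<partial>gauss (aux_index n p)) else 0)"
    by (simp add: count_test_def case_prod_beta')
  also have "\<dots> \<in> borel_measurable (Dspace n p)" by measurable
  finally have 1: "count_test n p \<eta> t \<phi> \<in> borel_measurable (Dspace n p)" .
  have "0 \<le> count_test n p \<eta> t \<phi> z \<and> count_test n p \<eta> t \<phi> z \<le> 1" for z
  proof -
    have "(\<integral>\<xi>. \<phi> (h \<xi>) \<partial>gauss (aux_index n p)) \<le> 1" for h :: "(nat \<Rightarrow> real) \<Rightarrow> nat"
    proof (cases "integrable (gauss (aux_index n p)) (\<lambda>\<xi>. \<phi> (h \<xi>))")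
      case True
      then have "(\<integral>\<xi>. \<phi> (h \<xi>) \<partial>gauss (aux_index n p)) \<le> (\<integral>\<xi>. 1 \<partial>gauss (aux_index n p))"
        using \<phi> by (intro integral_mono) auto
      then show ?thesis by (simp add: g.prob_space)
    qed (simp add: not_integrable_integral_eq)
    moreover have "0 \<le> (\<integral>\<xi>. \<phi> (h \<xi>) \<partial>gauss (aux_index n p))" for h :: "(nat \<Rightarrow> real) \<Rightarrow> nat"
      using \<phi> by (intro Bochner_Integration.integral_nonneg) auto
    ultimately show ?thesis by (auto simp: count_test_def split: prod.split)
  qed
  with 1 show ?thesis by (simp add: is_test_def)
qed

text \<open>The observation noise and the auxiliary noise together form one Gaussian vector, on
  which the combined rows are orthonormal. The statistic is thus exactly a Gaussian sequence with
  mean \<open>sqrt (n * (1 - \<eta>)) * \<beta> j\<close>, and its exceedances are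
  independent.\<close>

lemma count_test_mean:
  fixes \<eta> :: real
  assumes good: "good_design n p (\<eta> / 2 / p) X" and n: "0 < n" and eta: "0 \<le> \<eta>" "\<eta> \<le> 1"
    and \<phi>: "\<And>w. 0 \<le> \<phi> w \<and> \<phi> w \<le> 1"
  shows "gauss_mean n (\<lambda>y. count_test n p \<eta> t \<phi> (y, X)) (matvec X p \<beta>)
    = bern_expect p (\<lambda>j. measure std_gauss {x. \<bar>x + sqrt (n * (1 - \<eta>)) * \<beta> j\<bar> > t}) \<phi>"
proof -
  define J where "J = aux_index n p"
  define I where "I = {..<n} \<union> J"
  have fin: "finite {..<n}" "finite J" "{..<n} \<inter> J = {}" by (simp_all add: J_def aux_index_disjoint)
  have finI: "finite I" by (simp add: I_def J_def)
  define \<theta> where "\<theta> j = sqrt (n * (1 - \<eta>)) * \<beta> j" for j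
  define u where "u j i = (if i < n then ols_row n p \<eta> X j i else noise_row n p \<eta> X j i)" for j i
  have nJ: "\<not> i < n" if "i \<in> J" for i using that fin(3) by auto
  have split: "(\<Sum>i\<in>I. f i) = (\<Sum>i<n. f i) + (\<Sum>i\<in>J. f i)" for f :: "nat \<Rightarrow> real"
    unfolding I_def by (rule sum.union_disjoint[OF fin])
  have orth: "(\<Sum>i\<in>I. u j i * u k i) = (if j = k then 1 else 0)" if "j < p" "k < p" for j k
  proof -
    have "(\<Sum>i\<in>J. u j i * u k i) = (\<Sum>i\<in>J. noise_row n p \<eta> X j i * noise_row n p \<eta> X k i)"
      by (rule sum.cong) (auto simp: u_def nJ)
    then show ?thesis using ols_row_facts(2)[OF good n eta that] by (simp add: split u_def J_def)
  qed
  define Z where "Z g = (\<lambda>j\<in>{..<p}. \<Sum>i\<in>I. u j i * g i)" for g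
  have Zm: "Z \<in> gauss I \<rightarrow>\<^sub>M gauss {..<p}"
    unfolding Z_def by (rule measurable_restrict) (simp add: I_def)
  have stat: "ols_stat n p \<eta> X (\<lambda>i\<in>{..<n}. matvec X p \<beta> i + e i) \<xi> j = Z (merge {..<n} J (e, \<xi>)) j + \<theta> j"
    if j: "j < p" for e \<xi> j
  proof -
    have "(\<Sum>i<n. ols_row n p \<eta> X j i * matvec X p \<beta> i) = (\<Sum>i<n. \<Sum>k<p. \<beta> k * (ols_row n p \<eta> X j i * X i k))"
      by (simp add: matvec_def sum_distrib_left mult_ac)
    also have "\<dots> = (\<Sum>k<p. \<Sum>i<n. \<beta> k * (ols_row n p \<eta> X j i * X i k))" by (rule sum.swap)
    also have "\<dots> = (\<Sum>k<p. \<beta> k * (\<Sum>i<n. ols_row n p \<eta> X j i * X i k))" by (simp add: sum_distrib_left)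
    also have "\<dots> = (\<Sum>k<p. (\<beta> k * sqrt (n * (1 - \<eta>))) * (if j = k then 1 else 0))"
      by (intro sum.cong refl) (use ols_row_facts(1)[OF good n eta j] in auto)
    also have "\<dots> = \<theta> j" by (subst sum_mult_delta(1)[OF j]) (simp add: \<theta>_def mult.commute)
    finally have 1: "(\<Sum>i<n. ols_row n p \<eta> X j i * matvec X p \<beta> i) = \<theta> j" .
    have 2: "(\<Sum>i<n. u j i * merge {..<n} J (e, \<xi>) i) = (\<Sum>i<n. ols_row n p \<eta> X j i * e i)"
      by (rule sum.cong) (auto simp: u_def merge_def)
    have 3: "(\<Sum>i\<in>J. u j i * merge {..<n} J (e, \<xi>) i) = (\<Sum>i\<in>J. noise_row n p \<eta> X j i * \<xi> i)"
      by (rule sum.cong) (auto simp: u_def merge_def nJ)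
    have "(\<Sum>i<n. ols_row n p \<eta> X j i * (\<lambda>i\<in>{..<n}. matvec X p \<beta> i + e i) i)
        = (\<Sum>i<n. ols_row n p \<eta> X j i * matvec X p \<beta> i) + (\<Sum>i<n. ols_row n p \<eta> X j i * e i)"
      by (simp add: distrib_left sum.distrib)
    then show ?thesis using j by (simp add: ols_stat_def Z_def split 1 2 3 flip: J_def)
  qed
  define f where "f z = \<phi> (exceed_count p t (\<lambda>j. z j + \<theta> j))" for z
  have fm: "f \<in> borel_measurable (gauss {..<p})"
  proof -
    have "(\<lambda>z. z j + \<theta> j) \<in> borel_measurable (gauss {..<p})" if "j < p" for j
    proof -
      have "(\<lambda>z. z j) \<in> gauss {..<p} \<rightarrow>\<^sub>M std_gauss"
        by (rule measurable_component_singleton) (use that in simp)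
      then have "(\<lambda>z. z j) \<in> borel_measurable (gauss {..<p})"
        by (simp only: measurable_cong_sets[OF refl sets_std_gauss])
      then show ?thesis by (intro borel_measurable_add borel_measurable_const)
    qed
    then show ?thesis unfolding f_def by (intro measurable_compose[OF exceed_count_measurable]) auto
  qed
  have fint: "integrable (gauss I) (\<lambda>g. f (Z g))"
  proof -
    interpret prob_space "gauss I" by (rule prob_space_gauss)
    show ?thesis
      by (rule integrable_const_bound[where B=1]) (use \<phi> measurable_compose[OF Zm fm] in \<open>auto simp: f_def\<close>)
  qed
  have ec: "exceed_count p t z = exceed_count p t z'" if "\<And>j. j < p \<Longrightarrow> z j = z' j" for z z'
    unfolding exceed_count_def by (rule sum.cong) (use that in auto)
  have "gauss_mean n (\<lambda>y. count_test n p \<eta> t \<phi> (y, X)) (matvec X p \<beta>)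
      = (\<integral>e. \<integral>\<xi>. f (Z (merge {..<n} J (e, \<xi>))) \<partial>gauss J \<partial>gauss {..<n})"
    unfolding gauss_mean_def count_test_def f_def using good
    by (intro Bochner_Integration.integral_cong refl)
       (auto simp: J_def[symmetric] intro!: Bochner_Integration.integral_cong arg_cong[where f=\<phi>] ec stat)
  also have "\<dots> = (\<integral>g. f (Z g) \<partial>gauss I)"
    using gauss.product_integral_fold[OF fin(3,1,2), of "\<lambda>g. f (Z g)"] fint by (simp add: I_def)
  also have "\<dots> = (\<integral>z. f z \<partial>distr (gauss I) (gauss {..<p}) Z)"
    by (rule integral_distr[OF Zm fm, symmetric])
  also have "distr (gauss I) (gauss {..<p}) Z = gauss {..<p}"
    unfolding Z_def by (rule gauss_orthonormal_distr[OF finI orth])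
  also have "(\<integral>z. f z \<partial>gauss {..<p}) = bern_expect p (\<lambda>j. measure std_gauss {x. \<bar>x + \<theta> j\<bar> > t}) \<phi>"
    unfolding f_def exceed_count_def
    by (rule gauss_integral_count[where B=1 and P="\<lambda>j x. \<bar>x + \<theta> j\<bar> > t"]) (use \<phi> in auto)
  finally show ?thesis by (simp add: \<theta>_def)
qed

section \<open>Upper bound on the minimax risk\<close>

lemma std_gauss_upper_tail_le:
  assumes "0 \<le> a"
  shows "measure std_gauss {x. x > a} \<le> exp (- a\<^sup>2 / 2)"
proof -
  interpret prob_space std_gauss by (rule prob_space_std_gauss)
  have "measure std_gauss {x. x > a} \<le> measure std_gauss {x \<in> space std_gauss. exp (a * x) \<ge> exp (a\<^sup>2)}"
    by (rule finite_measure_mono) (use assms in \<open>auto simp: power2_eq_square mult_left_mono\<close>)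
  also have "\<dots> \<le> (\<integral>x. exp (a * x) \<partial>std_gauss) / exp (a\<^sup>2)"
    by (rule integral_Markov_inequality_measure[OF std_gauss_exp_moment(1), of "{}"]) auto
  also have "\<dots> = exp (- a\<^sup>2 / 2)"
    by (simp add: std_gauss_exp_moment(2) exp_diff[symmetric])
  finally show ?thesis .
qed

text \<open>On \<open>{a..a + 1}\<close> the density is at least its value at \<open>a + 1\<close>.
  Against the upper bound this loses \<open>exp (a + 1 / 2)\<close> and a constant, which is
  subpolynomial in p when \<open>a\<close> is of order sqrt (log p).\<close>

lemma std_gauss_upper_tail_ge:
  assumes "0 \<le> a"
  shows "exp (- (a + 1)\<^sup>2 / 2) / sqrt (2 * pi) \<le> measure std_gauss {x. x > a}"
proof -
  interpret prob_space std_gauss by (rule prob_space_std_gauss)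
  define c where "c = exp (- (a + 1)\<^sup>2 / 2) / sqrt (2 * pi)"
  have c: "c \<ge> 0" by (simp add: c_def)
  have "ennreal c = (\<integral>\<^sup>+x. ennreal c * indicator {a..a + 1} x \<partial>lborel)"
    by (simp add: nn_integral_cmult_indicator)
  also have "\<dots> \<le> (\<integral>\<^sup>+x. ennreal (std_normal_density x) * indicator {x. x \<ge> a} x \<partial>lborel)"
  proof (rule nn_integral_mono)
    fix x
    have "c \<le> std_normal_density x" if "a \<le> x" "x \<le> a + 1"
    proof -
      have "x\<^sup>2 \<le> (a + 1)\<^sup>2" using that assms by (intro power_mono) auto
      then show ?thesis by (simp add: c_def std_normal_density_def divide_right_mono)
    qed
    then show "ennreal c * indicator {a..a + 1} x \<le> ennreal (std_normal_density x) * indicator {x. x \<ge> a} x"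
      by (auto simp: indicator_def intro: ennreal_leI)
  qed
  also have "\<dots> = (\<integral>\<^sup>+x. ennreal (std_normal_density x) * indicator {x. x > a} x \<partial>lborel)"
  proof (rule nn_integral_cong_AE)
    have "AE x in lborel. x \<noteq> a" by (rule AE_lborel_singleton)
    then show "AE x in lborel. ennreal (std_normal_density x) * indicator {x. x \<ge> a} x
        = ennreal (std_normal_density x) * indicator {x. x > a} x"
      by eventually_elim (auto simp: indicator_def)
  qed
  also have "\<dots> = emeasure std_gauss {x. x > a}"
    unfolding std_gauss_def by (subst emeasure_density) auto
  finally show ?thesis by (simp add: emeasure_eq_measure c_def)
qed

lemma std_gauss_lower_tail: "measure std_gauss {x. x < - a} = measure std_gauss {x. x > a}"
proof -
  interpret prob_space std_gauss by (rule prob_space_std_gauss)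
  have "emeasure std_gauss {x. x < - a} = (\<integral>\<^sup>+x. indicator {x. x < - a} x \<partial>std_gauss)" by simp
  also have "\<dots> = (\<integral>\<^sup>+x. indicator {x. x < - a} (- x) \<partial>std_gauss)"
    by (rule nn_integral_std_gauss_uminus[symmetric]) simp
  also have "\<dots> = (\<integral>\<^sup>+x. indicator {x. x > a} x \<partial>std_gauss)"
    by (intro nn_integral_cong) (auto simp: indicator_def)
  also have "\<dots> = emeasure std_gauss {x. x > a}" by simp
  finally show ?thesis by (simp add: emeasure_eq_measure)
qed

lemma std_gauss_two_sided_le:
  assumes "0 \<le> t"
  shows "measure std_gauss {x. \<bar>x\<bar> > t} \<le> 2 * exp (- t\<^sup>2 / 2)"
proof -
  have "{x. \<bar>x\<bar> > t} = {x. x > t} \<union> {x. x < - t}" by auto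
  then have "measure std_gauss {x. \<bar>x\<bar> > t} \<le> measure std_gauss {x. x > t} + measure std_gauss {x. x < - t}"
    by (simp only:) (rule measure_Un_le; simp)
  then show ?thesis using std_gauss_upper_tail_le[OF assms] by (simp add: std_gauss_lower_tail)
qed

text \<open>The sign of the signal is unknown, so only the tail on the side of the signal is kept;
  symmetry makes both cases equal.\<close>

lemma std_gauss_shifted_tail_ge:
  assumes "\<mu> \<le> \<bar>\<theta>\<bar>" "0 \<le> \<mu>"
  shows "measure std_gauss {x. x > t - \<mu>} \<le> measure std_gauss {x. \<bar>x + \<theta>\<bar> > t}"
proof -
  interpret prob_space std_gauss by (rule prob_space_std_gauss)
  show ?thesis
  proof (cases "\<theta> \<ge> 0")
    case True
    then show ?thesis by (intro finite_measure_mono) (use assms in auto)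
  next
    case False
    have "measure std_gauss {x. x < - (t - \<mu>)} \<le> measure std_gauss {x. \<bar>x + \<theta>\<bar> > t}"
      by (rule finite_measure_mono) (use False assms in auto)
    then show ?thesis by (simp only: std_gauss_lower_tail)
  qed
qed

text \<open>The test vanishes on bad designs, so its rejection probabilities under the null and
  under the alternative carry the same factor, the probability of a good design; hence so does the
  advantage.\<close>

lemma count_test_risk:
  fixes \<eta> adv B0 :: real
  assumes mu: "prob_space \<mu>" "sets \<mu> = sets (Xspace n p)"
    and n: "0 < n" and eta: "0 \<le> \<eta>" "\<eta> \<le> 1"
    and \<phi>: "\<And>w. 0 \<le> \<phi> w \<and> \<phi> w \<le> 1" and ne: "Xi p s A \<noteq> {}"
    and B0: "bern_expect p (\<lambda>_. measure std_gauss {x. \<bar>x\<bar> > t}) \<phi> = B0"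
    and B1: "\<And>\<beta>. \<beta> \<in> Xi p s A \<Longrightarrow>
        bern_expect p (\<lambda>j. measure std_gauss {x. \<bar>x + sqrt (n * (1 - \<eta>)) * \<beta> j\<bar> > t}) \<phi> \<ge> B0 + adv"
  shows "risk_test n p \<mu> (count_test n p \<eta> t \<phi>) s A
      \<le> 1 - adv * (1 - measure \<mu> {X \<in> space \<mu>. \<not> good_design n p (\<eta> / 2 / p) X})"
proof -
  interpret m: prob_space \<mu> by (rule mu)
  let ?T = "count_test n p \<eta> t \<phi>"
  define G where "G = {X \<in> space \<mu>. good_design n p (\<eta> / 2 / p) X}"
  have Gm: "G \<in> sets \<mu>" unfolding G_def by (rule good_design_event[OF mu])
  have T: "is_test n p ?T" by (rule count_test_is_test[OF \<phi>])
  define B where "B \<beta> = bern_expect p (\<lambda>j. measure std_gauss {x. \<bar>x + sqrt (n * (1 - \<eta>)) * \<beta> j\<bar> > t}) \<phi>" for \<beta>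
  have E: "(\<integral>X. gauss_mean n (\<lambda>y. ?T (y, X)) (matvec X p \<beta>) \<partial>\<mu>) = B \<beta> * measure \<mu> G" for \<beta>
  proof -
    have "(\<integral>X. gauss_mean n (\<lambda>y. ?T (y, X)) (matvec X p \<beta>) \<partial>\<mu>) = (\<integral>X. B \<beta> * indicator G X \<partial>\<mu>)"
    proof (rule Bochner_Integration.integral_cong)
      fix X assume X: "X \<in> space \<mu>"
      show "gauss_mean n (\<lambda>y. ?T (y, X)) (matvec X p \<beta>) = B \<beta> * indicator G X"
      proof (cases "good_design n p (\<eta> / 2 / p) X")
        case True
        then show ?thesis using X count_test_mean[OF True n eta \<phi>, where t=t and \<beta>=\<beta>] by (simp add: G_def B_def)
      next
        case False
        then show ?thesis by (simp add: gauss_mean_def count_test_def G_def)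
      qed
    qed simp
    then show ?thesis using Gm by simp
  qed
  have "{X \<in> space \<mu>. \<not> good_design n p (\<eta> / 2 / p) X} = space \<mu> - G" by (auto simp: G_def)
  then have G1: "measure \<mu> G = 1 - measure \<mu> {X \<in> space \<mu>. \<not> good_design n p (\<eta> / 2 / p) X}"
    using m.prob_compl[OF Gm] by simp
  have 0: "(\<integral>z. ?T z \<partial>data_law n p \<mu> (\<lambda>_. 0)) = B0 * measure \<mu> G"
    unfolding data_law_integral(1)[OF mu T] E B_def using B0 by simp
  have "(SUP \<beta>\<in>Xi p s A. \<integral>z. 1 - ?T z \<partial>data_law n p \<mu> \<beta>) \<le> 1 - (B0 + adv) * measure \<mu> G"
  proof (rule cSUP_least[OF ne])
    fix \<beta> assume "\<beta> \<in> Xi p s A"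
    then have "(B0 + adv) * measure \<mu> G \<le> B \<beta> * measure \<mu> G"
      using B1 by (intro mult_right_mono) (auto simp: B_def)
    then show "(\<integral>z. 1 - ?T z \<partial>data_law n p \<mu> \<beta>) \<le> 1 - (B0 + adv) * measure \<mu> G"
      unfolding data_law_integral(3)[OF mu T] E by simp
  qed
  then have "risk_test n p \<mu> ?T s A \<le> 1 - adv * measure \<mu> G"
    unfolding risk_test_def 0 by (simp add: algebra_simps)
  then show ?thesis by (simp only: G1)
qed

lemma minimax_risk_upper_bound:
  fixes \<eta> A t :: real
  assumes mu: "prob_space \<mu>" "sets \<mu> = sets (Xspace n p)"
    and n: "0 < n" and eta: "0 \<le> \<eta>" "\<eta> \<le> 1" and s: "0 < s" "s \<le> p" and A: "0 < A"
  defines "\<pi>0 \<equiv> measure std_gauss {x. \<bar>x\<bar> > t}"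
    and "\<pi>1 \<equiv> measure std_gauss {x. x > t - sqrt (n * (1 - \<eta>)) * A}"
  assumes le: "\<pi>0 \<le> \<pi>1"
  shows "minimax_risk n p \<mu> s A
    \<le> 1 - s * (\<pi>1 - \<pi>0) / (16 * (1 + sqrt (p * \<pi>0) + s * \<pi>1))
        * (1 - measure \<mu> {X \<in> space \<mu>. \<not> good_design n p (\<eta> / 2 / p) X})"
proof -
  interpret g: prob_space std_gauss by (rule prob_space_std_gauss)
  define K where "K = 8 * (1 + sqrt (p * \<pi>0) + s * \<pi>1)"
  define \<phi> where "\<phi> = clamp_test (p * \<pi>0) K"
  have \<phi>: "0 \<le> \<phi> w \<and> \<phi> w \<le> 1" for w by (simp add: \<phi>_def clamp_test_bounds)
  have pi: "0 \<le> \<pi>0" "\<pi>1 \<le> 1" by (simp_all add: \<pi>0_def \<pi>1_def)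
  \<comment> \<open>Blocks of length 1 give a member of \<open>Xi\<close>, so that the supremum
    ranges over a nonempty set.\<close>
  have "block_spikes s 1 A (\<lambda>k\<in>{..<s}. 0) \<in> Xi p s A"
    by (rule block_spikes_in_Xi) (use s A in auto)
  then have ne: "Xi p s A \<noteq> {}" by auto
  have adv: "bern_expect p (\<lambda>j. measure std_gauss {x. \<bar>x + sqrt (n * (1 - \<eta>)) * \<beta> j\<bar> > t}) \<phi>
      \<ge> bern_expect p (\<lambda>_. \<pi>0) \<phi> + s * (\<pi>1 - \<pi>0) / (2 * K)" if \<beta>: "\<beta> \<in> Xi p s A" for \<beta>
  proof -
    define S where "S = {j \<in> {..<p}. \<beta> j \<noteq> 0}"
    have S: "S \<subseteq> {..<p}" "card S = s" using \<beta> by (auto simp: S_def Xi_def)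
    have big: "sqrt (n * (1 - \<eta>)) * A \<le> \<bar>sqrt (n * (1 - \<eta>)) * \<beta> j\<bar>" if "j \<in> S" for j
      using \<beta> that eta by (auto simp: S_def Xi_def abs_mult intro!: mult_left_mono)
    show ?thesis
      unfolding S(2)[symmetric] \<phi>_def
    proof (rule bern_expect_advantage[OF S(1) pi(1) le pi(2)])
      show "measure std_gauss {x. \<bar>x + sqrt (n * (1 - \<eta>)) * \<beta> j\<bar> > t} = \<pi>0" if "j < p" "j \<notin> S" for j
        using that by (simp add: S_def \<pi>0_def)
      show "\<pi>1 \<le> measure std_gauss {x. \<bar>x + sqrt (n * (1 - \<eta>)) * \<beta> j\<bar> > t} \<and>
          measure std_gauss {x. \<bar>x + sqrt (n * (1 - \<eta>)) * \<beta> j\<bar> > t} \<le> 1" if "j \<in> S" for j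
        unfolding \<pi>1_def using std_gauss_shifted_tail_ge[OF big[OF that]] eta A by simp
    qed (simp add: K_def S(2))
  qed
  have "minimax_risk n p \<mu> s A \<le> risk_test n p \<mu> (count_test n p \<eta> t \<phi>) s A"
    by (rule minimax_risk_le[OF mu count_test_is_test[OF \<phi>] n s A])
  also have "\<dots> \<le> 1 - s * (\<pi>1 - \<pi>0) / (2 * K) * (1 - measure \<mu> {X \<in> space \<mu>. \<not> good_design n p (\<eta> / 2 / p) X})"
    by (rule count_test_risk[OF mu n eta \<phi> ne _ adv]) (simp_all add: \<pi>0_def)
  also have "2 * K = 16 * (1 + sqrt (p * \<pi>0) + s * \<pi>1)" by (simp add: K_def)
  finally show ?thesis .
qed

section \<open>Asymptotics\<close>

definition rate_exponent :: "real \<Rightarrow> real \<Rightarrow> real" where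
  "rate_exponent \<alpha> r = 1 / 2 - \<alpha> + r - (max 0 (2 * sqrt r - 1))\<^sup>2 / 2"

definition sparsity :: "real \<Rightarrow> nat \<Rightarrow> nat" where
  "sparsity \<alpha> p = nat (round (real p powr (1 - \<alpha>)))"

text \<open>Rounding moves a number that is at least 1 by at most 1/2, and taking the integer part
  of a quotient that is at least 1 loses at most a factor 2. The 4 in the last bound combines the
  latter with \<open>s \<le> 2 * p powr (1 - \<alpha>)\<close>.\<close>

lemma sparsity_bounds:
  assumes \<alpha>: "0 < \<alpha>" "\<alpha> < 1" and p: "1 \<le> p"
  defines "s \<equiv> sparsity \<alpha> p"
  shows "p powr (1 - \<alpha>) / 2 \<le> s" "s \<le> 2 * p powr (1 - \<alpha>)" "0 < s" "s \<le> p"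
    "0 < p div s" "p powr \<alpha> / 4 \<le> real (p div s)"
proof -
  define x where "x = p powr (1 - \<alpha>)"
  have x1: "1 \<le> x" using p \<alpha> by (simp add: x_def ge_one_powr_ge_zero)
  have xp: "x \<le> p"
  proof -
    have "x \<le> p powr 1" unfolding x_def using p \<alpha> by (intro powr_mono) auto
    then show ?thesis using p by simp
  qed
  have rnd: "\<bar>of_int (round x) - x\<bar> \<le> 1 / 2" by (rule of_int_round_abs_le)
  then have "(1::real) / 2 \<le> of_int (round x)" using x1 by linarith
  then have "0 < round x" by linarith
  then have s: "real s = of_int (round x)" by (simp add: s_def sparsity_def x_def)
  show 1: "p powr (1 - \<alpha>) / 2 \<le> s" and 2: "s \<le> 2 * p powr (1 - \<alpha>)"
    using rnd x1 s unfolding x_def[symmetric] by linarith+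
  show 3: "0 < s" using s \<open>0 < round x\<close> by linarith
  have "real s < real p + 1" using rnd xp s by linarith
  then show 4: "s \<le> p" by linarith
  show 5: "0 < p div s" using 3 4 by (simp add: div_greater_zero_iff)
  have "p div s + 1 > real p / s"
  proof -
    have "p < s * (p div s + 1)" using 3 by (metis add.commute dividend_less_times_div mult.commute mult_Suc_right plus_1_eq_Suc)
    then have "real p < real s * (real (p div s) + 1)" by (metis of_nat_1 of_nat_add of_nat_less_iff of_nat_mult)
    then show ?thesis using 3 by (simp add: pos_divide_less_eq mult.commute add.commute)
  qed
  then have "real p / (2 * s) \<le> real (p div s)" using 5 by (simp add: field_simps)
  moreover have "p powr \<alpha> / 4 \<le> real p / (2 * s)"
  proof -
    have "p powr \<alpha> * x = p" unfolding x_def using p by (simp add: powr_add[symmetric])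
    then have "real p / (2 * (2 * x)) = p powr \<alpha> / 4" using x1 by (simp add: field_simps)
    moreover have "real p / (2 * (2 * x)) \<le> real p / (2 * s)"
      using 2[folded x_def] 3 x1 by (intro divide_left_mono) (auto intro!: mult_pos_pos)
    ultimately show ?thesis by simp
  qed
  ultimately show "p powr \<alpha> / 4 \<le> real (p div s)" by linarith
qed

text \<open>The truncation loss \<open>s * \<tau>\<close> has exponent 1 - \<alpha> - (1 - sqrt
  \<rho>)^2, and the variance term \<open>s * v / m\<close> has exponent twice
  \<open>rate_exponent\<close>. The former exponent never exceeds \<open>rate_exponent\<close> and
  equals it once \<open>2 * sqrt \<rho> \<ge> 1\<close>, so the truncation level balances both
  errors in that regime.\<close>

lemma block_lr_min_integral_powr:
  fixes p :: nat and \<alpha> \<rho> :: real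
  assumes \<alpha>: "1 / 2 < \<alpha>" "\<alpha> < 1" and \<rho>: "0 < \<rho>" "\<rho> \<le> 1" and p: "1 \<le> p"
    and small: "8 * p powr (2 * rate_exponent \<alpha> \<rho>) \<le> 1"
  defines "s \<equiv> sparsity \<alpha> p"
  shows "1 - 5 * p powr rate_exponent \<alpha> \<rho>
    \<le> (\<integral>z. min 1 (block_lr s (p div s) (sqrt \<rho> * sqrt (2 * ln p)) z) \<partial>gauss {..<p})"
proof -
  define e where "e = rate_exponent \<alpha> \<rho>"
  define T where "T = sqrt (2 * ln p)"
  define M where "M = max 0 (2 * sqrt \<rho> - 1)"
  define m where "m = p div s"
  note sb = sparsity_bounds[of \<alpha> p, folded s_def, folded m_def]
  have l: "ln p \<ge> 0" using p by simp
  have T: "T \<ge> 0" "T\<^sup>2 = 2 * ln p" using l by (auto simp: T_def)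
  have sr: "sqrt \<rho> \<le> 1" "(sqrt \<rho>)\<^sup>2 = \<rho>" using \<rho> by auto
  have mt: "sqrt \<rho> * T \<le> T" using T sr by (intro mult_left_le_one_le) auto
  define \<tau> where "\<tau> = exp (- (T - sqrt \<rho> * T)\<^sup>2 / 2)"
  define v where "v = exp ((sqrt \<rho> * T)\<^sup>2 - (max 0 (2 * (sqrt \<rho> * T) - T))\<^sup>2 / 2)"
  have tau: "\<tau> = p powr (- (1 - sqrt \<rho>)\<^sup>2)"
  proof -
    have "(T - sqrt \<rho> * T)\<^sup>2 = T\<^sup>2 * (1 - sqrt \<rho>)\<^sup>2" by (simp add: power2_eq_square algebra_simps)
    then show ?thesis using p by (simp add: \<tau>_def T powr_def)
  qed
  have v: "v = p powr (2 * \<rho> - M\<^sup>2)"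
  proof -
    have "max 0 (2 * (sqrt \<rho> * T) - T) = T * M"
    proof (cases "2 * sqrt \<rho> \<le> 1")
      case True
      then have "2 * sqrt \<rho> * T \<le> 1 * T" using T by (intro mult_right_mono) auto
      then show ?thesis using True by (simp add: M_def)
    next
      case False
      then have "1 * T \<le> 2 * sqrt \<rho> * T" using T by (intro mult_right_mono) auto
      then show ?thesis using False by (simp add: M_def algebra_simps)
    qed
    then show ?thesis using p by (simp add: v_def power_mult_distrib T sr powr_def algebra_simps)
  qed
  have pp: "real p > 0" using p by simp
  have st: "s * \<tau> \<le> 2 * p powr e"
  proof -
    have "M\<^sup>2 \<le> (2 * sqrt \<rho> - 1)\<^sup>2" by (auto simp: M_def max_def)
    then have ex: "1 - \<alpha> - (1 - sqrt \<rho>)\<^sup>2 \<le> e"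
    proof -
      have "(1 - sqrt \<rho>)\<^sup>2 = 1 + \<rho> - 2 * sqrt \<rho>" "(2 * sqrt \<rho> - 1)\<^sup>2 = 4 * \<rho> + 1 - 4 * sqrt \<rho>"
        by (simp_all only: power2_diff power_mult_distrib sr(2)) simp_all
      then show ?thesis
        using \<open>M\<^sup>2 \<le> (2 * sqrt \<rho> - 1)\<^sup>2\<close> unfolding e_def rate_exponent_def M_def[symmetric] by linarith
    qed
    have "s * \<tau> \<le> 2 * p powr (1 - \<alpha>) * \<tau>" using sb \<alpha> p by (intro mult_right_mono) (auto simp: \<tau>_def)
    also have "\<dots> = 2 * p powr (1 - \<alpha> - (1 - sqrt \<rho>)\<^sup>2)" using pp by (simp add: tau powr_add[symmetric] mult.assoc)
    also have "\<dots> \<le> 2 * p powr e" using ex p by (intro mult_left_mono powr_mono) auto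
    finally show ?thesis .
  qed
  have sv: "s * v / m \<le> 8 * p powr (2 * e)"
  proof -
    have "s * v / m \<le> (2 * p powr (1 - \<alpha>) * v) / (p powr \<alpha> / 4)"
      using sb \<alpha> p pp by (intro frac_le mult_right_mono) (auto simp: v)
    also have "\<dots> = 8 * (p powr (1 - \<alpha>) * p powr (2 * \<rho> - M\<^sup>2) * p powr (- \<alpha>))"
      using pp by (simp add: v powr_minus field_simps)
    also have "\<dots> = 8 * p powr (2 * e)"
    proof -
      have "2 * e = (1 - \<alpha>) + (2 * \<rho> - M\<^sup>2) + (- \<alpha>)" by (simp add: e_def rate_exponent_def M_def)
      then show ?thesis by (simp only: powr_add)
    qed
    finally show ?thesis .
  qed
  have sm: "s * m \<le> p" by (simp add: m_def)
  have m0: "0 < m" using sb \<alpha> p by auto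
  have "s * v / m \<le> 1" using sv small by (simp add: e_def)
  from block_lr_min_integral[OF mt m0 sm, folded \<tau>_def v_def, OF this]
  have "1 - sqrt ((s * \<tau>)\<^sup>2 + 2 * (s * v / m)) \<le> (\<integral>z. min 1 (block_lr s m (sqrt \<rho> * T) z) \<partial>gauss {..<p})" .
  moreover have "sqrt ((s * \<tau>)\<^sup>2 + 2 * (s * v / m)) \<le> 5 * p powr e"
  proof (rule real_le_lsqrt)
    have "(s * \<tau>)\<^sup>2 \<le> (2 * p powr e)\<^sup>2" using st by (intro power_mono) (auto simp: \<tau>_def)
    then have 1: "(s * \<tau>)\<^sup>2 \<le> 4 * (p powr e)\<^sup>2" by (simp only: power_mult_distrib) simp
    have "p powr (2 * e) = (p powr e)\<^sup>2" by (simp add: power2_eq_square powr_add[symmetric])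
    \<comment> \<open>Here 20 is 2^2 + 2 * 8, and its square root is below 5.\<close>
    then have "(s * \<tau>)\<^sup>2 + 2 * (s * v / m) \<le> 20 * (p powr e)\<^sup>2" using 1 sv by linarith
    also have "\<dots> \<le> (5 * p powr e)\<^sup>2" by (simp add: power_mult_distrib)
    finally show "(s * \<tau>)\<^sup>2 + 2 * (s * v / m) \<le> (5 * p powr e)\<^sup>2" .
  qed auto
  ultimately show ?thesis by (simp add: e_def m_def T_def)
qed

text \<open>At threshold \<open>w * sqrt (2 * ln p)\<close> the exceedance probabilities are of
  order p^(-w^2) under the null and p^(-b) for a spike, with
  \<open>b = (w - sqrt \<rho>)\<^sup>2\<close>, up to subpolynomial factors. The ratio of s \<pi>1
  to sqrt (p \<pi>0) has exponent 1 - \<alpha> - b - (1 - w^2) / 2, maximal at w = 2 sqrt \<rho>;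
  the cap at 1 keeps the expected number of null exceedances from becoming polynomially
  small.\<close>

lemma tail_advantage_powr:
  fixes \<alpha> \<rho> \<epsilon> w :: real and \<pi>0 \<pi>1 :: "nat \<Rightarrow> real" and s :: "nat \<Rightarrow> nat"
  assumes \<alpha>: "1 / 2 < \<alpha>" "\<alpha> < 1" and \<rho>: "0 < \<rho>" "\<rho> < 1" and e: "rate_exponent \<alpha> \<rho> < 0" and eps: "0 < \<epsilon>"
  defines "w \<equiv> min 1 (2 * sqrt \<rho>)"
  defines "\<pi>0 \<equiv> \<lambda>p::nat. measure std_gauss {x. \<bar>x\<bar> > w * sqrt (2 * ln p)}"
    and "\<pi>1 \<equiv> \<lambda>p::nat. measure std_gauss {x. x > w * sqrt (2 * ln p) - sqrt \<rho> * sqrt (2 * ln p)}"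
    and "s \<equiv> sparsity \<alpha>"
  shows "eventually (\<lambda>p. \<pi>0 p \<le> \<pi>1 p \<and>
     p powr (rate_exponent \<alpha> \<rho> - \<epsilon>) / 320 \<le> s p * (\<pi>1 p - \<pi>0 p) / (16 * (1 + sqrt (p * \<pi>0 p) + s p * \<pi>1 p))) sequentially"
proof -
  define b where "b = (w - sqrt \<rho>)\<^sup>2"
  have sr: "0 < sqrt \<rho>" "sqrt \<rho> < 1" "(sqrt \<rho>)\<^sup>2 = \<rho>" using \<rho> by auto
  have w: "sqrt \<rho> \<le> w" "w \<le> 1" "0 < w" using sr by (auto simp: w_def)
  have ident: "1 - \<alpha> - b - (1 - w\<^sup>2) / 2 = rate_exponent \<alpha> \<rho>"
  proof (cases "2 * sqrt \<rho> \<le> 1")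
    case True
    then show ?thesis using sr(3) by (simp add: b_def w_def rate_exponent_def power2_eq_square field_simps)
  next
    case False
    then show ?thesis using sr(3) by (simp add: b_def w_def rate_exponent_def power2_eq_square field_simps)
  qed
  have qb: "b < w\<^sup>2"
  proof -
    have "0 < sqrt \<rho> * (2 * w - sqrt \<rho>)" using sr w by (intro mult_pos_pos) auto
    then show ?thesis by (simp add: b_def power2_eq_square algebra_simps)
  qed
  \<comment> \<open>Small enough to stay within \<open>\<epsilon>\<close>, and below
    \<open>w\<^sup>2 - b\<close>, so that even after this loss \<open>\<pi>1\<close> is at least
    twice \<open>\<pi>0\<close>.\<close>
  define \<delta> where "\<delta> = min \<epsilon> ((w\<^sup>2 - b) / 2)"
  have \<delta>: "0 < \<delta>" "\<delta> \<le> \<epsilon>" "0 < w\<^sup>2 - b - \<delta>" using eps qb by (auto simp: \<delta>_def min_def field_simps)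
  \<comment> \<open>Absorbs into p^\<delta> the factor lost in the lower bound on the Gaussian
    tail.\<close>
  have ev1: "eventually (\<lambda>p::nat. (w - sqrt \<rho>) * sqrt (2 * ln p) + (1 / 2 + ln (sqrt (2 * pi))) \<le> \<delta> * ln p) sequentially"
    using \<delta>(1) by real_asymp
  have ev2: "eventually (\<lambda>p::nat. 4 \<le> p powr (w\<^sup>2 - b - \<delta>)) sequentially"
    using \<delta>(3) by real_asymp
  show ?thesis
    using ev1 ev2 eventually_ge_at_top[of 1]
  proof eventually_elim
    case (elim p)
    define T where "T = sqrt (2 * ln p)"
    have T: "T \<ge> 0" "T\<^sup>2 = 2 * ln p" using elim(3) by (auto simp: T_def)
    have pp: "real p > 0" using elim(3) by simp
    note sb = sparsity_bounds[of \<alpha> p, folded s_def]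
    have sb': "p powr (1 - \<alpha>) / 2 \<le> s p" "s p \<le> 2 * p powr (1 - \<alpha>)" using sb \<alpha> elim(3) by auto
    define a where "a = w * T - sqrt \<rho> * T"
    have a0: "0 \<le> a" using w T by (simp add: a_def mult_right_mono)
    have a2: "a\<^sup>2 = 2 * ln p * b"
    proof -
      have "a\<^sup>2 = T\<^sup>2 * b" by (simp add: a_def b_def power2_eq_square algebra_simps)
      then show ?thesis by (simp add: T)
    qed
    have P0: "\<pi>0 p \<le> 2 * p powr (- w\<^sup>2)"
    proof -
      have "(w * T)\<^sup>2 / 2 = w\<^sup>2 * ln p" by (simp add: power_mult_distrib T)
      then show ?thesis
        using std_gauss_two_sided_le[of "w * T"] w T pp by (simp add: \<pi>0_def T_def[symmetric] powr_def)
    qed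
    have pi1: "\<pi>1 p = measure std_gauss {x. x > a}" by (simp only: \<pi>1_def a_def T_def)
    have P1: "\<pi>1 p \<le> p powr (- b)"
      using std_gauss_upper_tail_le[OF a0] pp by (simp add: pi1 a2 powr_def mult.commute)
    have P1': "p powr (- b - \<delta>) \<le> \<pi>1 p"
    proof -
      have "p powr (- b - \<delta>) = exp ((- b - \<delta>) * ln p)" using pp by (simp add: powr_def)
      also have "\<dots> \<le> exp (- (a + 1)\<^sup>2 / 2 - ln (sqrt (2 * pi)))"
      proof -
        have "a + (1 / 2 + ln (sqrt (2 * pi))) \<le> \<delta> * ln p"
          using elim(1) by (simp add: a_def T_def[symmetric] algebra_simps)
        moreover have "(a + 1)\<^sup>2 / 2 = b * ln p + a + 1 / 2"
          using a2 by (simp add: power2_eq_square algebra_simps)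
        ultimately show ?thesis by (simp add: algebra_simps)
      qed
      also have "\<dots> = exp (- (a + 1)\<^sup>2 / 2) / sqrt (2 * pi)" by (simp add: exp_diff)
      also have "\<dots> \<le> \<pi>1 p" using std_gauss_upper_tail_ge[OF a0] by (simp add: pi1)
      finally show ?thesis .
    qed
    have half: "\<pi>0 p \<le> p powr (- b - \<delta>) / 2"
    proof -
      have "4 * p powr (- w\<^sup>2) \<le> p powr (w\<^sup>2 - b - \<delta>) * p powr (- w\<^sup>2)"
        using elim(2) by (intro mult_right_mono) auto
      also have "\<dots> = p powr (- b - \<delta>)" by (simp add: powr_add[symmetric])
      finally show ?thesis using P0 by simp
    qed
    have nn: "0 \<le> \<pi>0 p" "0 \<le> \<pi>1 p" by (simp_all add: \<pi>0_def \<pi>1_def)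
    define h where "h = p powr ((1 - w\<^sup>2) / 2)"
    have h1: "1 \<le> h" unfolding h_def using elim(3) w by (intro ge_one_powr_ge_zero) (auto simp: power_le_one)
    have D1: "sqrt (p * \<pi>0 p) \<le> 2 * h"
    proof (rule real_le_lsqrt)
      have "p * \<pi>0 p \<le> p powr 1 * (2 * p powr (- w\<^sup>2))" using P0 pp by (intro mult_mono) (auto simp: nn)
      also have "\<dots> = 2 * p powr (1 + - w\<^sup>2)" by (simp only: powr_add mult.left_commute)
      also have "1 + - w\<^sup>2 = 1 - w\<^sup>2" by simp
      also have "p powr (1 - w\<^sup>2) = h\<^sup>2" by (simp add: h_def power2_eq_square powr_add[symmetric])
      finally show "p * \<pi>0 p \<le> (2 * h)\<^sup>2"
        by (simp add: power_mult_distrib) (use zero_le_power2[of h] in linarith)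
    qed (use h1 nn in auto)
    \<comment> \<open>A negative \<open>rate_exponent\<close> means that the expected number of
      exceedances due to spikes stays below the order \<open>h\<close> of the null fluctuations, so
      the latter determine the width of the ramp.\<close>
    have D2: "s p * \<pi>1 p \<le> 2 * h"
    proof -
      have "s p * \<pi>1 p \<le> (2 * p powr (1 - \<alpha>)) * p powr (- b)"
        using sb' P1 nn by (intro mult_mono) auto
      also have "\<dots> = 2 * p powr (rate_exponent \<alpha> \<rho> + (1 - w\<^sup>2) / 2)"
        unfolding ident[symmetric] by (simp add: powr_add[symmetric])
      also have "\<dots> \<le> 2 * h"
      proof -
        have "rate_exponent \<alpha> \<rho> + (1 - w\<^sup>2) / 2 \<le> (1 - w\<^sup>2) / 2" using e by linarith
        then show ?thesis unfolding h_def using elim(3) by (intro mult_left_mono powr_mono) auto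
      qed
      finally show ?thesis .
    qed
    \<comment> \<open>From 1 + 2h + 2h \<le> 5h. Together with the two halves in \<open>num\<close>
      this makes the constant 320.\<close>
    have den: "16 * (1 + sqrt (p * \<pi>0 p) + s p * \<pi>1 p) \<le> 80 * h" using D1 D2 h1 by simp
    have den0: "0 < 16 * (1 + sqrt (p * \<pi>0 p) + s p * \<pi>1 p)"
      using nn by (intro mult_pos_pos add_pos_nonneg) auto
    have num: "p powr (1 - \<alpha>) / 2 * (p powr (- b - \<delta>) / 2) \<le> s p * (\<pi>1 p - \<pi>0 p)"
      using sb' half P1' by (intro mult_mono) auto
    have "p powr (rate_exponent \<alpha> \<rho> - \<epsilon>) / 320 \<le> p powr (rate_exponent \<alpha> \<rho> - \<delta>) / 320"
      using \<delta> elim(3) by (intro divide_right_mono powr_mono) auto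
    also have "\<dots> = (p powr (1 - \<alpha>) / 2 * (p powr (- b - \<delta>) / 2)) / (80 * h)"
    proof -
      have "p powr (rate_exponent \<alpha> \<rho> - \<delta>) * h = p powr (1 - \<alpha>) * p powr (- b - \<delta>)"
        unfolding h_def ident[symmetric] powr_add[symmetric]
        by (rule arg_cong[where f="\<lambda>x. real p powr x"]) simp
      then show ?thesis using h1 by (simp add: field_simps)
    qed
    also have "\<dots> \<le> s p * (\<pi>1 p - \<pi>0 p) / (16 * (1 + sqrt (p * \<pi>0 p) + s p * \<pi>1 p))"
    proof -
      have "0 \<le> s p * (\<pi>1 p - \<pi>0 p)" by (rule order_trans[OF _ num]) simp
      then show ?thesis by (rule frac_le[OF _ num den0 den])
    qed
    finally show ?case using half P1' nn by simp
  qed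
qed

lemma const_less_mult_ln:
  fixes c d :: real
  assumes "0 < d"
  shows "eventually (\<lambda>p::nat. c < d * ln p) sequentially"
  using assms by real_asymp

lemma near_value_bounds:
  fixes a x y :: real
  assumes "a < x" "\<bar>y - x\<bar> < min (- x) ((x - a) / 2)"
  shows "y < 0" "a < y - (x - a) / 4"
proof -
  have 1: "\<bar>y - x\<bar> < - x" and 2: "\<bar>y - x\<bar> < (x - a) / 2" using assms(2) by simp_all
  show "y < 0" using 1 by linarith
  show "a < y - (x - a) / 4" using 2 assms(1) by argo
qed

lemma rate_exponent_isCont: "isCont (rate_exponent \<alpha>) r"
  unfolding rate_exponent_def by (intro continuous_intros) auto

section \<open>The limit for any design sequence whose bad designs are rarer than every power of
  \<open>p\<close>\<close>

context
  fixes \<alpha> r :: real and n :: "nat \<Rightarrow> nat" and \<mu> :: "nat \<Rightarrow> (nat \<Rightarrow> nat \<Rightarrow> real) measure"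
  assumes \<alpha>: "1 / 2 < \<alpha>" "\<alpha> < 1" and r: "0 < r" "r < 1" and e: "rate_exponent \<alpha> r < 0"
    and mu: "\<And>p. prob_space (\<mu> p)" "\<And>p. sets (\<mu> p) = sets (Xspace (n p) p)"
    and npos: "eventually (\<lambda>p. 0 < n p) sequentially"
    and conc: "\<And>\<kappa> M. 0 < \<kappa> \<Longrightarrow> eventually (\<lambda>p. measure (\<mu> p) {X \<in> space (\<mu> p). \<not> good_design (n p) p (\<kappa> / p) X} \<le> p powr (- M)) sequentially"
begin

definition amplitude :: "nat \<Rightarrow> real" where
  "amplitude p = sqrt (2 * r * ln p / n p)"

definition risk_gap :: "nat \<Rightarrow> real" where
  "risk_gap p = 1 - minimax_risk (n p) p (\<mu> p) (sparsity \<alpha> p) (amplitude p)"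

lemma amplitude_pos: "2 \<le> p \<Longrightarrow> 0 < n p \<Longrightarrow> 0 < amplitude p"
  using r by (simp add: amplitude_def)

lemma amplitude_rescale:
  assumes "2 \<le> p" "0 < n p" "0 < \<rho>"
  shows "sqrt (n p * (\<rho> / r)) * amplitude p = sqrt \<rho> * sqrt (2 * ln p)"
proof -
  have "sqrt (n p * (\<rho> / r)) * amplitude p = sqrt (n p * (\<rho> / r) * (2 * r * ln p / n p))"
    by (simp only: amplitude_def real_sqrt_mult[symmetric])
  also have "n p * (\<rho> / r) * (2 * r * ln p / n p) = \<rho> * (2 * ln p)" using assms r by simp
  finally show ?thesis by (simp only: real_sqrt_mult)
qed

text \<open>\<open>\<eta>\<close> is chosen so that completing the design replaces \<open>r\<close>
  by exactly \<open>\<rho>\<close>. Bad designs are required to be rarer than the target itself,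
  which raises the constant from 5 to 6.\<close>

lemma risk_gap_upper:
  assumes \<rho>: "r < \<rho>" "\<rho> < 1" and e\<rho>: "rate_exponent \<alpha> \<rho> < 0"
  shows "eventually (\<lambda>p. risk_gap p \<le> 6 * p powr rate_exponent \<alpha> \<rho>) sequentially"
proof -
  define \<eta> where "\<eta> = \<rho> / r - 1"
  have eta: "0 < \<eta>" "1 + \<eta> = \<rho> / r" using \<rho> r by (auto simp: \<eta>_def field_simps)
  have ev: "eventually (\<lambda>p::nat. 8 * p powr (2 * rate_exponent \<alpha> \<rho>) \<le> 1) sequentially"
  proof -
    define c where "c = - rate_exponent \<alpha> \<rho>"
    have "0 < c" using e\<rho> by (simp add: c_def)
    then have "eventually (\<lambda>p::nat. 8 * p powr (2 * - c) \<le> 1) sequentially" by real_asymp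
    then show ?thesis by (simp add: c_def)
  qed
  show ?thesis
    using ev npos conc[OF eta(1), of "- rate_exponent \<alpha> \<rho>"] eventually_ge_at_top[of 2]
  proof eventually_elim
    case (elim p)
    have sm: "sparsity \<alpha> p * (p div sparsity \<alpha> p) \<le> p" by simp
    have m0: "0 < p div sparsity \<alpha> p" by (rule sparsity_bounds(5)) (use \<alpha> elim(4) in auto)
    have \<rho>0: "0 < \<rho>" using \<rho> r by simp
    have A: "sqrt (n p * (1 + \<eta>)) * amplitude p = sqrt \<rho> * sqrt (2 * ln p)"
      unfolding eta(2) by (rule amplitude_rescale[OF elim(4,2) \<rho>0])
    have "1 - 5 * p powr rate_exponent \<alpha> \<rho>
       \<le> (\<integral>z. min 1 (block_lr (sparsity \<alpha> p) (p div sparsity \<alpha> p) (sqrt (n p * (1 + \<eta>)) * amplitude p) z) \<partial>gauss {..<p})"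
      unfolding A by (rule block_lr_min_integral_powr) (use \<alpha> \<rho> \<rho>0 elim(1,4) in auto)
    moreover have "(\<integral>z. min 1 (block_lr (sparsity \<alpha> p) (p div sparsity \<alpha> p) (sqrt (n p * (1 + \<eta>)) * amplitude p) z) \<partial>gauss {..<p})
       - measure (\<mu> p) {X \<in> space (\<mu> p). \<not> good_design (n p) p (\<eta> / p) X} \<le> 1 - risk_gap p"
      unfolding risk_gap_def
      using minimax_risk_lower_bound[OF mu(1) mu(2), of p \<eta> "sparsity \<alpha> p" "p div sparsity \<alpha> p" "amplitude p"]
        elim(2) eta(1) sm m0 amplitude_pos[OF elim(4,2)] by simp
    ultimately show ?case using elim(3) by simp
  qed
qed

text \<open>Here \<open>1 - \<eta> = \<rho> / r\<close>. On this side bad designs only multiply the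
  advantage by their complementary probability, so it is enough that they have probability at most
  1/2; this turns 320 into 640.\<close>

lemma risk_gap_lower:
  assumes \<rho>: "0 < \<rho>" "\<rho> < r" and e\<rho>: "rate_exponent \<alpha> \<rho> < 0" and \<epsilon>: "0 < \<epsilon>"
  shows "eventually (\<lambda>p. p powr (rate_exponent \<alpha> \<rho> - \<epsilon>) / 640 \<le> risk_gap p) sequentially"
proof -
  define \<eta> where "\<eta> = 1 - \<rho> / r"
  have eta: "0 < \<eta>" "\<eta> \<le> 1" "1 - \<eta> = \<rho> / r" using \<rho> r by (auto simp: \<eta>_def field_simps)
  have \<rho>1: "\<rho> < 1" using \<rho> r by simp
  have ev: "eventually (\<lambda>p::nat. p powr (- 1) \<le> 1 / 2) sequentially" by real_asymp
  have bad: "eventually (\<lambda>p. measure (\<mu> p) {X \<in> space (\<mu> p). \<not> good_design (n p) p (\<eta> / 2 / p) X} \<le> p powr (- 1)) sequentially"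
    by (rule conc) (use eta in simp)
  define t where "t p = min 1 (2 * sqrt \<rho>) * sqrt (2 * ln p)" for p :: nat
  define \<pi>0 where "\<pi>0 p = measure std_gauss {x. \<bar>x\<bar> > t p}" for p
  define \<pi>1 where "\<pi>1 p = measure std_gauss {x. x > t p - sqrt \<rho> * sqrt (2 * ln p)}" for p :: nat
  define adv where "adv p = sparsity \<alpha> p * (\<pi>1 p - \<pi>0 p) / (16 * (1 + sqrt (p * \<pi>0 p) + sparsity \<alpha> p * \<pi>1 p))" for p
  have tail: "eventually (\<lambda>p. \<pi>0 p \<le> \<pi>1 p \<and> p powr (rate_exponent \<alpha> \<rho> - \<epsilon>) / 320 \<le> adv p) sequentially"
    unfolding adv_def \<pi>0_def \<pi>1_def t_def by (rule tail_advantage_powr[OF \<alpha> \<rho>(1) \<rho>1 e\<rho> \<epsilon>])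
  show ?thesis
    using ev npos bad tail eventually_ge_at_top[of 2]
  proof eventually_elim
    case (elim p)
    have A: "sqrt (n p * (1 - \<eta>)) * amplitude p = sqrt \<rho> * sqrt (2 * ln p)"
      unfolding eta(3) by (rule amplitude_rescale[OF elim(5,2) \<rho>(1)])
    have le: "\<pi>0 p \<le> \<pi>1 p" and adv: "p powr (rate_exponent \<alpha> \<rho> - \<epsilon>) / 320 \<le> adv p"
      using elim(4) by auto
    have s: "0 < sparsity \<alpha> p" "sparsity \<alpha> p \<le> p"
      by (rule sparsity_bounds(3,4); use \<alpha> elim(5) in simp)+
    define B where "B = measure (\<mu> p) {X \<in> space (\<mu> p). \<not> good_design (n p) p (\<eta> / 2 / p) X}"
    have B: "B \<le> 1 / 2" using elim(1,3) eta by (simp add: B_def)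
    have adv0: "0 \<le> adv p" by (rule order_trans[OF _ adv]) simp
    have "minimax_risk (n p) p (\<mu> p) (sparsity \<alpha> p) (amplitude p) \<le> 1 - adv p * (1 - B)"
      unfolding adv_def B_def \<pi>0_def \<pi>1_def A[symmetric]
    proof (rule minimax_risk_upper_bound[OF mu(1) mu(2)])
      show "measure std_gauss {x. \<bar>x\<bar> > t p} \<le> measure std_gauss {x. x > t p - sqrt (n p * (1 - \<eta>)) * amplitude p}"
        using le unfolding \<pi>0_def \<pi>1_def A .
    qed (use s eta elim(2,5) amplitude_pos[of p] in auto)
    then have "adv p * (1 - B) \<le> risk_gap p" by (simp add: risk_gap_def)
    moreover have "adv p * (1 / 2) \<le> adv p * (1 - B)" using adv0 B by (intro mult_left_mono) auto
    ultimately show ?case using adv by linarith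
  qed
qed

lemma rate_eq: "rate n \<mu> \<alpha> r p = ln (risk_gap p) / ln p"
  by (simp add: rate_def risk_gap_def sparsity_def amplitude_def)

text \<open>A sandwich with \<open>\<rho>\<close> slightly below or slightly above \<open>r\<close>.
  Continuity keeps \<open>rate_exponent\<close> at \<open>\<rho>\<close> negative and close to its
  value at \<open>r\<close>, and division by \<open>ln p\<close> removes the constants.\<close>

lemma rate_tendsto: "(rate n \<mu> \<alpha> r \<longlongrightarrow> rate_exponent \<alpha> r) sequentially"
proof (rule order_tendstoI)
  have cont: "\<exists>d>0. \<forall>x. \<bar>x - r\<bar> < d \<longrightarrow> \<bar>rate_exponent \<alpha> x - rate_exponent \<alpha> r\<bar> < c" if "c > 0" for c
    using continuous_at_eps_delta[THEN iffD1, OF rate_exponent_isCont[where \<alpha>=\<alpha> and r=r], rule_format, OF that]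
    by (simp add: dist_real_def)
  have lower: "\<exists>\<rho> \<epsilon>. 0 < \<rho> \<and> \<rho> < r \<and> rate_exponent \<alpha> \<rho> < 0 \<and> 0 < \<epsilon> \<and> a < rate_exponent \<alpha> \<rho> - \<epsilon>"
    if a: "a < rate_exponent \<alpha> r" for a
  proof -
    define c where "c = min (- rate_exponent \<alpha> r) ((rate_exponent \<alpha> r - a) / 2)"
    have "c > 0" using a e by (simp add: c_def)
    then obtain d where d: "d > 0" "\<And>x. \<bar>x - r\<bar> < d \<Longrightarrow> \<bar>rate_exponent \<alpha> x - rate_exponent \<alpha> r\<bar> < c"
      using cont by blast
    define \<rho> where "\<rho> = r - min d r / 2"
    have \<rho>: "0 < \<rho>" "\<rho> < r" "\<bar>\<rho> - r\<bar> < d" using d r by (auto simp: \<rho>_def min_def)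
    then have "\<bar>rate_exponent \<alpha> \<rho> - rate_exponent \<alpha> r\<bar> < c" using d by blast
    then have "rate_exponent \<alpha> \<rho> < 0" "a < rate_exponent \<alpha> \<rho> - (rate_exponent \<alpha> r - a) / 4"
      unfolding c_def by (rule near_value_bounds[OF a])+
    moreover have "0 < (rate_exponent \<alpha> r - a) / 4" using a by simp
    ultimately show ?thesis using \<rho>(1,2) by blast
  qed
  \<comment> \<open>Positivity has to be secured separately, since taking logarithms in either bound
    presupposes it.\<close>
  have pos: "eventually (\<lambda>p. 0 < risk_gap p) sequentially"
  proof -
    have "rate_exponent \<alpha> r - 1 < rate_exponent \<alpha> r" by simp
    from lower[OF this] obtain \<rho> \<epsilon> where \<rho>: "0 < \<rho>" "\<rho> < r" "rate_exponent \<alpha> \<rho> < 0" "0 < \<epsilon>"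
        "rate_exponent \<alpha> r - 1 < rate_exponent \<alpha> \<rho> - \<epsilon>"
      by blast
    show ?thesis
      using risk_gap_lower[OF \<rho>(1-4)] eventually_gt_at_top[of "0::nat"]
    proof eventually_elim
      case (elim p)
      have "0 < p powr (rate_exponent \<alpha> \<rho> - \<epsilon>) / 640" using elim(2) by simp
      also have "\<dots> \<le> risk_gap p" by (rule elim(1))
      finally show ?case .
    qed
  qed
  fix a
  {
    assume a: "a < rate_exponent \<alpha> r"
    then obtain \<rho> \<epsilon> where \<rho>: "0 < \<rho>" "\<rho> < r" "rate_exponent \<alpha> \<rho> < 0" "0 < \<epsilon>" "a < rate_exponent \<alpha> \<rho> - \<epsilon>"
      using lower by blast
    have ev: "eventually (\<lambda>p::nat. ln 640 < (rate_exponent \<alpha> \<rho> - \<epsilon> - a) * ln p) sequentially"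
      by (rule const_less_mult_ln) (use \<rho>(5) in simp)
    show "eventually (\<lambda>p. a < rate n \<mu> \<alpha> r p) sequentially"
      using ev risk_gap_lower[OF \<rho>(1-4)] eventually_ge_at_top[of 2] pos
    proof eventually_elim
      case (elim p)
      have l: "ln p > 0" using elim(3) by simp
      have "ln (p powr (rate_exponent \<alpha> \<rho> - \<epsilon>) / 640) \<le> ln (risk_gap p)"
        using elim(2,3,4) by (subst ln_le_cancel_iff) simp_all
      then have "(rate_exponent \<alpha> \<rho> - \<epsilon>) * ln p - ln 640 \<le> ln (risk_gap p)"
        using elim(3) by (simp add: ln_div ln_powr)
      then have "a * ln p < ln (risk_gap p)" using elim(1) by (simp add: algebra_simps)
      then show ?case using l by (simp add: rate_eq pos_less_divide_eq)
    qed
  next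
    assume a: "rate_exponent \<alpha> r < a"
    define c where "c = min (- rate_exponent \<alpha> r) (a - rate_exponent \<alpha> r)"
    have "c > 0" using a e by (simp add: c_def)
    then obtain d where d: "d > 0" "\<And>x. \<bar>x - r\<bar> < d \<Longrightarrow> \<bar>rate_exponent \<alpha> x - rate_exponent \<alpha> r\<bar> < c"
      using cont by blast
    define \<rho> where "\<rho> = r + min d (1 - r) / 2"
    have \<rho>: "r < \<rho>" "\<rho> < 1" "\<bar>\<rho> - r\<bar> < d" using d r by (auto simp: \<rho>_def min_def field_simps)
    then have "\<bar>rate_exponent \<alpha> \<rho> - rate_exponent \<alpha> r\<bar> < c" using d by blast
    then have e\<rho>: "rate_exponent \<alpha> \<rho> < 0" and a\<rho>: "rate_exponent \<alpha> \<rho> < a"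
      unfolding c_def by linarith+
    have ev: "eventually (\<lambda>p::nat. ln 6 < (a - rate_exponent \<alpha> \<rho>) * ln p) sequentially"
      by (rule const_less_mult_ln) (use a\<rho> in simp)
    show "eventually (\<lambda>p. rate n \<mu> \<alpha> r p < a) sequentially"
      using ev risk_gap_upper[OF \<rho>(1,2) e\<rho>] eventually_ge_at_top[of 2] pos
    proof eventually_elim
      case (elim p)
      have l: "ln p > 0" using elim(3) by simp
      have "ln (risk_gap p) \<le> ln (6 * p powr rate_exponent \<alpha> \<rho>)"
        using elim(2,3,4) by (subst ln_le_cancel_iff) simp_all
      then have "ln (risk_gap p) \<le> ln 6 + rate_exponent \<alpha> \<rho> * ln p"
        using elim(3) by (simp add: ln_mult ln_powr)
      then have "ln (risk_gap p) < a * ln p" using elim(1) by (simp add: algebra_simps)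
      then show ?case using l by (simp add: rate_eq pos_divide_less_eq)
    qed
  }
qed

end

section \<open>The detection boundary and the two design classes\<close>

lemma rate_exponent_cases:
  assumes "0 < r"
  shows "4 * r \<le> 1 \<Longrightarrow> rate_exponent \<alpha> r = r - (\<alpha> - 1 / 2)"
    and "4 * r > 1 \<Longrightarrow> rate_exponent \<alpha> r = 1 - \<alpha> - (1 - sqrt r)\<^sup>2"
proof -
  have s: "sqrt (4 * r) = 2 * sqrt r" "(sqrt r)\<^sup>2 = r" using assms by (simp_all add: real_sqrt_mult)
  show "rate_exponent \<alpha> r = r - (\<alpha> - 1 / 2)" if "4 * r \<le> 1"
  proof -
    have "2 * sqrt r \<le> 1" using real_sqrt_le_mono[OF that] s by simp
    then show ?thesis by (simp add: rate_exponent_def)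
  qed
  show "rate_exponent \<alpha> r = 1 - \<alpha> - (1 - sqrt r)\<^sup>2" if "4 * r > 1"
  proof -
    have "1 < 2 * sqrt r" using real_sqrt_less_mono[OF that] s by simp
    then show ?thesis using s(2) by (simp add: rate_exponent_def power2_eq_square field_simps)
  qed
qed

text \<open>Below the boundary the exponent is negative. If 4 r \<le> 1 the claim is r < \<alpha> -
  1/2, which for \<alpha> > 3/4 follows from r \<le> 1/4; at \<alpha> = 3/4 strictness comes from
  the value 1/4 of \<open>rho_star\<close>.\<close>

lemma below_rho_star:
  assumes \<alpha>: "1 / 2 < \<alpha>" "\<alpha> < 1" and r: "0 < r" "r < rho_star \<alpha>"
  shows "r < 1" "rate_exponent \<alpha> r < 0"
proof -
  have s1: "0 < sqrt (1 - \<alpha>)" "sqrt (1 - \<alpha>) < 1" using \<alpha> by auto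
  have rs: "rho_star \<alpha> < 1"
  proof (cases "\<alpha> < 3 / 4")
    case False
    have "(1 - sqrt (1 - \<alpha>))\<^sup>2 < 1" using s1 by (intro power_less_one_iff[THEN iffD2]) auto
    then show ?thesis using False by (simp add: rho_star_def)
  qed (simp add: rho_star_def)
  then show "r < 1" using r by simp
  show "rate_exponent \<alpha> r < 0"
  proof (cases "4 * r \<le> 1")
    case True
    have "r < \<alpha> - 1 / 2"
    proof (cases "\<alpha> < 3 / 4")
      case False
      show ?thesis
      proof (cases "\<alpha> = 3 / 4")
        case True
        have "sqrt (1 / 4) = (1 / 2 :: real)" by (rule real_sqrt_unique) (simp_all add: power2_eq_square)
        note q = this
        show ?thesis using r True by (simp add: rho_star_def power2_eq_square q)
      qed (use True False in auto)
    qed (use r in \<open>simp add: rho_star_def\<close>)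
    then show ?thesis using rate_exponent_cases(1)[OF r(1) True] by simp
  next
    case False
    \<comment> \<open>For smaller \<alpha> the boundary \<alpha> - 1/2 lies below 1/4, hence below
      \<open>r\<close>.\<close>
    have a: "3 / 4 \<le> \<alpha>" using False r by (auto simp: rho_star_def split: if_splits)
    then have "r < (1 - sqrt (1 - \<alpha>))\<^sup>2" using r by (simp add: rho_star_def)
    then have "sqrt r < 1 - sqrt (1 - \<alpha>)" using s1 r real_less_lsqrt real_sqrt_less_mono by fastforce
    then have "sqrt (1 - \<alpha>) < 1 - sqrt r" by simp
    then have "(sqrt (1 - \<alpha>))\<^sup>2 < (1 - sqrt r)\<^sup>2" using s1 by (intro power_strict_mono) auto
    then have "1 - \<alpha> < (1 - sqrt r)\<^sup>2" using \<alpha> by simp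
    then show ?thesis using rate_exponent_cases(2)[OF r(1)] False by simp
  qed
qed

text \<open>\<open>N\<close> is the multiple of p^2 log p from which the exponential bound is at
  most p^(-(M + 3)). Two of the three spare powers cancel the p^2 of the union bound, and the third
  absorbs the constant 4 as soon as p \<ge> 4.\<close>

lemma SubG_design_eventually_good:
  fixes \<kappa> M :: real
  assumes des: "\<And>p. SubG_design \<sigma>2 (n p) p (\<mu> p)" and kap: "0 < \<kappa>"
    and gr: "filterlim (\<lambda>p. real (n p) / (real p ^ 2 * ln p)) at_top sequentially"
  shows "eventually (\<lambda>p. measure (\<mu> p) {X \<in> space (\<mu> p). \<not> good_design (n p) p (\<kappa> / p) X} \<le> p powr (- M)) sequentially"
proof -
  define C where "C = 4 * bernstein_const (max 1 \<sigma>2)"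
  have C: "0 < C" by (simp add: C_def bernstein_const_def)
  define N where "N = (M + 3) * C / \<kappa>\<^sup>2"
  have ev1: "eventually (\<lambda>p. max N 1 \<le> real (n p) / (real p ^ 2 * ln p)) sequentially"
    using gr unfolding filterlim_at_top by blast
  have "0 < bernstein_const (max 1 \<sigma>2) / (4 * max 1 \<sigma>2)" using C by (simp add: C_def)
  moreover have "eventually (\<lambda>p::nat. \<kappa> / p \<le> c) sequentially" if "0 < c" for c :: real
    using that by real_asymp
  ultimately have ev2: "eventually (\<lambda>p::nat. \<kappa> / p \<le> bernstein_const (max 1 \<sigma>2) / (4 * max 1 \<sigma>2)) sequentially"
    by blast
  show ?thesis
    using ev1 ev2 eventually_ge_at_top[of 4]
  proof eventually_elim
    case (elim p)
    have l: "ln p > 0" using elim(3) by simp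
    have pl: "0 < real p ^ 2 * ln p" using l elim(3) by simp
    have "max N 1 * (real p ^ 2 * ln p) \<le> n p" using elim(1) pl by (simp add: le_divide_eq)
    moreover have "N * (real p ^ 2 * ln p) \<le> max N 1 * (real p ^ 2 * ln p)"
      "1 * (real p ^ 2 * ln p) \<le> max N 1 * (real p ^ 2 * ln p)"
      using pl by (intro mult_right_mono; simp)+
    ultimately have n: "N * (real p ^ 2 * ln p) \<le> n p" "1 * (real p ^ 2 * ln p) \<le> n p" by linarith+
    then have n0: "0 < n p" using pl by (metis less_le_trans mult_1 of_nat_0_less_iff)
    obtain \<nu> where \<nu>: "subG_row \<sigma>2 p \<nu>" "\<mu> p = PiM {..<n p} (\<lambda>_. \<nu>)" using des[of p] by (auto simp: SubG_design_def)
    have "measure (\<mu> p) {X \<in> space (\<mu> p). \<not> good_design (n p) p (\<kappa> / p) X} \<le> 4 * (real p)\<^sup>2 * exp (- real (n p) * (\<kappa> / p)\<^sup>2 / C)"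
      unfolding \<nu>(2) C_def
      by (rule subG_design_concentration[OF \<nu>(1) n0]) (use kap elim in auto)
    also have "\<dots> \<le> 4 * (real p)\<^sup>2 * exp (- (M + 3) * ln p)"
    proof (intro mult_left_mono)
      have "(M + 3) * ln p = N * (real p ^ 2 * ln p) * (\<kappa> / p)\<^sup>2 / C"
        using C kap elim(3) by (simp add: N_def power_divide)
      also have "\<dots> \<le> n p * (\<kappa> / p)\<^sup>2 / C"
        using n C by (intro divide_right_mono mult_right_mono) auto
      finally show "exp (- real (n p) * (\<kappa> / p)\<^sup>2 / C) \<le> exp (- (M + 3) * ln p)"
        by (simp add: algebra_simps)
    qed simp
    also have "exp (- (M + 3) * ln p) = p powr (- (M + 3))" using elim(3) by (simp only: powr_def) simp
    also have "4 * (real p)\<^sup>2 * p powr (- (M + 3)) = 4 * (p powr 2 * p powr (- (M + 3)))"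
      using elim(3) by (simp add: powr_numeral)
    also have "\<dots> = 4 * p powr (- 1) * p powr (- M)"
    proof -
      have "2 + - (M + 3) = - 1 + - M" by simp
      then show ?thesis by (simp only: mult.assoc powr_add[symmetric])
    qed
    also have "\<dots> \<le> 1 * p powr (- M)"
      using elim(3) by (intro mult_right_mono) (auto simp: powr_minus field_simps)
    finally show ?case by simp
  qed
qed

lemma Orth_design_good:
  assumes des: "Orth_design n p \<mu>" and n: "0 < n" and "0 < \<kappa>"
  shows "measure \<mu> {X \<in> space \<mu>. \<not> good_design n p (\<kappa> / p) X} = 0"
proof -
  interpret prob_space \<mu> using des by (simp add: Orth_design_def)
  have "AE X in \<mu>. good_design n p (\<kappa> / p) X"
    using des unfolding Orth_design_def good_design_def
    by (elim conjE, elim eventually_mono) (use n assms(3) in auto)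
  then have AE: "AE X in \<mu>. X \<notin> space \<mu> - {X \<in> space \<mu>. good_design n p (\<kappa> / p) X}"
    by eventually_elim auto
  have "{X \<in> space \<mu>. good_design n p (\<kappa> / p) X} \<in> sets \<mu>"
    by (rule good_design_event) (use des in \<open>simp_all add: Orth_design_def\<close>)
  then have "prob (space \<mu> - {X \<in> space \<mu>. good_design n p (\<kappa> / p) X}) = 0"
    using AE by (subst prob_eq_0) auto
  moreover have "{X \<in> space \<mu>. \<not> good_design n p (\<kappa> / p) X} = space \<mu> - {X \<in> space \<mu>. good_design n p (\<kappa> / p) X}"
    by auto
  ultimately show ?thesis by (simp only:)
qed

theorem mainTheorem2:
  fixes \<alpha> r \<sigma>2 :: real
  assumes "1/2 < \<alpha>" and "\<alpha> < 1" and "0 < r" and "r < rho_star \<alpha>"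
  shows
    "(\<forall>(n :: nat \<Rightarrow> nat) \<mu>. (\<forall>p. SubG_design \<sigma>2 (n p) p (\<mu> p)) \<longrightarrow>
        ((4 * r \<le> 1 \<and>
          filterlim (\<lambda>p. real (n p) / (real p powr (13/6) * ln (real p))) at_top sequentially)
           \<longrightarrow> (rate n \<mu> \<alpha> r \<longlongrightarrow> r - (\<alpha> - 1/2)) sequentially) \<and>
        ((4 * r > 1 \<and>
          filterlim (\<lambda>p. real (n p) / (real p ^ 2 * ln (real p))) at_top sequentially)
           \<longrightarrow> (rate n \<mu> \<alpha> r \<longlongrightarrow> 1 - \<alpha> - (1 - sqrt r)\<^sup>2) sequentially)) \<and>
     (\<forall>(n :: nat \<Rightarrow> nat) \<mu>. (\<forall>p. p \<le> n p \<and> Orth_design (n p) p (\<mu> p)) \<longrightarrow>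
        (4 * r \<le> 1 \<longrightarrow> (rate n \<mu> \<alpha> r \<longlongrightarrow> r - (\<alpha> - 1/2)) sequentially) \<and>
        (4 * r > 1 \<longrightarrow> (rate n \<mu> \<alpha> r \<longlongrightarrow> 1 - \<alpha> - (1 - sqrt r)\<^sup>2) sequentially))"
proof -
  note r1 = below_rho_star[OF assms]
  have subG: "(rate n \<mu> \<alpha> r \<longlongrightarrow> rate_exponent \<alpha> r) sequentially"
    if des: "\<forall>p. SubG_design \<sigma>2 (n p) p (\<mu> p)"
      and gr: "filterlim (\<lambda>p. real (n p) / (real p ^ 2 * ln p)) at_top sequentially" for n \<mu>
  proof (rule rate_tendsto)
    fix p
    obtain \<nu> where \<nu>: "subG_row \<sigma>2 p \<nu>" "\<mu> p = PiM {..<n p} (\<lambda>_. \<nu>)"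
      using des by (auto simp: SubG_design_def)
    show "prob_space (\<mu> p)"
      unfolding \<nu>(2) using \<nu>(1) by (intro prob_space_PiM) (simp add: subG_row_def)
    show "sets (\<mu> p) = sets (Xspace (n p) p)"
      unfolding \<nu>(2) Xspace_def using \<nu>(1) by (intro sets_PiM_cong) (simp_all add: subG_row_def)
  next
    have "eventually (\<lambda>p. 1 \<le> real (n p) / (real p ^ 2 * ln p)) sequentially"
      using gr unfolding filterlim_at_top by blast
    then show "eventually (\<lambda>p. 0 < n p) sequentially"
      by eventually_elim (auto intro: Nat.gr0I)
    show "eventually (\<lambda>p. measure (\<mu> p) {X \<in> space (\<mu> p). \<not> good_design (n p) p (\<kappa> / p) X} \<le> p powr (- M)) sequentially"
      if "0 < \<kappa>" for \<kappa> M :: real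
      by (rule SubG_design_eventually_good[OF _ that gr]) (use des in blast)
  qed (use assms r1 in auto)
  have orth: "(rate n \<mu> \<alpha> r \<longlongrightarrow> rate_exponent \<alpha> r) sequentially"
    if des: "\<forall>p. p \<le> n p \<and> Orth_design (n p) p (\<mu> p)" for n \<mu>
  proof (rule rate_tendsto)
    show "prob_space (\<mu> p)" "sets (\<mu> p) = sets (Xspace (n p) p)" for p
      using des by (auto simp: Orth_design_def)
    show n0: "eventually (\<lambda>p. 0 < n p) sequentially"
      using eventually_gt_at_top[of 0] by eventually_elim (use des less_le_trans in blast)
    show "eventually (\<lambda>p. measure (\<mu> p) {X \<in> space (\<mu> p). \<not> good_design (n p) p (\<kappa> / p) X} \<le> p powr (- M)) sequentially"
      if "0 < \<kappa>" for \<kappa> M :: real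
      using n0 by eventually_elim (use des that in \<open>simp add: Orth_design_good\<close>)
  qed (use assms r1 in auto)
  have weaken: "filterlim (\<lambda>p. real (n p) / (real p ^ 2 * ln (real p))) at_top sequentially"
    if gr: "filterlim (\<lambda>p. real (n p) / (real p powr (13/6) * ln (real p))) at_top sequentially" for n :: "nat \<Rightarrow> nat"
  proof (rule filterlim_at_top_mono[OF gr])
    show "eventually (\<lambda>p. real (n p) / (real p powr (13/6) * ln (real p)) \<le> real (n p) / (real p ^ 2 * ln (real p))) sequentially"
      using eventually_ge_at_top[of 2]
    proof eventually_elim
      case (elim p)
      have "real p powr 2 \<le> real p powr (13/6)" using elim by (intro powr_mono) auto
      then have "real p ^ 2 \<le> real p powr (13/6)" using elim by (simp add: powr_numeral)
      then show ?case using elim by (intro divide_left_mono mult_right_mono mult_pos_pos) auto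
    qed
  qed
  note low = rate_exponent_cases(1)[OF assms(3), of \<alpha>] and high = rate_exponent_cases(2)[OF assms(3), of \<alpha>]
  show ?thesis
  proof (intro conjI allI impI; (elim conjE)?)
    fix n \<mu> assume "\<forall>p. SubG_design \<sigma>2 (n p) p (\<mu> p)" "4 * r \<le> 1"
      "filterlim (\<lambda>p. real (n p) / (real p powr (13/6) * ln (real p))) at_top sequentially"
    from subG[OF this(1) weaken[OF this(3)]] low[OF this(2)]
    show "(rate n \<mu> \<alpha> r \<longlongrightarrow> r - (\<alpha> - 1/2)) sequentially" by (simp only:)
  next
    fix n \<mu> assume "\<forall>p. SubG_design \<sigma>2 (n p) p (\<mu> p)" "4 * r > 1"
      "filterlim (\<lambda>p. real (n p) / (real p ^ 2 * ln (real p))) at_top sequentially"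
    from subG[OF this(1,3)] high[OF this(2)]
    show "(rate n \<mu> \<alpha> r \<longlongrightarrow> 1 - \<alpha> - (1 - sqrt r)\<^sup>2) sequentially" by (simp only:)
  next
    fix n \<mu> assume "\<forall>p. p \<le> n p \<and> Orth_design (n p) p (\<mu> p)" "4 * r \<le> 1"
    from orth[OF this(1)] low[OF this(2)]
    show "(rate n \<mu> \<alpha> r \<longlongrightarrow> r - (\<alpha> - 1/2)) sequentially" by (simp only:)
  next
    fix n \<mu> assume "\<forall>p. p \<le> n p \<and> Orth_design (n p) p (\<mu> p)" "4 * r > 1"
    from orth[OF this(1)] high[OF this(2)]
    show "(rate n \<mu> \<alpha> r \<longlongrightarrow> 1 - \<alpha> - (1 - sqrt r)\<^sup>2) sequentially" by (simp only:)
  qed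
qed

end
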